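(* Let $\alpha,\beta>-1$, let $\{\zeta_n\}_{n>m}$ be a sequence of complex numbers with limit $\zeta\in\mathbb{C}\setminus[-1,1]$, where $m\in\mathbb{N}$, let $\mu\in\mathcal{P}_m(\alpha,\beta)$ with $d\mu=\rho^{-1}d\mu_{\alpha,\beta}$, and let $\{Q_n\}_{n>m}$ be the sequence of monic orthogonal polynomials with respect to the pair $(\mathcal{L}^{(\alpha,\beta)},\mu)$ such that $Q_n(\zeta_n)=0$. Then: 1. Uniformly on compact subsets of $\Omega=\{z\in\mathbb{C}:|\varphi(z)|>|\varphi(\zeta)|\}$ (i.e. the exterior of the ellipse $\mathcal{E}(\zeta)$), $$\lim_{n\to\infty}\frac{Q_n(z)}{P_n^{(\alpha,\beta)}(z)}=\phi_m^2\,\Phi(\rho,z).$$ 2. Uniformly on compact subsets of $\Omega=\{z\in\mathbb{C}:|\varphi(z)|<|\varphi(\zeta)|\}\setminus[-1,1]$, $$\lim_{n\to\infty}\frac{Q_n(z)}{P_n^{(\alpha,\beta)}(\zeta_n)}=-\phi_m^2\,\Phi(\rho,\zeta).$$ If $\delta(\zeta)=\inf_{-1\le x\le1}|\zeta-x|>2$, then this last limit holds (uniformly on compact subsets) for $\Omega=\{z\in\mathbb{C}:|\varphi(z)|<|\varphi(\zeta)|\}$ (i.e. the interior of the ellipse $\mathcal{E}(\zeta)$).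
   Context: For $\alpha,\beta>-1$ let $d\mu_{\alpha,\beta}(x)=(1-x)^\alpha(1+x)^\beta dx$ on $[-1,1]$, let $P_n^{(\alpha,\beta)}$ be the $n$th monic orthogonal (Jacobi) polynomial with respect to $\mu_{\alpha,\beta}$, let $$\mathcal{L}^{(\alpha,\beta)}[f]=(1-x^2)f''+(\beta-\alpha-(\alpha+\beta+2)x)f'$$ be the Jacobi differential operator on polynomials, and $\lambda_n=-n(1+n+\alpha+\beta)$. The class $\mathcal{P}_m(\alpha,\beta)$ consists of the finite positive Borel measures $\mu$ supported on $[-1,1]$ for which there is a polynomial $\rho$ of degree $m$, nonnegative on $[-1,1]$, with $d\mu(x)=\rho^{-1}(x)\,d\mu_{\alpha,\beta}(x)$. Let $L_n$ be the $n$th monic orthogonal polynomial with respect to $\mu$. For $\mu\in\mathcal{P}_m(\alpha,\beta)$ and each $n>m$ there is a monic polynomial $Q_n$ of degree $n$, unique up to an additive constant, such that $\int\mathcal{L}^{(\alpha,\beta)}[Q_n](x)\,x^k\,d\mu(x)=0$ for $0\le k\le n-1$; equivalently $\mathcal{L}^{(\alpha,\beta)}[Q_n]=\lambda_nL_n$. "The sequence of monic orthogonal polynomials with respect to $(\mathcal{L}^{(\alpha,\beta)},\mu)$ such that $Q_n(\zeta_n)=0$" means that the additive constant is fixed by $Q_n(\zeta_n)=0$. $\varphi(z)=z+\sqrt{z^2-1}$, with the branch of the square root for which $|\varphi(z)|>1$ on $\mathbb{C}\setminus[-1,1]$; on $[-1,1]$ one has $|\varphi|=1$, and $\varphi(\pm1)=\pm1$.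 The ellipse is $\mathcal{E}(\zeta)=\{z\in\mathbb{C}:z=\cosh(\eta_\zeta+i\theta),\ 0\le\theta<2\pi\}$ with $\eta_\zeta=\ln|\varphi(\zeta)|$. If $\nu_1,\dots,\nu_m$ are the zeros of $\rho$ (with multiplicity; finiteness of $\mu$ forces each to lie in $\mathbb{C}\setminus(-1,1)$), then for $z\in\mathbb{C}\setminus[-1,1]$ $$\Phi(\rho,z)=\prod_{i=1}^m\frac{z-\nu_i}{\varphi(z)-\varphi(\nu_i)},\qquad \phi_m=2^m\exp\left(\frac1{2\pi}\int_{-1}^1\frac{\log\rho(t)}{\sqrt{1-t^2}}\,dt\right),$$ with removable singularities of $\Phi(\rho,\cdot)$ at the $\nu_i$ filled in by continuity.
   Formalization: The constant φ_m² in both limits is replaced by 2^m: as printed the claim fails, since replacing ρ by cρ leaves Q_n, P_n and Φ unchanged but multiplies φ_m² by c (for m=0, ρ=2 the limit is 1, not 2). When φ_m²=2^m the two agree. *)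

theory Defs
  imports "HOL-Analysis.Analysis" "HOL-Computational_Algebra.Computational_Algebra"
begin

text \<open>The values given to the weight at the points \<open>-1\<close> and \<open>1\<close> are irrelevant (a null set).\<close>

definition jacobi_measure :: "real \<Rightarrow> real \<Rightarrow> real measure" where
  "jacobi_measure \<alpha> \<beta> =
     density lborel (\<lambda>x. ennreal (indicator {-1..1} x * ((1 - x) powr \<alpha> * (1 + x) powr \<beta>)))"

definition monic_orthogonal_poly :: "real measure \<Rightarrow> nat \<Rightarrow> real poly \<Rightarrow> bool" where
  "monic_orthogonal_poly \<mu> n p \<longleftrightarrow>
     degree p = n \<and> lead_coeff p = 1 \<and> (\<forall>k<n. (\<integral>x. poly p x * x ^ k \<partial>\<mu>) = 0)"

definition jacobi_op :: "real \<Rightarrow> real \<Rightarrow> complex poly \<Rightarrow> complex poly" where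
  "jacobi_op \<alpha> \<beta> f =
     [:1, 0, -1:] * pderiv (pderiv f)
     + [:complex_of_real (\<beta> - \<alpha>), - complex_of_real (\<alpha> + \<beta> + 2):] * pderiv f"

text \<open>
  The polynomials have complex coefficients because the additive constant, which is later fixed by
  a condition at a complex point, may be complex.
\<close>

definition monic_jacobi_op_orthogonal_poly ::
    "real \<Rightarrow> real \<Rightarrow> real measure \<Rightarrow> nat \<Rightarrow> complex poly \<Rightarrow> bool" where
  "monic_jacobi_op_orthogonal_poly \<alpha> \<beta> \<mu> n q \<longleftrightarrow>
     degree q = n \<and> lead_coeff q = 1 \<and>
     (\<forall>k<n. (\<integral>x. poly (jacobi_op \<alpha> \<beta> q) (complex_of_real x) * complex_of_real x ^ k \<partial>\<mu>) = 0)"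

text \<open>
  The condition \<open>\<rho> \<noteq> 0\<close> is part of having degree \<open>m\<close>; it matters only for \<open>m = 0\<close>, where the
  zero polynomial also has library degree \<open>0\<close>. The zeros of \<open>\<rho>\<close> form a null set, so the convention
  \<open>1 / 0 = 0\<close> does not affect the density.
\<close>

definition jacobi_divided :: "real \<Rightarrow> real \<Rightarrow> nat \<Rightarrow> real poly \<Rightarrow> real measure \<Rightarrow> bool" where
  "jacobi_divided \<alpha> \<beta> m \<rho> \<mu> \<longleftrightarrow>
     \<rho> \<noteq> 0 \<and> degree \<rho> = m \<and> (\<forall>x\<in>{-1..1}. 0 \<le> poly \<rho> x) \<and>
     \<mu> = density (jacobi_measure \<alpha> \<beta>) (\<lambda>x. ennreal (1 / poly \<rho> x))"

definition jacobi_class :: "nat \<Rightarrow> real \<Rightarrow> real \<Rightarrow> real measure set" where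
  "jacobi_class m \<alpha> \<beta> =
     {\<mu>. sets \<mu> = sets borel \<and> finite_measure \<mu> \<and> emeasure \<mu> (- {-1..1}) = 0 \<and>
         (\<exists>\<rho>. jacobi_divided \<alpha> \<beta> m \<rho> \<mu>)}"

text \<open>
  The two values of \<open>z + sqrt (z\<^sup>2 - 1)\<close> have product \<open>1\<close>, so the test selects the one of modulus
  greater than \<open>1\<close> when \<open>z\<close> is not in \<open>[-1, 1]\<close>. On \<open>[-1, 1]\<close> both have modulus \<open>1\<close>.
\<close>

definition joukowski :: "complex \<Rightarrow> complex" where
  "joukowski z =
     (if cmod (z + csqrt (z\<^sup>2 - 1)) \<ge> 1 then z + csqrt (z\<^sup>2 - 1) else z - csqrt (z\<^sup>2 - 1))"

text \<open>
  The value at \<open>z = \<nu>\<close> fills in the removable singularity; it is used only for \<open>z\<close> outside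
  \<open>[-1, 1]\<close>, where the limit exists.
\<close>

definition Phi_factor :: "complex \<Rightarrow> complex \<Rightarrow> complex" where
  "Phi_factor \<nu> z =
     (if z = \<nu> then Lim (at \<nu>) (\<lambda>w. (w - \<nu>) / (joukowski w - joukowski \<nu>))
      else (z - \<nu>) / (joukowski z - joukowski \<nu>))"

text \<open>
  The Szego function of \<open>\<rho>\<close> on the exterior of \<open>[-1, 1]\<close> is \<open>D(z) = c * Phi \<rho> z\<close> with
  \<open>c = 2 ^ m * exp ((1 / (2 * pi)) * (\<integral> ln \<rho>(t) / sqrt (1 - t\<^sup>2) dt))\<close>, where \<open>m\<close> is the degree
  of \<open>\<rho>\<close> and the integral is over \<open>[-1, 1]\<close>. Since \<open>Phi \<rho> z\<close> tends to \<open>2 powi (- m)\<close> as \<open>z\<close> tends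
  to infinity, the ratio \<open>D(z) / D(\<infinity>)\<close> governing quotients of monic orthogonal polynomials is
  \<open>2 ^ m * Phi \<rho> z\<close>. It is unchanged when \<open>\<rho>\<close> is multiplied by a positive constant, as monic
  orthogonal polynomials are, whereas \<open>c\<^sup>2 * Phi \<rho> z\<close> is not.
\<close>

definition Phi :: "real poly \<Rightarrow> complex \<Rightarrow> complex" where
  "Phi \<rho> z = (\<Prod>\<nu>\<in>#proots (map_poly complex_of_real \<rho>). Phi_factor \<nu> z)"

end

theory Submission
  imports Defs "HOL-Complex_Analysis.Conformal_Mappings" "HOL-Real_Asymp.Real_Asymp"
begin

text \<open>
  With \<open>p n\<close> the orthonormal Jacobi polynomials and \<open>l n\<close> the orthogonal polynomials of \<open>\<mu>\<close> scaled to
  the leading coefficient of \<open>p n\<close>, only \<open>p n, ..., p (n - m)\<close> occur in \<open>l n\<close>, because \<open>\<rho> d\<mu>\<close> is the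
  Jacobi measure. As \<open>L[p k] = \<lambda>\<^sub>k p k\<close>, dividing each term by \<open>\<lambda>\<^sub>k\<close> inverts the operator, so \<open>Q n\<close> is,
  up to a constant fixed by its zero, a combination of \<open>m + 1\<close> consecutive Jacobi polynomials. Two
  asymptotic facts then suffice.

  The first is \<open>p (n - 1) / p n \<rightarrow> 1 / \<phi>\<close> off \<open>[-1, 1]\<close>. The three-term recurrence, whose coefficients
  follow from the eigenvalue equation, makes \<open>p (n - 1) - p n / \<phi>\<close> satisfy a linear recursion with
  factor \<open>1 / \<phi>\<close> and a small error, and the Christoffel-Darboux identity bounds \<open>p k\<close> by a multiple
  of \<open>p n\<close> for \<open>k \<le> n\<close>.

  The second is that the coefficient of \<open>p (n - k)\<close> in \<open>l n\<close> tends to the \<open>k\<close>th coefficient of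
  \<open>B(t) = \<Prod>(1 - t / \<phi>(\<nu>))\<close>, where \<open>\<rho>(cos \<theta>) = C |B(exp (i \<theta>))|\<^sup>2\<close> and \<open>B(1 / \<phi>) = 2\<^sup>m \<Phi>\<close>. If \<open>B S\<close> is
  close to \<open>1\<close> in mean square, then \<open>\<rho> \<Sum>\<^sub>j s\<^sub>j p (n + j)\<close> has inner product \<open>1\<close> with \<open>l n\<close> and squared norm
  close to \<open>C\<close>, while by minimality that of \<open>l n\<close> is at most about \<open>1 / C\<close>.
  Near-equality in Cauchy-Schwarz makes the two nearly proportional. All norms reduce to limits of
  integrals of polynomials times \<open>p i p j\<close>, that is, to means over the unit circle.

  The interior limit holds up to \<open>[-1, 1]\<close> by the maximum modulus principle.
\<close>

section \<open>Orthonormal polynomials of a positive functional\<close>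

text \<open>The obstacle is that \<open>1 / \<rho>\<close> may be singular at the end points.
  \<open>J\<close> can be computed through \<open>I\<close> only on multiples of
  \<open>\<rho>\<close>, so every norm that has to be evaluated is brought into that form: the test
  polynomial carries the factor \<open>\<rho>\<close> outright, while the competitor for the minimum
  carries a factor \<open>\<rho>1\<close> vanishing at the end-point zeros, and the square of
  \<open>\<rho>1\<close> is dominated by a polynomial multiple of \<open>\<rho>\<close>. The same
  zeros put zeros of \<open>B\<close> on the unit circle, where \<open>1 / B\<close> is unbounded.
  Hence \<open>B S\<close> approaches \<open>1\<close> only in mean square, and \<open>S\<close> is
  built with Cesaro weights. Only quotients of values of \<open>p n\<close> enter. One quotient
  limit also yields geometric growth bounds, and the condition at \<open>\<zeta>s n\<close> then
  only asks which of \<open>p n z\<close> and \<open>p n (\<zeta>s n)\<close> is geometrically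
  larger; the level sets of \<open>cmod (joukowski z)\<close> decide this. The functionals act on
  real polynomials although \<open>\<zeta>s n\<close> is complex, so \<open>Q n\<close> is split
  into real and imaginary parts; the imaginary part turns out to be constant.\<close>

lemma real_poly_eqI: "(\<And>x. poly p x = poly q x) \<Longrightarrow> p = q" for p q :: "real poly"
  using poly_eq_poly_eq_iff by blast

text \<open>Positivity is asked only of polynomials that are nonnegative on \<open>[-1, 1]\<close>.
  This is how the support of the measure enters, and it makes multiplication by \<open>x\<close> a
  contraction.\<close>

locale positive_functional =
  fixes I :: "real poly \<Rightarrow> real"
  assumes add: "I (p + q) = I p + I q"
    and smult: "I (smult c p) = c * I p"
    and nonneg: "(\<And>x. x \<in> {-1..1} \<Longrightarrow> 0 \<le> poly p x) \<Longrightarrow> 0 \<le> I p"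
begin

lemma zero: "I 0 = 0"
  using smult[of 0 0] by simp

lemma uminus: "I (- p) = - I p"
  using smult[of "-1" p] by simp

lemma diff: "I (p - q) = I p - I q"
  using add[of p "- q"] uminus[of q] by simp

lemma sum: "I (\<Sum>x\<in>A. f x) = (\<Sum>x\<in>A. I (f x))"
  by (induction A rule: infinite_finite_induct) (auto simp: zero add)

lemma mono: "(\<And>x. x \<in> {-1..1} \<Longrightarrow> poly p x \<le> poly q x) \<Longrightarrow> I p \<le> I q"
  using nonneg[of "q - p"] by (simp add: diff)

lemma cauchy_schwarz: "(I (p * q))\<^sup>2 \<le> I (p * p) * I (q * q)"
proof -
  define a b c where "a = I (p * p)" and "b = I (p * q)" and "c = I (q * q)"
  have quad: "0 \<le> a * x\<^sup>2 + 2 * b * x * y + c * y\<^sup>2" for x y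
  proof -
    have "0 \<le> I ((smult x p + smult y q) * (smult x p + smult y q))"
      by (rule nonneg) simp
    also have "(smult x p + smult y q) * (smult x p + smult y q)
        = smult (x\<^sup>2) (p * p) + smult (2 * x * y) (p * q) + smult (y\<^sup>2) (q * q)"
      by (rule real_poly_eqI) (simp add: algebra_simps power2_eq_square)
    finally show ?thesis by (simp add: add smult a_def b_def c_def algebra_simps)
  qed
  have c: "0 \<le> c" using quad[of 0 1] by simp
  show ?thesis
  proof (cases "c = 0")
    case False
    have "0 \<le> a * c\<^sup>2 + 2 * b * c * (-b) + c * (-b)\<^sup>2" by (rule quad)
    also have "\<dots> = c * (a * c - b\<^sup>2)" by (simp add: algebra_simps power2_eq_square)
    finally show ?thesis using c False
      by (simp add: zero_le_mult_iff a_def b_def c_def)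
  next
    case True
    have "b = 0"
    proof (rule ccontr)
      assume b: "b \<noteq> 0"
      \<comment> \<open>Definiteness is not assumed, so \<open>c = 0\<close> can occur. This choice
        gives the quadratic form the value \<open>-1\<close>.\<close>
      have "0 \<le> a * 1\<^sup>2 + 2 * b * 1 * (- (a + 1) / (2 * b)) + c * (- (a + 1) / (2 * b))\<^sup>2"
        by (rule quad)
      then show False using True b by (simp add: field_simps)
    qed
    then show ?thesis using True by (simp add: a_def b_def c_def)
  qed
qed

end

lemma degree_smult_sub_less:
  fixes p q :: "real poly"
  assumes "degree p \<le> n" "degree q = n" "q \<noteq> 0" "n > 0"
  shows "degree (p - smult (coeff p n / lead_coeff q) q) < n"
proof (rule degree_lessI)
  show "\<forall>k\<ge>n. coeff (p - smult (coeff p n / lead_coeff q) q) k = 0"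
  proof (intro allI impI)
    fix k assume "n \<le> k"
    then show "coeff (p - smult (coeff p n / lead_coeff q) q) k = 0"
      using assms by (cases "k = n") (auto simp: coeff_eq_0)
  qed
qed (use assms in auto)

abbreviation cpoly :: "real poly \<Rightarrow> complex poly" where
  "cpoly \<equiv> map_poly complex_of_real"

lemma cpoly_add: "cpoly (p + q) = cpoly p + cpoly q"
  by (simp add: poly_eq_iff coeff_map_poly)

lemma cpoly_smult: "cpoly (smult c p) = smult (of_real c) (cpoly p)"
  by (simp add: poly_eq_iff coeff_map_poly)

lemma cpoly_mult: "cpoly (p * q) = cpoly p * cpoly q"
  by (simp add: poly_eq_iff coeff_map_poly coeff_mult)

lemma cpoly_sum: "cpoly (\<Sum>x\<in>A. f x) = (\<Sum>x\<in>A. cpoly (f x))"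
  by (induction A rule: infinite_finite_induct) (auto simp: cpoly_add)

lemma poly_cpoly_of_real: "poly (cpoly p) (of_real x) = of_real (poly p x)"
  by (induction p) (auto simp: map_poly_pCons)

locale orthonormal_polys = positive_functional I for I :: "real poly \<Rightarrow> real" +
  fixes p :: "nat \<Rightarrow> real poly"
  assumes degree_p: "degree (p n) = n"
    and lead_pos: "lead_coeff (p n) > 0"
    and orthonormal: "I (p i * p j) = (if i = j then 1 else 0)"
begin

lemma p_nonzero: "p n \<noteq> 0"
  using lead_pos[of n] by auto

lemma p_0: "\<exists>c>0. p 0 = [:c:]"
  using degree_p[of 0] lead_pos[of 0] by (metis degree_eq_zeroE lead_coeff_pCons(2))

lemma expansion_exists:
  "degree q \<le> n \<Longrightarrow> \<exists>c. q = (\<Sum>k\<le>n. smult (c k) (p k))"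
proof (induction n arbitrary: q)
  case 0
  obtain c where "c > 0" "p 0 = [:c:]" using p_0 by blast
  moreover obtain d where "q = [:d:]" using 0 by (metis degree_eq_zeroE le_zero_eq)
  ultimately show ?case by (intro exI[of _ "\<lambda>_. d / c"]) auto
next
  case (Suc n)
  define d where "d = coeff q (Suc n) / lead_coeff (p (Suc n))"
  have "degree (q - smult d (p (Suc n))) < Suc n"
    unfolding d_def by (rule degree_smult_sub_less) (use Suc degree_p p_nonzero in auto)
  then obtain c where c: "q - smult d (p (Suc n)) = (\<Sum>k\<le>n. smult (c k) (p k))"
    using Suc.IH by fastforce
  have "q = (\<Sum>k\<le>Suc n. smult ((c(Suc n := d)) k) (p k))"
    using c by (simp add: algebra_simps)
  then show ?case by blast
qed

lemma inner_sum_p: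
  "finite A \<Longrightarrow> I ((\<Sum>k\<in>A. smult (c k) (p k)) * p j) = (if j \<in> A then c j else 0)"
  by (simp add: sum_distrib_right sum smult orthonormal if_distrib cong: if_cong)

lemma expansion:
  assumes "degree q \<le> n"
  shows "q = (\<Sum>k\<le>n. smult (I (q * p k)) (p k))"
proof -
  obtain c where c: "q = (\<Sum>k\<le>n. smult (c k) (p k))" using expansion_exists[OF assms] by blast
  have "I (q * p k) = c k" if "k \<le> n" for k
    using that by (subst c, subst inner_sum_p) auto
  then show ?thesis using c by simp
qed

lemma orthogonal_lower:
  assumes "degree q < n"
  shows "I (q * p n) = 0"
proof -
  obtain c where c: "q = (\<Sum>k\<le>degree q. smult (c k) (p k))" using expansion_exists by blast
  show ?thesis using assms by (subst c, subst inner_sum_p) auto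
qed

text \<open>The off-diagonal entries of the Jacobi matrix. The value \<open>0\<close> at
  \<open>n = 0\<close> removes the spurious term with \<open>p (0 - 1) = p 0\<close> from the
  recurrence.\<close>

definition offdiag :: "nat \<Rightarrow> real" where
  "offdiag n = (if n = 0 then 0 else I ([:0, 1:] * p n * p (n - 1)))"

definition diag :: "nat \<Rightarrow> real" where
  "diag n = I ([:0, 1:] * p n * p n)"

text \<open>Multiplication by \<open>x\<close> can be moved to the other factor, so for
  \<open>k + 1 < n\<close> the coefficient of \<open>p k\<close> pairs \<open>p n\<close> with a
  polynomial of lower degree.\<close>

lemma recurrence:
  "[:0, 1:] * p n = smult (offdiag (Suc n)) (p (Suc n)) + smult (diag n) (p n)
     + smult (offdiag n) (p (n - 1))"
proof -
  have deg: "degree ([:0, 1:] * p k) = Suc k" for k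
    using degree_p[of k] p_nonzero[of k] by (simp add: degree_mult_eq)
  have low: "I ([:0, 1:] * p n * p k) = 0" if "Suc k < n" for k
    using orthogonal_lower[of "[:0, 1:] * p k" n] deg[of k] that by (simp add: mult.commute mult.left_commute)
  have "[:0, 1:] * p n = (\<Sum>k\<le>Suc n. smult (I ([:0, 1:] * p n * p k)) (p k))"
    by (rule expansion) (simp only: deg)
  also have "\<dots> = (\<Sum>k\<in>{n - 1..Suc n}. smult (I ([:0, 1:] * p n * p k)) (p k))"
  proof (rule sum.mono_neutral_right)
    show "\<forall>i\<in>{..Suc n} - {n - 1..Suc n}. smult (I ([:0, 1:] * p n * p i)) (p i) = 0"
    proof
      fix i assume "i \<in> {..Suc n} - {n - 1..Suc n}"
      then have "Suc i < n" by auto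
      then show "smult (I ([:0, 1:] * p n * p i)) (p i) = 0" by (simp only: low smult_0_left)
    qed
  qed auto
  also have "\<dots> = smult (offdiag (Suc n)) (p (Suc n)) + smult (diag n) (p n)
     + smult (offdiag n) (p (n - 1))"
  proof (cases n)
    case 0
    then show ?thesis by (simp add: offdiag_def diag_def mult.commute mult.left_commute)
  next
    case (Suc k)
    then have "{n - 1..Suc n} = {k, Suc k, Suc (Suc k)}" by auto
    then show ?thesis using Suc by (simp add: offdiag_def diag_def mult.commute mult.left_commute)
  qed
  finally show ?thesis .
qed

lemma lead_offdiag: "lead_coeff (p n) = offdiag (Suc n) * lead_coeff (p (Suc n))"
  using arg_cong[OF recurrence[of n], of "\<lambda>q. coeff q (Suc n)"] degree_p
  by (simp add: coeff_eq_0)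

lemma offdiag_pos: "offdiag (Suc n) > 0"
  using lead_offdiag[of n] lead_pos[of n] lead_pos[of "Suc n"]
  by (metis zero_less_mult_pos2)

lemma inner_x_p:
  "I ([:0, 1:] * p n * p k) =
     (if k = Suc n then offdiag k else if k = n then diag n else if n = Suc k then offdiag n else 0)"
proof -
  have "I ([:0, 1:] * p n * p k) = I (smult (offdiag (Suc n)) (p (Suc n) * p k)
      + smult (diag n) (p n * p k) + smult (offdiag n) (p (n - 1) * p k))"
    by (subst recurrence) (simp add: algebra_simps)
  also have "\<dots> = (if k = Suc n then offdiag k else if k = n then diag n else if n = Suc k then offdiag n else 0)"
    by (cases n) (auto simp: add smult orthonormal offdiag_def)
  finally show ?thesis .
qed

section \<open>Values at complex points and the Christoffel-Darboux identity\<close>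

definition pz :: "nat \<Rightarrow> complex \<Rightarrow> complex" where
  "pz n z = poly (cpoly (p n)) z"

lemma pz_recurrence:
  "z * pz n z = offdiag (Suc n) * pz (Suc n) z + diag n * pz n z + offdiag n * pz (n - 1) z"
  using arg_cong[OF recurrence[of n], of "\<lambda>q. poly (cpoly q) z"]
  by (simp add: cpoly_add cpoly_smult cpoly_mult pz_def map_poly_pCons)

lemma pz_0: "pz 0 z \<noteq> 0"
  using p_0 by (auto simp: pz_def map_poly_pCons)

definition energy :: "nat \<Rightarrow> complex \<Rightarrow> real" where
  "energy N z = (\<Sum>k<N. (cmod (pz k z))\<^sup>2)"

text \<open>
  The kernel \<open>K(x) = \<Sum>k<N. cnj (p\<^sub>k z) * p\<^sub>k x\<close> is kept as its real and imaginary parts, because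
  the functional acts on real polynomials.
\<close>

definition ker :: "(complex \<Rightarrow> real) \<Rightarrow> nat \<Rightarrow> complex \<Rightarrow> real poly" where
  "ker h N z = (\<Sum>k<N. smult (h (pz k z)) (p k))"

lemma inner_ker: "I (ker h N z * ker h N z) = (\<Sum>k<N. (h (pz k z))\<^sup>2)"
proof -
  have *: "ker h N z * ker h N z = (\<Sum>j<N. smult (h (pz j z)) (ker h N z * p j))"
    by (simp add: ker_def sum_distrib_left)
  have "I (ker h N z * p j) = h (pz j z)" if "j < N" for j
    unfolding ker_def using that by (subst inner_sum_p) auto
  then show ?thesis unfolding * by (simp add: sum smult power2_eq_square)
qed

lemma inner_x_ker_Suc:
  "I ([:0, 1:] * (ker h (Suc N) z * ker h (Suc N) z)) = I ([:0, 1:] * (ker h N z * ker h N z))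
     + 2 * offdiag N * h (pz N z) * h (pz (N - 1) z) + diag N * (h (pz N z))\<^sup>2"
proof -
  let ?c = "h (pz N z)"
  have "[:0, 1:] * (ker h (Suc N) z * ker h (Suc N) z) = [:0, 1:] * (ker h N z * ker h N z)
      + smult (2 * ?c) ([:0, 1:] * p N * ker h N z) + smult (?c\<^sup>2) ([:0, 1:] * p N * p N)"
    by (rule real_poly_eqI) (simp add: ker_def algebra_simps power2_eq_square)
  moreover have "I ([:0, 1:] * p N * ker h N z) = offdiag N * h (pz (N - 1) z)"
  proof -
    have "[:0, 1:] * p N * ker h N z = (\<Sum>k<N. smult (h (pz k z)) ([:0, 1:] * p N * p k))"
      by (simp add: ker_def sum_distrib_left)
    then have "I ([:0, 1:] * p N * ker h N z) = (\<Sum>k<N. h (pz k z) * I ([:0, 1:] * p N * p k))"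
      by (simp only: sum smult)
    also have "\<dots> = (\<Sum>k<N. if k = N - 1 then offdiag N * h (pz (N - 1) z) else 0)"
      by (rule sum.cong) (auto simp: inner_x_p simp del: mult_pCons_left split: if_splits)
    also have "\<dots> = offdiag N * h (pz (N - 1) z)"
      by (cases N) (auto simp: offdiag_def)
    finally show ?thesis .
  qed
  moreover have "I ([:0, 1:] * p N * p N) = diag N"
    by (simp only: diag_def)
  ultimately show ?thesis by (simp only: add smult mult.assoc mult.left_commute mult.commute)
qed

text \<open>The classical identity for \<open>z - x\<close> times the kernel, paired with the
  conjugate kernel: \<open>p N\<close> is orthogonal to it, and \<open>p (N - 1)\<close> picks out
  one coefficient. In this form the recurrence gives it by induction on \<open>N\<close>.\<close>

lemma christoffel_darboux:
  fixes z :: complex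
  shows "z * energy N z - I ([:0, 1:] * (ker Re N z * ker Re N z + ker Im N z * ker Im N z))
     = offdiag N * pz N z * cnj (pz (N - 1) z)"
proof (induction N)
  case 0
  then show ?case by (simp add: energy_def ker_def offdiag_def zero)
next
  case (Suc N)
  let ?T = "\<lambda>N. I ([:0, 1:] * (ker Re N z * ker Re N z + ker Im N z * ker Im N z))"
  let ?v = "pz N z" and ?u = "pz (N - 1) z" and ?w = "pz (Suc N) z"
  have split: "?T N = I ([:0, 1:] * (ker Re N z * ker Re N z)) + I ([:0, 1:] * (ker Im N z * ker Im N z))" for N
    by (simp only: distrib_left add)
  have T: "of_real (?T (Suc N)) = of_real (?T N) + of_real (offdiag N) * (?v * cnj ?u + cnj ?v * ?u)
      + of_real (diag N) * (?v * cnj ?v)"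
    by (simp only: split inner_x_ker_Suc)
       (simp add: complex_eq_iff algebra_simps power2_eq_square)
  have "z * energy (Suc N) z = z * energy N z + cnj ?v * (z * ?v)"
    by (simp add: energy_def algebra_simps complex_norm_square[symmetric])
  also have "\<dots> = z * energy N z + cnj ?v * (offdiag (Suc N) * ?w + diag N * ?v + offdiag N * ?u)"
    using pz_recurrence[of z N] by simp
  finally have E: "z * energy (Suc N) z = \<dots>" .
  show ?case using Suc.IH unfolding E T by (simp add: algebra_simps)
qed

lemma energy_bound:
  assumes "\<And>x. x \<in> {-1..1} \<Longrightarrow> d \<le> cmod (z - of_real x)"
  shows "d * energy N z \<le> offdiag N * cmod (pz N z) * cmod (pz (N - 1) z)"
proof -
  define K where "K = ker Re N z * ker Re N z + ker Im N z * ker Im N z"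
  define T where "T = I ([:0, 1:] * K)"
  have K: "poly K x \<ge> 0" for x by (simp add: K_def)
  have E: "I K = energy N z"
    by (simp add: K_def add inner_ker energy_def cmod_power2 sum.distrib)
  have "\<bar>T\<bar> \<le> I K"
  proof -
    have "T \<le> I K" unfolding T_def
    proof (rule mono)
      fix x :: real assume "x \<in> {-1..1}"
      then have "0 \<le> (1 - x) * poly K x" using K by (intro mult_nonneg_nonneg) auto
      then show "poly ([:0, 1:] * K) x \<le> poly K x" by (simp add: algebra_simps)
    qed
    moreover have "- I K \<le> T" unfolding T_def uminus[symmetric]
    proof (rule mono)
      fix x :: real assume "x \<in> {-1..1}"
      then have "0 \<le> (1 + x) * poly K x" using K by (intro mult_nonneg_nonneg) auto
      then show "poly (- K) x \<le> poly ([:0, 1:] * K) x" by (simp add: algebra_simps)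
    qed
    ultimately show ?thesis by simp
  qed
  have nn: "0 \<le> energy N z" by (simp add: energy_def sum_nonneg)
  have off: "0 \<le> offdiag N" using offdiag_pos[of "N - 1"] by (cases N) (auto simp: offdiag_def)
  have "d * energy N z \<le> cmod (z * energy N z - T)"
  proof (cases "energy N z = 0")
    case False
    \<comment> \<open>The mean of the variable against the nonnegative density \<open>K\<close>.
      Positivity of \<open>I\<close> places it in \<open>[-1, 1]\<close>, where the distance
      hypothesis applies.\<close>
    define x where "x = T / energy N z"
    have "x \<in> {-1..1}" using \<open>\<bar>T\<bar> \<le> I K\<close> False nn by (auto simp: x_def E field_simps abs_le_iff)
    then have "d * energy N z \<le> cmod (z - of_real x) * energy N z"
      using assms nn by (intro mult_right_mono) auto
    also have "\<dots> = cmod ((z - of_real x) * energy N z)" using nn by (simp add: norm_mult)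
    also have "(z - of_real x) * energy N z = z * energy N z - T"
      using False by (simp add: x_def field_simps)
    finally show ?thesis .
  qed simp
  also have "z * energy N z - T = offdiag N * pz N z * cnj (pz (N - 1) z)"
    unfolding T_def K_def by (rule christoffel_darboux)
  finally show ?thesis using off by (simp add: norm_mult)
qed

text \<open>The energy dominates \<open>cmod (pz k z) * cmod (pz (N - 1) z)\<close> for every
  \<open>k < N\<close>. The common factor \<open>pz (N - 1) z\<close> then cancels from
  \<open>energy_bound\<close>; it is nonzero because the energy is positive.\<close>

lemma pz_le_later:
  assumes d: "d > 0" "\<And>x. x \<in> {-1..1} \<Longrightarrow> d \<le> cmod (z - of_real x)" and "k < N"
  shows "pz N z \<noteq> 0" and "cmod (pz k z) \<le> offdiag N / d * cmod (pz N z)"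
proof -
  have pos: "energy N z > 0"
  proof -
    have "0 < (cmod (pz 0 z))\<^sup>2" using pz_0 by simp
    also have "\<dots> \<le> energy N z"
      unfolding energy_def by (rule member_le_sum) (use \<open>k < N\<close> in auto)
    finally show ?thesis .
  qed
  then have "0 < d * energy N z" using d by simp
  also note bound = energy_bound[OF d(2), of N]
  finally have nz: "pz N z \<noteq> 0" "pz (N - 1) z \<noteq> 0" by auto
  have "cmod (pz k z) * cmod (pz (N - 1) z) \<le> energy N z"
  proof (cases "k = N - 1")
    case True
    show ?thesis unfolding energy_def True
      using member_le_sum[of "N - 1" "{..<N}" "\<lambda>k. (cmod (pz k z))\<^sup>2"] \<open>k < N\<close>
      by (simp add: power2_eq_square)
  next
    case False
    have "2 * (cmod (pz k z) * cmod (pz (N - 1) z)) \<le> (cmod (pz k z))\<^sup>2 + (cmod (pz (N - 1) z))\<^sup>2"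
      using sum_squares_bound[of "cmod (pz k z)" "cmod (pz (N - 1) z)"] by simp
    also have "\<dots> = (\<Sum>k\<in>{k, N - 1}. (cmod (pz k z))\<^sup>2)" using False by simp
    also have "\<dots> \<le> energy N z" unfolding energy_def
      by (rule sum_mono2) (use \<open>k < N\<close> in auto)
    finally show ?thesis using pos
      by (smt (verit) mult_nonneg_nonneg norm_ge_zero)
  qed
  then have "d * (cmod (pz k z) * cmod (pz (N - 1) z)) \<le> offdiag N * cmod (pz N z) * cmod (pz (N - 1) z)"
    using bound d(1) by (meson mult_left_mono order_less_imp_le order_trans)
  then have "d * cmod (pz k z) \<le> offdiag N * cmod (pz N z)"
    using nz by (simp add: mult.assoc[symmetric])
  then show "pz N z \<noteq> 0" "cmod (pz k z) \<le> offdiag N / d * cmod (pz N z)"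
    using nz d by (simp_all add: field_simps)
qed


end

section \<open>Quotient asymptotics and geometric growth off the interval\<close>

lemma linear_recursion_tendsto_zero:
  fixes u e :: "nat \<Rightarrow> real"
  assumes q: "0 \<le> q" "q < 1" and rec: "\<And>n. u (Suc n) = q * u n + e n"
    and e: "e \<longlonglongrightarrow> 0"
  shows "u \<longlonglongrightarrow> 0"
proof (rule LIMSEQ_I)
  fix r :: real assume r: "r > 0"
  \<comment> \<open>With this choice \<open>r / 2\<close> is the fixed point of
    \<open>u = q * u + s\<close>.\<close>
  define s where "s = (1 - q) * (r / 2)"
  have "s > 0" using q r by (simp add: s_def)
  then obtain N where N: "\<And>n. n \<ge> N \<Longrightarrow> \<bar>e n\<bar> < s"
    using e by (metis LIMSEQ_D diff_zero real_norm_def)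
  have bound: "\<bar>u (N + k)\<bar> \<le> q ^ k * \<bar>u N\<bar> + r / 2" for k
  proof (induction k)
    case (Suc k)
    have "\<bar>u (N + Suc k)\<bar> \<le> q * \<bar>u (N + k)\<bar> + \<bar>e (N + k)\<bar>"
      using rec[of "N + k"] q abs_triangle_ineq[of "q * u (N + k)" "e (N + k)"] by (simp add: abs_mult)
    also have "\<dots> \<le> q * (q ^ k * \<bar>u N\<bar> + r / 2) + s"
      using Suc q N[of "N + k"] by (intro add_mono mult_left_mono) auto
    also have "\<dots> = q ^ Suc k * \<bar>u N\<bar> + r / 2"
      by (simp add: s_def field_simps)
    finally show ?case .
  qed (use r in auto)
  have "(\<lambda>k. q ^ k * \<bar>u N\<bar>) \<longlonglongrightarrow> 0"
    using q by (intro tendsto_mult_left_zero LIMSEQ_realpow_zero)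
  then obtain M where M: "\<And>k. k \<ge> M \<Longrightarrow> q ^ k * \<bar>u N\<bar> < r / 2"
    using r LIMSEQ_D[of "\<lambda>k. q ^ k * \<bar>u N\<bar>" 0 "r / 2"] q by (auto simp: abs_mult)
  have "\<bar>u n\<bar> < r" if "n \<ge> N + M" for n
  proof -
    have "q ^ (n - N) * \<bar>u N\<bar> < r / 2" using M[of "n - N"] that by linarith
    then show ?thesis using bound[of "n - N"] that by simp
  qed
  then show "\<exists>no. \<forall>n\<ge>no. norm (u n - 0) < r" by auto
qed

text \<open>The Nevai class: the recurrence tends to that of the Chebyshev polynomials, with
  characteristic equation \<open>w + 1 / w = 2 * z\<close>.\<close>

locale nevai_polys = orthonormal_polys I p for I p +
  assumes offdiag_lim: "offdiag \<longlonglongrightarrow> 1 / 2" and diag_lim: "diag \<longlonglongrightarrow> 0"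
begin

lemma pz_le_later_uniform:
  assumes "d > 0"
  obtains C where "C \<ge> 1"
    "\<And>k N z. k \<le> N \<Longrightarrow> (\<And>x. x \<in> {-1..1} \<Longrightarrow> d \<le> cmod (z - of_real x)) \<Longrightarrow> cmod (pz k z) \<le> C * cmod (pz N z)"
proof -
  obtain B where B: "\<And>n. \<bar>offdiag n\<bar> \<le> B"
    using convergent_imp_Bseq[OF convergentI[OF offdiag_lim]] by (auto simp: Bseq_def)
  define C where "C = max 1 (B / d)"
  have "cmod (pz k z) \<le> C * cmod (pz N z)"
    if "k \<le> N" and z: "\<And>x. x \<in> {-1..1} \<Longrightarrow> d \<le> cmod (z - of_real x)" for k N z
  proof (cases "k = N")
    case True
    then show ?thesis by (simp add: C_def mult_le_cancel_right1)
  next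
    case False
    then have "cmod (pz k z) \<le> offdiag N / d * cmod (pz N z)"
      using pz_le_later(2)[OF assms z] that by simp
    also have "offdiag N / d \<le> C"
      using B[of N] assms by (simp add: C_def divide_right_mono le_max_iff_disj)
    finally show ?thesis by (simp add: mult_right_mono)
  qed
  then show thesis using that[of C] by (simp add: C_def)
qed

lemma ratio_asymptotics:
  assumes d: "d > 0" "\<And>z x. z \<in> K \<Longrightarrow> x \<in> {-1..1} \<Longrightarrow> d \<le> cmod (z - of_real x)"
    and q: "q < 1" "\<And>z. z \<in> K \<Longrightarrow> cmod (F z) \<le> q"
    and F: "\<And>z. z \<in> K \<Longrightarrow> F z \<noteq> 0" "\<And>z. z \<in> K \<Longrightarrow> F z + 1 / F z = 2 * z"
  shows "uniform_limit K (\<lambda>n z. pz n z / pz (Suc n) z) F sequentially"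
proof (cases "K = {}")
  case False
  have q0: "0 \<le> q" using False q(2) by (meson ex_in_conv norm_ge_zero order_trans)
  obtain C where C: "C \<ge> 1" "\<And>k N z. k \<le> N \<Longrightarrow> z \<in> K \<Longrightarrow> cmod (pz k z) \<le> C * cmod (pz N z)"
    using pz_le_later_uniform[OF d(1)] d(2) by metis
  define e where "e n = 2 * (\<bar>offdiag (Suc (Suc n)) - 1 / 2\<bar> + \<bar>diag (Suc n)\<bar> + \<bar>offdiag (Suc n) - 1 / 2\<bar>)" for n
  \<comment> \<open>A scalar majorant independent of \<open>z\<close>, whence the uniformity. The
    start \<open>2\<close> comes from
    \<open>cmod (D 0 z) \<le> cmod (pz 0 z) + cmod (pz 1 z)\<close>.\<close>
  define u where "u = rec_nat 2 (\<lambda>n un. q * un + e n)"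
  have u: "u 0 = 2" "u (Suc n) = q * u n + e n" for n by (simp_all add: u_def)
  have e0: "e \<longlonglongrightarrow> 0"
  proof -
    have 1: "(\<lambda>n. offdiag (Suc n)) \<longlonglongrightarrow> 1 / 2" "(\<lambda>n. offdiag (Suc (Suc n))) \<longlonglongrightarrow> 1 / 2"
      "(\<lambda>n. diag (Suc n)) \<longlonglongrightarrow> 0"
      using offdiag_lim diag_lim by (simp_all add: filterlim_sequentially_Suc[of offdiag]
          filterlim_sequentially_Suc[of "\<lambda>n. offdiag (Suc n)"] filterlim_sequentially_Suc[of diag])
    have "e \<longlonglongrightarrow> 2 * (\<bar>1 / 2 - 1 / 2\<bar> + \<bar>0\<bar> + \<bar>1 / 2 - 1 / 2\<bar>)"
      unfolding e_def by (intro tendsto_intros 1)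
    then show ?thesis by simp
  qed
  have "u \<longlonglongrightarrow> 0" by (rule linear_recursion_tendsto_zero[OF q0 q(1) u(2) e0])
  define D where "D n z = pz n z - F z * pz (Suc n) z" for n z
  define r where "r n z = of_real (offdiag (Suc n) - 1 / 2) * pz (Suc n) z + of_real (diag n) * pz n z
      + of_real (offdiag n - 1 / 2) * pz (n - 1) z" for n z
  \<comment> \<open>\<open>F z\<close> and \<open>1 / F z\<close> are the roots of the limiting
    characteristic equation, so the second-order recurrence factors. \<open>D\<close> removes the
    solution that grows like \<open>(1 / F z) ^ n\<close>.\<close>
  have D_Suc: "D (Suc n) z = F z * D n z + 2 * F z * r (Suc n) z" if "z \<in> K" for n z
  proof -
    have Fz: "1 = 2 * z * F z - F z * F z" using F[OF that] by (simp add: field_simps)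
    have "D (Suc n) z - F z * D n z - 2 * F z * r (Suc n) z =
      pz (Suc n) z * (1 - (2 * z * F z - F z * F z)) + 2 * F z * (z * pz (Suc n) z -
        (offdiag (Suc (Suc n)) * pz (Suc (Suc n)) z + diag (Suc n) * pz (Suc n) z + offdiag (Suc n) * pz n z))"
      by (simp add: D_def r_def algebra_simps)
    also have "\<dots> = 0" using pz_recurrence[of z "Suc n"] Fz by simp
    finally show ?thesis by (simp add: algebra_simps)
  qed
  \<comment> \<open>The bound is relative to an arbitrary later value \<open>pz N z\<close>, because
    the reference value has to stay fixed while \<open>n\<close> advances in the induction.\<close>
  have D_bound: "cmod (D n z) \<le> C * u n * cmod (pz N z)" if "z \<in> K" "n < N" for n N z
    using that(2)
  proof (induction n)
    case 0
    have "cmod (D 0 z) \<le> cmod (pz 0 z) + cmod (F z) * cmod (pz 1 z)"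
      unfolding D_def by (metis One_nat_def norm_mult norm_triangle_ineq4)
    also have "\<dots> \<le> C * cmod (pz N z) + 1 * (C * cmod (pz N z))"
      using C(2)[of _ N z] that 0 q(1) q(2)[OF that(1)] by (intro add_mono mult_mono) auto
    finally show ?case by (simp add: u)
  next
    case (Suc n)
    have "cmod (r (Suc n) z) \<le> \<bar>offdiag (Suc (Suc n)) - 1 / 2\<bar> * cmod (pz (Suc (Suc n)) z)
       + \<bar>diag (Suc n)\<bar> * cmod (pz (Suc n) z) + \<bar>offdiag (Suc n) - 1 / 2\<bar> * cmod (pz n z)"
    proof -
      have "cmod (x + y + w) \<le> cmod x + cmod y + cmod w" for x y w
        by (metis add_right_mono norm_triangle_ineq order_trans)
      from this[of "of_real (offdiag (Suc (Suc n)) - 1 / 2) * pz (Suc (Suc n)) z"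
          "of_real (diag (Suc n)) * pz (Suc n) z" "of_real (offdiag (Suc n) - 1 / 2) * pz n z"]
      show ?thesis unfolding r_def norm_mult norm_of_real diff_Suc_1 .
    qed
    also have "\<dots> \<le> \<bar>offdiag (Suc (Suc n)) - 1 / 2\<bar> * (C * cmod (pz N z))
       + \<bar>diag (Suc n)\<bar> * (C * cmod (pz N z)) + \<bar>offdiag (Suc n) - 1 / 2\<bar> * (C * cmod (pz N z))"
      using Suc.prems that by (intro add_mono mult_left_mono C(2)) auto
    also have "\<dots> = C * (e n / 2) * cmod (pz N z)" by (simp add: e_def algebra_simps)
    finally have r: "cmod (r (Suc n) z) \<le> C * (e n / 2) * cmod (pz N z)" .
    have Fz: "cmod (F z) \<le> q" "cmod (F z) \<le> 1" using q(1) q(2)[OF that(1)] by auto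
    have "cmod (D (Suc n) z) \<le> cmod (F z) * cmod (D n z) + 2 * (cmod (F z) * cmod (r (Suc n) z))"
      unfolding D_Suc[OF that(1)] by (rule order_trans[OF norm_triangle_ineq]) (simp add: norm_mult)
    also have "\<dots> \<le> q * (C * u n * cmod (pz N z)) + 2 * (1 * (C * (e n / 2) * cmod (pz N z)))"
      using Suc Fz r q0 by (intro add_mono mult_mono) auto
    also have "\<dots> = C * u (Suc n) * cmod (pz N z)" by (simp add: u algebra_simps)
    finally show ?case .
  qed
  have bound: "cmod (pz n z / pz (Suc n) z - F z) \<le> C * u n" if "z \<in> K" for n z
  proof -
    have nz: "pz (Suc n) z \<noteq> 0" using pz_le_later(1)[OF d(1), of z 0] d(2) that by auto
    have "cmod (pz n z / pz (Suc n) z - F z) = cmod (D n z) / cmod (pz (Suc n) z)"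
      using nz by (simp add: D_def diff_divide_distrib flip: norm_divide)
    also have "\<dots> \<le> C * u n" using D_bound[OF that, of n "Suc n"] nz by (simp add: divide_le_eq)
    finally show ?thesis .
  qed
  show ?thesis
  proof (rule uniform_limitI)
    fix \<epsilon> :: real assume "\<epsilon> > 0"
    have "(\<lambda>n. C * u n) \<longlonglongrightarrow> 0" using \<open>u \<longlonglongrightarrow> 0\<close> by (rule tendsto_mult_right_zero)
    then have "\<forall>\<^sub>F n in sequentially. C * u n < \<epsilon>" using \<open>\<epsilon> > 0\<close> by (rule order_tendstoD)
    then show "\<forall>\<^sub>F n in sequentially. \<forall>z\<in>K. dist (pz n z / pz (Suc n) z) (F z) < \<epsilon>"
    proof eventually_elim
      case (elim n)
      show ?case
        using order_le_less_trans[OF bound elim] by (simp add: dist_norm)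
    qed
  qed
qed simp

text \<open>The gap between \<open>r\<close> and \<open>r'\<close> absorbs the error in the quotient
  limit; from some index on, the bound is a geometric iteration.\<close>

lemma growth_upper:
  assumes lim: "uniform_limit K (\<lambda>n z. pz n z / pz (Suc n) z) F sequentially"
    and "compact K" and F: "\<And>z. z \<in> K \<Longrightarrow> 1 / r \<le> cmod (F z)" and "0 < r" "r < r'"
  obtains C where "C > 0" "\<forall>\<^sub>F n in sequentially. \<forall>z\<in>K. cmod (pz n z) \<le> C * r' ^ n"
proof -
  have gap: "1 / r - 1 / r' > 0" using assms by (simp add: field_simps)
  obtain N where N: "\<And>n z. n \<ge> N \<Longrightarrow> z \<in> K \<Longrightarrow> dist (pz n z / pz (Suc n) z) (F z) < 1 / r - 1 / r'"
    using uniform_limitD[OF lim gap] by (auto simp: eventually_sequentially)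
  have step: "cmod (pz (Suc n) z) \<le> r' * cmod (pz n z)" if "n \<ge> N" "z \<in> K" for n z
  proof -
    have "cmod (F z) - cmod (pz n z / pz (Suc n) z) \<le> dist (pz n z / pz (Suc n) z) (F z)"
      by (metis dist_commute dist_norm norm_triangle_ineq2)
    then have "1 / r' < cmod (pz n z) / cmod (pz (Suc n) z)"
      using N[OF that] F[OF that(2)] by (simp add: norm_divide)
    then show ?thesis using assms by (cases "pz (Suc n) z = 0") (auto simp: field_simps)
  qed
  have "bounded (pz N ` K)" unfolding pz_def
    by (intro compact_imp_bounded compact_continuous_image \<open>compact K\<close> continuous_intros)
  then obtain B where B: "B > 0" "\<And>z. z \<in> K \<Longrightarrow> cmod (pz N z) \<le> B"
    unfolding bounded_pos by auto
  have bound: "cmod (pz (N + k) z) \<le> B * r' ^ k" if "z \<in> K" for k z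
  proof (induction k)
    case (Suc k)
    have "cmod (pz (N + Suc k) z) \<le> r' * cmod (pz (N + k) z)" using step[of "N + k" z] that by simp
    also have "\<dots> \<le> r' * (B * r' ^ k)" using Suc assms by (intro mult_left_mono) auto
    finally show ?case by (simp add: algebra_simps)
  qed (use B that in auto)
  have "cmod (pz n z) \<le> (B / r' ^ N) * r' ^ n" if "n \<ge> N" "z \<in> K" for n z
  proof -
    define k where "k = n - N"
    then have "n = N + k" using that by simp
    then show ?thesis using bound[OF that(2), of k] assms by (simp add: power_add)
  qed
  then show thesis using B assms by (intro that[of "B / r' ^ N"]) (auto simp: eventually_sequentially)
qed

lemma growth_lower:
  assumes lim: "uniform_limit K (\<lambda>n z. pz n z / pz (Suc n) z) F sequentially"
    and d: "d > 0" "\<And>z x. z \<in> K \<Longrightarrow> x \<in> {-1..1} \<Longrightarrow> d \<le> cmod (z - of_real x)"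
    and F: "\<And>z. z \<in> K \<Longrightarrow> cmod (F z) \<le> 1 / R" and "0 < R'" "R' < R"
  obtains c where "c > 0" "\<forall>\<^sub>F n in sequentially. \<forall>z\<in>K. c * R' ^ n \<le> cmod (pz n z)"
proof -
  have gap: "1 / R' - 1 / R > 0" using assms by (simp add: field_simps)
  obtain N where N: "\<And>n z. n \<ge> N \<Longrightarrow> z \<in> K \<Longrightarrow> dist (pz n z / pz (Suc n) z) (F z) < 1 / R' - 1 / R"
    using uniform_limitD[OF lim gap] by (auto simp: eventually_sequentially)
  have step: "R' * cmod (pz n z) \<le> cmod (pz (Suc n) z)" if "n \<ge> N" "z \<in> K" for n z
  proof -
    have "cmod (pz n z / pz (Suc n) z) - cmod (F z) \<le> dist (pz n z / pz (Suc n) z) (F z)"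
      by (metis dist_norm norm_triangle_ineq2)
    then have "cmod (pz n z) / cmod (pz (Suc n) z) < 1 / R'"
      using N[OF that] F[OF that(2)] by (simp add: norm_divide)
    moreover have "pz (Suc n) z \<noteq> 0" using pz_le_later(1)[OF d(1), of z 0] d(2) that by auto
    ultimately show ?thesis using assms by (auto simp: field_simps)
  qed
  obtain C where C: "C \<ge> 1" "\<And>k N z. k \<le> N \<Longrightarrow> z \<in> K \<Longrightarrow> cmod (pz k z) \<le> C * cmod (pz N z)"
    using pz_le_later_uniform[OF d(1)] d(2) by metis
  obtain c0 where c0: "c0 > 0" "p 0 = [:c0:]" using p_0 by blast
  \<comment> \<open>A lower bound for the starting value, uniform on \<open>K\<close>: the positive
    constant \<open>p 0\<close> is at most \<open>C\<close> times any later value.\<close>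
  define B where "B = c0 / C"
  have B: "B > 0" "\<And>z. z \<in> K \<Longrightarrow> B \<le> cmod (pz N z)"
    using C(1) C(2)[of 0 N] c0 by (auto simp: B_def pz_def map_poly_pCons field_simps)
  have bound: "B * R' ^ k \<le> cmod (pz (N + k) z)" if "z \<in> K" for k z
  proof (induction k)
    case (Suc k)
    have "B * R' ^ Suc k = R' * (B * R' ^ k)" by simp
    also have "\<dots> \<le> R' * cmod (pz (N + k) z)" using Suc assms by (intro mult_left_mono) auto
    also have "\<dots> \<le> cmod (pz (N + Suc k) z)" using step[of "N + k" z] that by simp
    finally show ?case .
  qed (use B that in auto)
  have "(B / R' ^ N) * R' ^ n \<le> cmod (pz n z)" if "n \<ge> N" "z \<in> K" for n z
  proof -
    define k where "k = n - N"
    then have "n = N + k" using that by simp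
    then show ?thesis using bound[OF that(2), of k] assms by (simp add: power_add)
  qed
  then show thesis using B assms by (intro that[of "B / R' ^ N"]) (auto simp: eventually_sequentially)
qed

end

section \<open>Means over the unit circle and outer polynomials\<close>

definition circle_mean :: "(complex \<Rightarrow> real) \<Rightarrow> real" where
  "circle_mean f = integral {0..1} (\<lambda>x. f (cis (2 * pi * x)))"

lemma circle_integrable:
  fixes f :: "complex \<Rightarrow> real"
  assumes "continuous_on UNIV f"
  shows "(\<lambda>x. f (cis (2 * pi * x))) integrable_on {0..1::real}"
proof (rule integrable_continuous_real)
  show "continuous_on {0..1::real} (\<lambda>x. f (cis (2 * pi * x)))"
    by (rule continuous_on_compose2[OF assms]) (auto intro!: continuous_intros)
qed

lemma circle_mean_add:
  "continuous_on UNIV f \<Longrightarrow> continuous_on UNIV g \<Longrightarrow>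
    circle_mean (\<lambda>t. f t + g t) = circle_mean f + circle_mean g"
  unfolding circle_mean_def by (intro integral_add circle_integrable)

lemma circle_mean_cmult: "circle_mean (\<lambda>t. c * f t) = c * circle_mean f"
  unfolding circle_mean_def by (rule integral_mult_right)

lemma circle_mean_sum:
  "finite A \<Longrightarrow> (\<And>k. k \<in> A \<Longrightarrow> continuous_on UNIV (f k)) \<Longrightarrow>
    circle_mean (\<lambda>t. \<Sum>k\<in>A. f k t) = (\<Sum>k\<in>A. circle_mean (f k))"
  unfolding circle_mean_def by (rule integral_sum) (auto intro: circle_integrable)

lemma circle_mean_cong:
  "(\<And>t. cmod t = 1 \<Longrightarrow> f t = g t) \<Longrightarrow> circle_mean f = circle_mean g"
  unfolding circle_mean_def by (simp add: norm_cis)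

lemma circle_mean_mono:
  "continuous_on UNIV f \<Longrightarrow> continuous_on UNIV g \<Longrightarrow> (\<And>t. cmod t = 1 \<Longrightarrow> f t \<le> g t) \<Longrightarrow>
    circle_mean f \<le> circle_mean g"
  unfolding circle_mean_def by (intro integral_le circle_integrable) (auto simp: norm_cis)

lemma circle_mean_const: "circle_mean (\<lambda>t. c) = c"
  by (simp add: circle_mean_def)

lemma circle_mean_nonneg:
  "continuous_on UNIV f \<Longrightarrow> (\<And>t. cmod t = 1 \<Longrightarrow> 0 \<le> f t) \<Longrightarrow> 0 \<le> circle_mean f"
  using circle_mean_mono[of "\<lambda>_. 0" f] by (simp add: circle_mean_const)

lemma circle_mean_monomial:
  "circle_mean (\<lambda>t. Re (c * (t ^ i * cnj t ^ j))) = (if i = j then Re c else 0)"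
proof (cases "i = j")
  case True
  have "circle_mean (\<lambda>t. Re (c * (t ^ i * cnj t ^ j))) = circle_mean (\<lambda>t. Re c)"
    using True by (intro circle_mean_cong)
      (simp add: complex_norm_square[symmetric] flip: power_mult_distrib)
  then show ?thesis using True by (simp add: circle_mean_const)
next
  case False
  define w where "w = 2 * pi * (real i - real j)"
  define G where "G x = (Re c * sin (w * x) + Im c * cos (w * x)) / w" for x
  have w: "w \<noteq> 0" using False by (simp add: w_def)
  have "((\<lambda>x. Re c * cos (w * x) - Im c * sin (w * x)) has_integral G 1 - G 0) {0..1}"
    by (rule fundamental_theorem_of_calculus)
      (use w in \<open>auto simp: G_def has_real_derivative_iff_has_vector_derivative[symmetric] field_simps
        intro!: derivative_eq_intros\<close>)
  moreover have "G 1 - G 0 = 0"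
  proof -
    have "w = 2 * pi * real_of_int (int i - int j)" by (simp add: w_def)
    then have "sin w = 0" "cos w = 1" by (simp_all only: sin_int_2pin cos_int_2pin)
    then show ?thesis by (simp add: G_def)
  qed
  moreover have "Re (c * (cis (2 * pi * x) ^ i * cnj (cis (2 * pi * x)) ^ j)) =
      Re c * cos (w * x) - Im c * sin (w * x)" for x
  proof -
    have "cis (2 * pi * x) ^ i * cnj (cis (2 * pi * x)) ^ j = cis (w * x)"
      by (simp add: Complex.DeMoivre cis_cnj cis_mult w_def algebra_simps)
    then show ?thesis by simp
  qed
  ultimately show ?thesis using False by (simp add: circle_mean_def integral_unique)
qed

lemma circle_mean_coeff: "circle_mean (\<lambda>t. Re (poly P t * cnj t ^ j)) = Re (coeff P j)"
proof -
  have "circle_mean (\<lambda>t. Re (poly P t * cnj t ^ j)) =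
      circle_mean (\<lambda>t. \<Sum>i\<le>degree P. Re (coeff P i * (t ^ i * cnj t ^ j)))"
    by (simp only: poly_altdef sum_distrib_right Re_sum mult.assoc)
  also have "\<dots> = (\<Sum>i\<le>degree P. circle_mean (\<lambda>t. Re (coeff P i * (t ^ i * cnj t ^ j))))"
    by (intro circle_mean_sum continuous_intros) auto
  also have "\<dots> = Re (coeff P j)"
    by (simp only: circle_mean_monomial) (simp add: coeff_eq_0)
  finally show ?thesis .
qed

lemma parseval:
  assumes "finite A"
  shows "circle_mean (\<lambda>t. (cmod (\<Sum>k\<in>A. c k * t ^ k))\<^sup>2) = (\<Sum>k\<in>A. (cmod (c k))\<^sup>2)"
proof -
  have "(cmod (\<Sum>k\<in>A. c k * t ^ k))\<^sup>2 = (\<Sum>i\<in>A. \<Sum>j\<in>A. Re ((c i * cnj (c j)) * (t ^ i * cnj t ^ j)))" for t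
  proof -
    have "complex_of_real ((cmod (\<Sum>k\<in>A. c k * t ^ k))\<^sup>2) = (\<Sum>k\<in>A. c k * t ^ k) * cnj (\<Sum>k\<in>A. c k * t ^ k)"
      by (rule complex_norm_square)
    also have "\<dots> = (\<Sum>i\<in>A. \<Sum>j\<in>A. (c i * cnj (c j)) * (t ^ i * cnj t ^ j))"
      by (simp add: sum_product algebra_simps)
    finally show ?thesis by (metis (no_types, lifting) Re_complex_of_real Re_sum sum.cong)
  qed
  then have "circle_mean (\<lambda>t. (cmod (\<Sum>k\<in>A. c k * t ^ k))\<^sup>2) =
      (\<Sum>i\<in>A. \<Sum>j\<in>A. circle_mean (\<lambda>t. Re ((c i * cnj (c j)) * (t ^ i * cnj t ^ j))))"
    using assms by (simp add: circle_mean_sum continuous_intros)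
  also have "\<dots> = (\<Sum>k\<in>A. (cmod (c k))\<^sup>2)"
    using assms by (simp only: circle_mean_monomial) (simp add: cmod_power2, simp add: power2_eq_square)
  finally show ?thesis .
qed

text \<open>\<open>P - 1\<close> has mean zero and is thus orthogonal to \<open>1\<close> on the
  circle.\<close>

lemma mean_square_minus_one:
  assumes "coeff P 0 = 1"
  shows "circle_mean (\<lambda>t. (cmod (poly P t))\<^sup>2) = 1 + circle_mean (\<lambda>t. (cmod (poly P t - 1))\<^sup>2)"
proof -
  have "circle_mean (\<lambda>t. (cmod (poly P t))\<^sup>2) =
      circle_mean (\<lambda>t. (cmod (poly P t - 1))\<^sup>2 + (2 * Re (poly P t * cnj t ^ 0) + (-1)))"
    by (intro arg_cong[of _ _ circle_mean] ext) (simp add: cmod_power2, simp add: power2_eq_square algebra_simps)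
  also have "\<dots> = circle_mean (\<lambda>t. (cmod (poly P t - 1))\<^sup>2) + (2 * circle_mean (\<lambda>t. Re (poly P t * cnj t ^ 0)) + (-1))"
    by (simp only: circle_mean_add circle_mean_cmult circle_mean_const continuous_intros)
  finally show ?thesis using assms by (simp only: circle_mean_coeff) simp
qed

section \<open>Approximate inverses of polynomials without zeros in the open disc\<close>

definition root_factor :: "complex \<Rightarrow> complex poly" where
  "root_factor u = [:1, - (1 / u):]"

text \<open>
  Cesaro means of the geometric series \<open>1 / (1 - t / u)\<close>. Unlike its partial sums, they
  approximate the inverse of the factor in mean square also when \<open>cmod u = 1\<close>.
\<close>

definition fejer :: "nat \<Rightarrow> complex \<Rightarrow> complex poly" where
  "fejer N u = (\<Sum>k\<le>N. monom ((1 - of_nat k / of_nat (Suc N)) / u ^ k) k)"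

lemma cesaro_geometric:
  fixes y :: complex
  shows "(1 - y) * (\<Sum>k<N. (of_nat N - of_nat k) * y ^ k) = of_nat N - (\<Sum>k=1..N. y ^ k)"
proof (induction N)
  case (Suc N)
  have "(\<Sum>k<Suc N. (of_nat (Suc N) - of_nat k) * y ^ k) =
      (\<Sum>k<N. (of_nat N - of_nat k) * y ^ k) + (\<Sum>k<Suc N. y ^ k)"
    by (simp add: algebra_simps sum.distrib sum_subtractf)
  moreover have "(1 - y) * (\<Sum>k<Suc N. y ^ k) = 1 - y ^ Suc N"
    by (rule one_diff_power_eq[symmetric])
  ultimately show ?case using Suc by (simp add: distrib_left del: sum.lessThan_Suc)
qed simp

text \<open>The product misses \<open>1\<close> by an average of the powers
  \<open>1, ..., N + 1\<close> of \<open>t / u\<close>. These are orthogonal on the circle and, if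
  \<open>cmod u \<ge> 1\<close>, bounded by \<open>1\<close> there, so the mean square of the
  average is at most \<open>1 / (N + 1)\<close>.\<close>

lemma root_factor_fejer:
  "poly (root_factor u * fejer N u) t = 1 - (\<Sum>k=1..Suc N. (t / u) ^ k) / of_nat (Suc N)"
proof -
  have "poly (fejer N u) t = (\<Sum>k<Suc N. (1 - of_nat k / of_nat (Suc N)) * (t / u) ^ k)"
    by (simp add: fejer_def poly_sum poly_monom power_divide lessThan_Suc_atMost)
  also have "\<dots> = (\<Sum>k<Suc N. ((of_nat (Suc N) - of_nat k) * (t / u) ^ k) / of_nat (Suc N))"
    by (rule sum.cong) (simp_all add: field_simps del: of_nat_Suc)
  also have "\<dots> = (\<Sum>k<Suc N. (of_nat (Suc N) - of_nat k) * (t / u) ^ k) / of_nat (Suc N)"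
    by (simp only: sum_divide_distrib)
  finally have "poly (root_factor u * fejer N u) t =
      ((1 - t / u) * (\<Sum>k<Suc N. (of_nat (Suc N) - of_nat k) * (t / u) ^ k)) / of_nat (Suc N)"
    by (simp add: root_factor_def left_diff_distrib diff_divide_distrib del: sum.lessThan_Suc of_nat_Suc)
  then show ?thesis by (simp only: cesaro_geometric) (simp add: diff_divide_distrib del: of_nat_Suc)
qed

lemma fejer_0: "poly (fejer N u) 0 = 1"
  using root_factor_fejer[of u N 0] by (simp add: root_factor_def zero_power)

lemma mean_fejer_error:
  assumes "cmod u \<ge> 1"
  shows "circle_mean (\<lambda>t. (cmod ((\<Sum>k=1..Suc N. (t / u) ^ k) / of_nat (Suc N)))\<^sup>2) \<le> 1 / Suc N"
proof -
  have "circle_mean (\<lambda>t. (cmod ((\<Sum>k=1..Suc N. (t / u) ^ k) / of_nat (Suc N)))\<^sup>2) =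
    circle_mean (\<lambda>t. (cmod (\<Sum>k\<in>{1..Suc N}. (1 / u ^ k / of_nat (Suc N)) * t ^ k))\<^sup>2)"
    by (simp add: sum_divide_distrib power_divide del: sum.cl_ivl_Suc of_nat_Suc)
  also have "\<dots> = (\<Sum>k\<in>{1..Suc N}. (cmod (1 / u ^ k / of_nat (Suc N)))\<^sup>2)"
    by (rule parseval) simp
  also have "\<dots> \<le> (\<Sum>k\<in>{1..Suc N}. (1 / Suc N)\<^sup>2)"
  proof (intro sum_mono power_mono)
    fix k
    have "1 / cmod u ^ k \<le> 1" using one_le_power[OF assms, of k] by (simp add: divide_le_eq)
    then show "cmod (1 / u ^ k / of_nat (Suc N)) \<le> 1 / Suc N"
      by (simp only: norm_divide norm_power norm_one norm_of_nat) (rule divide_right_mono, auto)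
  qed auto
  also have "\<dots> = 1 / Suc N" by (simp add: power2_eq_square)
  finally show ?thesis .
qed

lemma cmod_product_sum_square_le:
  "(cmod ((1 - e) * P - 1))\<^sup>2 \<le> 2 * (cmod (P - 1))\<^sup>2 + 2 * (cmod P)\<^sup>2 * (cmod e)\<^sup>2"
proof -
  have "cmod ((1 - e) * P - 1) = cmod ((P - 1) + (- (e * P)))" by (simp add: algebra_simps)
  also have "\<dots> \<le> cmod (P - 1) + cmod (- (e * P))" by (rule norm_triangle_ineq)
  finally have "(cmod ((1 - e) * P - 1))\<^sup>2 \<le> (cmod (P - 1) + cmod e * cmod P)\<^sup>2"
    by (intro power_mono) (auto simp: norm_mult)
  also have "\<dots> \<le> 2 * (cmod (P - 1))\<^sup>2 + 2 * (cmod e * cmod P)\<^sup>2"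
    using sum_squares_bound[of "cmod (P - 1)" "cmod e * cmod P"] by (simp add: power2_sum)
  finally show ?thesis by (simp add: power_mult_distrib algebra_simps)
qed

text \<open>Mean-square convergence by itself does not pass to products. It is combined with the
  uniform bound \<open>2 ^ size A\<close> on the circle, which holds because each factor is
  \<open>1\<close> minus a quantity of modulus at most \<open>1\<close>.\<close>

lemma fejer_product_approximation:
  assumes "\<And>u. u \<in># A \<Longrightarrow> cmod u \<ge> 1"
  shows "(\<lambda>N. circle_mean (\<lambda>t. (cmod (poly (\<Prod>u\<in>#A. root_factor u * fejer N u) t - 1))\<^sup>2)) \<longlonglongrightarrow> 0"
  using assms
proof (induction A)
  case empty
  then show ?case by (simp add: circle_mean_const)
next
  case (add v A)
  let ?P = "\<lambda>N. poly (\<Prod>u\<in>#A. root_factor u * fejer N u)"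
  let ?e = "\<lambda>u N t. (\<Sum>k=1..Suc N. (t / u) ^ k) / of_nat (Suc N)"
  have e: "cmod (?e u N t) \<le> 1" if "cmod u \<ge> 1" "cmod t = 1" for u N t
  proof -
    have "cmod (\<Sum>k=1..Suc N. (t / u) ^ k) \<le> (\<Sum>k=1..Suc N. 1)"
      using that by (intro order_trans[OF norm_sum] sum_mono)
        (auto simp: norm_power norm_divide power_le_one divide_le_eq_1)
    then show ?thesis by (simp add: norm_divide del: sum.cl_ivl_Suc of_nat_Suc)
  qed
  have "?e v N t = 1 - poly (root_factor v * fejer N v) t" for N t
    by (simp only: root_factor_fejer) simp
  then have cont_e: "continuous_on UNIV (\<lambda>t. c * (cmod (?e v N t))\<^sup>2)" for c N
    by (simp only:) (intro continuous_intros)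
  have cont_P: "continuous_on UNIV (\<lambda>t. c * (cmod (?P N t - 1))\<^sup>2)" for c N
    by (intro continuous_intros)
  have P: "cmod (?P N t) \<le> 2 ^ size A" if "cmod t = 1" for N t
    using add.prems
  proof (induction A)
    case (add w A)
    have "cmod (1 - ?e w N t) \<le> 1 + 1"
      using e[of w t N] add that by (intro order_trans[OF norm_triangle_ineq4] add_mono) auto
    then have "cmod (1 - ?e w N t) * cmod (poly (\<Prod>u\<in>#A. root_factor u * fejer N u) t) \<le> 2 * 2 ^ size A"
      using add by (intro mult_mono) auto
    then show ?case
      by (simp only: image_mset_add_mset prod_mset.add_mset poly_mult[of "root_factor w * fejer N w"]
          root_factor_fejer norm_mult size_add_mset power_Suc)
  qed simp
  have upper: "circle_mean (\<lambda>t. (cmod (poly (\<Prod>u\<in>#add_mset v A. root_factor u * fejer N u) t - 1))\<^sup>2)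
      \<le> 2 * circle_mean (\<lambda>t. (cmod (?P N t - 1))\<^sup>2) + 2 * (2 ^ size A)\<^sup>2 * (1 / Suc N)" for N
  proof -
    have "circle_mean (\<lambda>t. (cmod (poly (\<Prod>u\<in>#add_mset v A. root_factor u * fejer N u) t - 1))\<^sup>2)
      \<le> circle_mean (\<lambda>t. 2 * (cmod (?P N t - 1))\<^sup>2 + 2 * (2 ^ size A)\<^sup>2 * (cmod (?e v N t))\<^sup>2)"
    proof (rule circle_mean_mono)
      fix t :: complex assume t: "cmod t = 1"
      have "(cmod (poly (\<Prod>u\<in>#add_mset v A. root_factor u * fejer N u) t - 1))\<^sup>2 =
          (cmod ((1 - ?e v N t) * ?P N t - 1))\<^sup>2"
        by (simp only: image_mset_add_mset prod_mset.add_mset poly_mult[of "root_factor v * fejer N v"] root_factor_fejer)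
      also have "\<dots> \<le> 2 * (cmod (?P N t - 1))\<^sup>2 + 2 * (cmod (?P N t))\<^sup>2 * (cmod (?e v N t))\<^sup>2"
        by (rule cmod_product_sum_square_le)
      also have "\<dots> \<le> 2 * (cmod (?P N t - 1))\<^sup>2 + 2 * (2 ^ size A)\<^sup>2 * (cmod (?e v N t))\<^sup>2"
        using P[OF t] by (intro add_left_mono mult_right_mono mult_left_mono power_mono) auto
      finally show "(cmod (poly (\<Prod>u\<in>#add_mset v A. root_factor u * fejer N u) t - 1))\<^sup>2 \<le> \<dots>" .
    qed (intro continuous_on_add cont_P cont_e continuous_intros)+
    also have "\<dots> = 2 * circle_mean (\<lambda>t. (cmod (?P N t - 1))\<^sup>2) +
        2 * (2 ^ size A)\<^sup>2 * circle_mean (\<lambda>t. (cmod (?e v N t))\<^sup>2)"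
      by (simp only: circle_mean_add[OF cont_P cont_e] circle_mean_cmult)
    also have "\<dots> \<le> 2 * circle_mean (\<lambda>t. (cmod (?P N t - 1))\<^sup>2) + 2 * (2 ^ size A)\<^sup>2 * (1 / Suc N)"
      using add.prems by (intro add_left_mono mult_left_mono mean_fejer_error) auto
    finally show ?thesis .
  qed
  have "(\<lambda>N. 1 / real (Suc N)) \<longlonglongrightarrow> 0"
    by (rule LIMSEQ_Suc[OF lim_1_over_n])
  then have "(\<lambda>N. 2 * circle_mean (\<lambda>t. (cmod (?P N t - 1))\<^sup>2) + 2 * (2 ^ size A)\<^sup>2 * (1 / Suc N)) \<longlonglongrightarrow> 2 * 0 + 2 * (2 ^ size A)\<^sup>2 * 0"
    by (intro tendsto_add tendsto_mult_left add.IH) (use add.prems in auto)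
  then have lim: "(\<lambda>N. 2 * circle_mean (\<lambda>t. (cmod (?P N t - 1))\<^sup>2) + 2 * (2 ^ size A)\<^sup>2 * (1 / Suc N)) \<longlonglongrightarrow> 0"
    by (simp only: mult_zero_right add_0)
  have nonneg: "0 \<le> circle_mean (\<lambda>t. (cmod (poly Q t - 1))\<^sup>2)" for Q
    by (intro circle_mean_nonneg continuous_intros) simp
  show ?case
    by (rule Lim_null_comparison[OF always_eventually lim]) (simp only: real_norm_def abs_of_nonneg[OF nonneg] upper simp_thms)
qed

lemma map_poly_cnj_mult: "map_poly cnj (P * Q) = map_poly cnj P * map_poly cnj Q"
  by (simp add: poly_eq_iff coeff_map_poly coeff_mult)

lemma real_poly_of_cnj_invariant:
  assumes "map_poly cnj P = P"
  shows "cpoly (map_poly Re P) = P"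
proof (rule poly_eqI)
  fix n
  have "cnj (coeff P n) = coeff P n" using arg_cong[OF assms, of "\<lambda>q. coeff q n"] by (simp add: coeff_map_poly)
  then show "coeff (cpoly (map_poly Re P)) n = coeff P n"
    by (simp add: coeff_map_poly complex_eq_iff)
qed

text \<open>A multiset closed under conjugation gives a product invariant under conjugation, hence a
  real polynomial on which the functionals can act.\<close>

lemma real_product:
  assumes "\<And>u. map_poly cnj (F u) = F (cnj u)" and "image_mset cnj A = A"
  obtains S where "cpoly S = (\<Prod>u\<in>#A. F u)"
proof -
  have "map_poly cnj (\<Prod>u\<in>#A. F u) = (\<Prod>u\<in>#image_mset cnj A. F u)"
    by (induction A) (simp_all add: map_poly_cnj_mult assms(1))
  then show thesis using that real_poly_of_cnj_invariant assms(2) by metis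
qed

text \<open>A polynomial without zeros in the open disc is outer, even if it has zeros on the
  circle. The products of the \<open>fejer\<close> factors exhibit the approximate inverses
  explicitly.\<close>

lemma outer_polynomial:
  assumes A: "\<And>u. u \<in># A \<Longrightarrow> cmod u \<ge> 1" "image_mset cnj A = A"
  obtains B where "cpoly B = (\<Prod>u\<in>#A. root_factor u)" "coeff B 0 = 1"
    "\<And>\<epsilon>. \<epsilon> > 0 \<Longrightarrow> \<exists>S. coeff S 0 = 1 \<and>
      circle_mean (\<lambda>t. (cmod (poly (cpoly (B * S)) t - 1))\<^sup>2) < \<epsilon>"
proof -
  obtain B where B: "cpoly B = (\<Prod>u\<in>#A. root_factor u)"
    by (rule real_product[OF _ A(2), of root_factor]) (auto simp: root_factor_def map_poly_pCons)
  have "\<exists>S. cpoly S = (\<Prod>u\<in>#A. fejer N u)" for N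
  proof (rule real_product[OF _ A(2), of "fejer N"])
    fix u
    have "coeff (map_poly cnj (fejer N u)) k = coeff (fejer N (cnj u)) k" for k
      by (simp add: coeff_map_poly fejer_def coeff_sum if_distrib cong: if_cong)
    then show "map_poly cnj (fejer N u) = fejer N (cnj u)" by (simp add: poly_eq_iff)
  qed blast
  then obtain S where S: "\<And>N. cpoly (S N) = (\<Prod>u\<in>#A. fejer N u)" by metis
  have c0: "coeff Q 0 = 1" if "poly (cpoly Q) 0 = 1" for Q
    using that by (simp add: poly_0_coeff_0 coeff_map_poly)
  have p0: "poly (\<Prod>u\<in>#A. F u) 0 = 1" if "\<And>u. poly (F u) 0 = 1" for F :: "complex \<Rightarrow> complex poly"
    by (induction A) (auto simp: that)
  have BS: "cpoly (B * S N) = (\<Prod>u\<in>#A. root_factor u * fejer N u)" for N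
    by (simp add: cpoly_mult B S prod_mset.distrib)
  show thesis
  proof (rule that[OF B])
    show "coeff B 0 = 1" by (rule c0) (simp add: B p0 root_factor_def)
    fix \<epsilon> :: real assume "\<epsilon> > 0"
    with fejer_product_approximation[OF A(1)]
    have "\<forall>\<^sub>F N in sequentially. circle_mean (\<lambda>t. (cmod (poly (\<Prod>u\<in>#A. root_factor u * fejer N u) t - 1))\<^sup>2) < \<epsilon>"
      by (rule order_tendstoD(2))
    then obtain N where "circle_mean (\<lambda>t. (cmod (poly (cpoly (B * S N)) t - 1))\<^sup>2) < \<epsilon>"
      by (auto simp: BS eventually_sequentially)
    moreover have "coeff (S N) 0 = 1" by (rule c0) (simp add: S p0 fejer_0)
    ultimately show "\<exists>S. coeff S 0 = 1 \<and>
      circle_mean (\<lambda>t. (cmod (poly (cpoly (B * S)) t - 1))\<^sup>2) < \<epsilon>" by blast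
  qed
qed

section \<open>Limits of moments as means over the unit circle\<close>

definition (in orthonormal_polys) shifted_combination :: "real poly \<Rightarrow> nat \<Rightarrow> real poly" where
  "shifted_combination s n = (\<Sum>k\<le>degree s. smult (coeff s k) (p (n + k)))"

context nevai_polys
begin

text \<open>In the limit \<open>p (n + i)\<close> behaves like \<open>t ^ i\<close> and
  multiplication by \<open>x\<close> like multiplication by \<open>Re t = (t + cnj t) / 2\<close>,
  because the recurrence coefficients tend to \<open>1 / 2\<close>, \<open>0\<close> and
  \<open>1 / 2\<close>. The induction on \<open>g\<close> peels off one factor \<open>x\<close> at a
  time.\<close>

lemma moment_limit:
  "(\<lambda>n. I (g * p (n + i) * p (n + j))) \<longlonglongrightarrow> circle_mean (\<lambda>t. poly g (Re t) * Re (t ^ i * cnj t ^ j))"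
proof (induction g arbitrary: i j)
  case 0
  then show ?case by (simp add: zero circle_mean_const)
next
  case (pCons a g)
  let ?E = "\<lambda>g i j. circle_mean (\<lambda>t. poly g (Re t) * Re (t ^ i * cnj t ^ j))"
  have cont: "continuous_on UNIV (\<lambda>t. poly g (Re t) * Re (t ^ i * cnj t ^ j))" for g i j
    by (intro continuous_intros)
  have unit: "t * cnj t = 1" if "cmod t = 1" for t
    using that by (simp add: complex_norm_square[symmetric])
  \<comment> \<open>Lowering \<open>j\<close> is written as raising \<open>i\<close>, and raising
    \<open>j\<close> as raising \<open>i\<close> once and \<open>j\<close> twice, both by
    \<open>t * cnj t = 1\<close>. This keeps the exponents natural and matches the shift of
    \<open>n\<close> by one in \<open>split\<close>.\<close>
  have E: "?E (pCons a g) i j = a * (if i = j then 1 else 0) + (1 / 2 * ?E g (Suc i) (Suc (Suc j)) + 1 / 2 * ?E g (Suc i) j)"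
  proof -
    have "?E (pCons a g) i j = circle_mean (\<lambda>t. a * Re (1 * (t ^ i * cnj t ^ j)) +
       (1 / 2 * (poly g (Re t) * Re (t ^ Suc i * cnj t ^ Suc (Suc j))) + 1 / 2 * (poly g (Re t) * Re (t ^ Suc i * cnj t ^ j))))"
    proof (rule circle_mean_cong)
      fix t :: complex assume "cmod t = 1"
      define z where "z = t ^ i * cnj t ^ j"
      have "t ^ Suc i * cnj t ^ Suc (Suc j) = (t * cnj t) * (cnj t * z)" "t ^ Suc i * cnj t ^ j = t * z"
        by (simp_all add: z_def mult_ac)
      moreover have "Re (cnj t * z) + Re (t * z) = 2 * Re t * Re z" by simp
      ultimately have "Re (t ^ Suc i * cnj t ^ Suc (Suc j)) + Re (t ^ Suc i * cnj t ^ j) = 2 * Re t * Re (t ^ i * cnj t ^ j)"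
        unfolding unit[OF \<open>cmod t = 1\<close>] z_def[symmetric] mult_1 by metis
      then show "poly (pCons a g) (Re t) * Re (t ^ i * cnj t ^ j) = a * Re (1 * (t ^ i * cnj t ^ j)) +
       (1 / 2 * (poly g (Re t) * Re (t ^ Suc i * cnj t ^ Suc (Suc j))) + 1 / 2 * (poly g (Re t) * Re (t ^ Suc i * cnj t ^ j)))"
        by (simp only: poly_pCons mult_1 flip: distrib_left mult.assoc)
          (simp add: algebra_simps del: times_complex.simps)
    qed
    also have "\<dots> = a * (if i = j then 1 else 0) + (1 / 2 * ?E g (Suc i) (Suc (Suc j)) + 1 / 2 * ?E g (Suc i) j)"
      by (subst circle_mean_add, (intro continuous_intros)+, subst circle_mean_add, (intro continuous_intros)+)
        (simp only: circle_mean_cmult circle_mean_monomial one_complex.sel)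
    finally show ?thesis .
  qed
  have split: "I (pCons a g * p (Suc n + i) * p (Suc n + j)) = a * (if i = j then 1 else 0) +
      (offdiag (Suc (Suc n + j)) * I (g * p (n + Suc i) * p (n + Suc (Suc j))) +
       diag (Suc n + j) * I (g * p (n + Suc i) * p (n + Suc j)) +
       offdiag (Suc n + j) * I (g * p (n + Suc i) * p (n + j)))" for n
  proof -
    have "pCons a g * p (Suc n + i) * p (Suc n + j) =
      smult a (p (Suc n + i) * p (Suc n + j)) + g * p (Suc n + i) * ([:0, 1:] * p (Suc n + j))"
      by (rule real_poly_eqI) (simp add: algebra_simps)
    also have "\<dots> = smult a (p (Suc n + i) * p (Suc n + j)) +
       (smult (offdiag (Suc (Suc n + j))) (g * p (n + Suc i) * p (n + Suc (Suc j))) +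
       smult (diag (Suc n + j)) (g * p (n + Suc i) * p (n + Suc j)) +
       smult (offdiag (Suc n + j)) (g * p (n + Suc i) * p (n + j)))"
      by (subst recurrence) (rule real_poly_eqI, simp add: algebra_simps)
    finally show ?thesis by (simp add: add smult orthonormal)
  qed
  have shift: "f \<longlonglongrightarrow> l \<Longrightarrow> (\<lambda>n. f (Suc n + c)) \<longlonglongrightarrow> l" for f :: "nat \<Rightarrow> real" and l c
    by (rule LIMSEQ_Suc) (simp add: LIMSEQ_ignore_initial_segment)
  have "(\<lambda>n. I (pCons a g * p (Suc n + i) * p (Suc n + j))) \<longlonglongrightarrow>
     a * (if i = j then 1 else 0) + (1 / 2 * ?E g (Suc i) (Suc (Suc j)) + 0 * ?E g (Suc i) (Suc j) + 1 / 2 * ?E g (Suc i) j)"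
    unfolding split using shift[OF offdiag_lim, of "Suc j"] 
    by (intro tendsto_intros pCons.IH shift[OF offdiag_lim] shift[OF diag_lim]) simp
  then have "(\<lambda>n. I (pCons a g * p (Suc n + i) * p (Suc n + j))) \<longlonglongrightarrow> ?E (pCons a g) i j"
    unfolding E by simp
  then show ?case by (rule LIMSEQ_imp_Suc)
qed

lemma combination_limit:
  "(\<lambda>n. I (g * shifted_combination s n * shifted_combination s' n)) \<longlonglongrightarrow>
     circle_mean (\<lambda>t. poly g (Re t) * Re (poly (cpoly s) t * cnj (poly (cpoly s') t)))"
proof -
  have split: "I (g * shifted_combination s n * shifted_combination s' n) =
     (\<Sum>i\<le>degree s. \<Sum>j\<le>degree s'. coeff s i * coeff s' j * I (g * p (n + i) * p (n + j)))" for n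
  proof -
    have "g * shifted_combination s n * shifted_combination s' n =
       (\<Sum>i\<le>degree s. \<Sum>j\<le>degree s'. smult (coeff s i * coeff s' j) (g * p (n + i) * p (n + j)))"
      by (rule real_poly_eqI) (simp add: shifted_combination_def poly_sum sum_product sum_distrib_left algebra_simps)
    then show ?thesis by (simp only: sum smult)
  qed
  have cp: "poly (cpoly s) t = (\<Sum>i\<le>degree s. of_real (coeff s i) * t ^ i)" for s t
    by (simp add: poly_altdef coeff_map_poly degree_map_poly)
  have "Re (poly (cpoly s) t * cnj (poly (cpoly s') t)) =
     (\<Sum>i\<le>degree s. \<Sum>j\<le>degree s'. coeff s i * coeff s' j * Re (t ^ i * cnj t ^ j))" for t
  proof -
    have "poly (cpoly s) t * cnj (poly (cpoly s') t) =
      (\<Sum>i\<le>degree s. \<Sum>j\<le>degree s'. of_real (coeff s i * coeff s' j) * (t ^ i * cnj t ^ j))"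
      by (simp add: cp sum_product algebra_simps)
    then show ?thesis by (simp only: Re_sum) simp
  qed
  then have "circle_mean (\<lambda>t. poly g (Re t) * Re (poly (cpoly s) t * cnj (poly (cpoly s') t))) =
     circle_mean (\<lambda>t. \<Sum>i\<le>degree s. \<Sum>j\<le>degree s'. coeff s i * coeff s' j * (poly g (Re t) * Re (t ^ i * cnj t ^ j)))"
    by (simp add: sum_distrib_left algebra_simps)
  also have "\<dots> = (\<Sum>i\<le>degree s. \<Sum>j\<le>degree s'. coeff s i * coeff s' j * circle_mean (\<lambda>t. poly g (Re t) * Re (t ^ i * cnj t ^ j)))"
    by (simp add: circle_mean_sum continuous_intros circle_mean_cmult del: times_complex.simps)
  finally have eq: "circle_mean (\<lambda>t. poly g (Re t) * Re (poly (cpoly s) t * cnj (poly (cpoly s') t))) = \<dots>" .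
  show ?thesis unfolding split eq by (intro tendsto_intros moment_limit)
qed

end

section \<open>Dividing the functional by a polynomial\<close>

lemma poly_cpoly_cnj: "poly (cpoly s) (cnj t) = cnj (poly (cpoly s) t)"
  by (induction s) (auto simp: map_poly_pCons)

lemma cmod_reflect_poly:
  assumes "cmod t = 1" "coeff V 0 \<noteq> 0"
  shows "cmod (poly (cpoly (reflect_poly V)) t) = cmod (poly (cpoly V) t)"
proof -
  have "t * cnj t = 1" using assms(1) by (simp add: complex_norm_square[symmetric])
  then have t: "inverse t = cnj t" "t \<noteq> 0" by (auto intro: inverse_unique)
  have "cpoly (reflect_poly V) = reflect_poly (cpoly V)"
    by (rule poly_eqI) (simp add: coeff_map_poly coeff_reflect_poly degree_map_poly)
  then have "poly (cpoly (reflect_poly V)) t = t ^ degree (cpoly V) * poly (cpoly V) (inverse t)"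
    using t by (simp add: poly_reflect_poly_nz)
  then show ?thesis using assms(1) by (simp add: t(1) poly_cpoly_cnj norm_mult norm_power)
qed

lemma circle_mean_abs_diff_le:
  assumes "continuous_on UNIV f" "continuous_on UNIV g" "continuous_on UNIV b"
    and "\<And>t. cmod t = 1 \<Longrightarrow> \<bar>f t - g t\<bar> \<le> b t"
  shows "\<bar>circle_mean f - circle_mean g\<bar> \<le> circle_mean b"
proof -
  have "f t \<le> g t + b t" "g t \<le> f t + b t" if "cmod t = 1" for t
    using assms(4)[OF that] by auto
  then have "circle_mean f \<le> circle_mean (\<lambda>t. g t + b t)" "circle_mean g \<le> circle_mean (\<lambda>t. f t + b t)"
    using assms by (auto intro!: circle_mean_mono continuous_intros)
  then show ?thesis using assms by (simp add: circle_mean_add)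
qed

context orthonormal_polys
begin

lemma degree_shifted_combination:
  assumes "lead_coeff s = 1"
  shows "coeff (shifted_combination s n) (n + degree s) = lead_coeff (p (n + degree s))"
    "degree (shifted_combination s n) = n + degree s"
proof -
  have "coeff (shifted_combination s n) (n + degree s) =
     (\<Sum>k\<le>degree s. if k = degree s then lead_coeff (p (n + degree s)) else 0)"
    unfolding shifted_combination_def coeff_sum
    using assms by (intro sum.cong) (auto simp: coeff_eq_0 degree_p)
  then show top: "coeff (shifted_combination s n) (n + degree s) = lead_coeff (p (n + degree s))" by simp
  show "degree (shifted_combination s n) = n + degree s"
  proof (rule antisym)
    show "degree (shifted_combination s n) \<le> n + degree s"
      unfolding shifted_combination_def by (intro degree_sum_le) (auto simp: degree_p intro: order_trans[OF degree_smult_le])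
    show "n + degree s \<le> degree (shifted_combination s n)"
      using top p_nonzero[of "n + degree s"] by (intro le_degree) simp
  qed
qed

text \<open>The index shift that pairs \<open>l (n + k)\<close> with \<open>p n\<close> thereby
  becomes a factor \<open>t ^ k\<close> in the circle means.\<close>

lemma shifted_combination_monom:
  assumes "S \<noteq> 0"
  shows "shifted_combination (monom 1 k * S) n = shifted_combination S (n + k)"
proof -
  have "shifted_combination (monom 1 k * S) n =
      (\<Sum>j\<le>degree S + k. smult (coeff (monom 1 k * S) j) (p (n + j)))"
    using assms by (simp add: shifted_combination_def degree_mult_eq degree_monom_eq add.commute)
  also have "\<dots> = (\<Sum>j\<in>(\<lambda>i. i + k) ` {..degree S}. smult (coeff (monom 1 k * S) j) (p (n + j)))"
  proof (rule sum.mono_neutral_right)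
    show "\<forall>i\<in>{..degree S + k} - (\<lambda>i. i + k) ` {..degree S}. smult (coeff (monom 1 k * S) i) (p (n + i)) = 0"
    proof
      fix i assume i: "i \<in> {..degree S + k} - (\<lambda>i. i + k) ` {..degree S}"
      have "i < k"
      proof (rule ccontr)
        assume "\<not> i < k"
        then have "i = (i - k) + k" "i - k \<le> degree S" using i by auto
        then show False using i by blast
      qed
      then show "smult (coeff (monom 1 k * S) i) (p (n + i)) = 0" by (simp add: coeff_monom_mult)
    qed
  qed auto
  also have "\<dots> = shifted_combination S (n + k)"
    by (subst sum.reindex) (auto simp: shifted_combination_def coeff_monom_mult inj_on_def add_ac)
  finally show ?thesis .
qed

lemma shifted_combination_1: "shifted_combination 1 n = p n"
  by (simp add: shifted_combination_def)

end

context nevai_polys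
begin

lemma lead_quotient_limit:
  "(\<lambda>n. lead_coeff (p (n + j)) / lead_coeff (p n)) \<longlonglongrightarrow> 2 ^ j"
proof (induction j)
  case 0
  then show ?case using p_nonzero by simp
next
  case (Suc j)
  have nz: "offdiag (Suc n) \<noteq> 0" "lead_coeff (p n) \<noteq> 0" for n
    using offdiag_pos[of n] lead_pos[of n] by (auto simp del: leading_coeff_0_iff)
  have "lead_coeff (p (n + Suc j)) / lead_coeff (p n) =
      lead_coeff (p (n + j)) / lead_coeff (p n) * (1 / offdiag (Suc (n + j)))" for n
    using lead_offdiag[of "n + j"] nz[of "n + j"] by (simp add: field_simps del: leading_coeff_0_iff)
  moreover have "(\<lambda>n. lead_coeff (p (n + j)) / lead_coeff (p n) * (1 / offdiag (Suc (n + j)))) \<longlonglongrightarrow> 2 ^ j * (1 / (1 / 2))"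
    using LIMSEQ_ignore_initial_segment[OF offdiag_lim, of "Suc j"]
    by (intro tendsto_intros Suc.IH) auto
  ultimately show ?case by (simp add: mult.commute)
qed

end

text \<open>Cyclicity of \<open>B\<close> in the Hardy space of the disc, normalised at
  \<open>0\<close>: the constant \<open>1\<close> is a mean-square limit of polynomial multiples of
  \<open>B\<close>.\<close>

definition square_approximable :: "real poly \<Rightarrow> bool" where
  "square_approximable B \<longleftrightarrow> coeff B 0 = 1 \<and>
     (\<forall>\<epsilon>>0. \<exists>S. coeff S 0 = 1 \<and> circle_mean (\<lambda>t. (cmod (poly (cpoly (B * S)) t - 1))\<^sup>2) < \<epsilon>)"

text \<open>
  Here \<open>J\<close> stands for integration against the measure divided by \<open>\<rho>\<close>. The polynomial \<open>\<rho>1\<close> collects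
  the zeros of \<open>\<rho>\<close> on \<open>[-1, 1]\<close>, and \<open>h\<close> approximates \<open>\<rho>1\<^sup>2 / \<rho>\<close> from above.
\<close>

locale divided_functional = nevai_polys I p + J: positive_functional J for I p J +
  fixes \<rho> B :: "real poly" and C :: real and \<rho>1 D :: "real poly" and m :: nat and l :: "nat \<Rightarrow> real poly"
  assumes J_mult: "J (\<rho> * f) = I f"
    and C_pos: "C > 0"
    and rho_circle: "cmod t = 1 \<Longrightarrow> poly \<rho> (Re t) = C * (cmod (poly (cpoly B) t))\<^sup>2"
    and B: "square_approximable B"
    and lead_rho1: "lead_coeff \<rho>1 = 1"
    and rho1_circle: "cmod t = 1 \<Longrightarrow> 4 ^ degree \<rho>1 * (poly \<rho>1 (Re t))\<^sup>2 = (cmod (poly (cpoly D) t))\<^sup>2"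
    and D: "square_approximable D"
    and majorant: "\<epsilon> > 0 \<Longrightarrow> \<exists>h. \<forall>x\<in>{-1..1}. (poly \<rho>1 x)\<^sup>2 \<le> poly h x * poly \<rho> x \<and>
      poly h x * poly \<rho> x \<le> (poly \<rho>1 x)\<^sup>2 + \<epsilon> * poly \<rho> x"
    and degree_l: "n > m \<Longrightarrow> degree (l n) = n"
    and lead_l: "n > m \<Longrightarrow> lead_coeff (l n) = lead_coeff (p n)"
    and J_orthogonal: "n > m \<Longrightarrow> degree q < n \<Longrightarrow> J (l n * q) = 0"
begin

lemma degree_diff_l:
  assumes "n > m" "degree R = n" "lead_coeff R = lead_coeff (p n)"
  shows "degree (R - l n) < n"
proof (rule degree_lessI)
  show "\<forall>k\<ge>n. coeff (R - l n) k = 0"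
  proof (intro allI impI)
    fix k assume "n \<le> k"
    then show "coeff (R - l n) k = 0"
      using assms degree_l[OF assms(1)] lead_l[OF assms(1)] by (cases "k = n") (auto simp: coeff_eq_0)
  qed
qed (use assms in auto)

text \<open>\<open>R - l n\<close> has degree below \<open>n\<close>, so it is
  \<open>J\<close>-orthogonal to \<open>l n\<close> and Pythagoras applies.\<close>

lemma l_minimal:
  assumes "n > m" "degree R = n" "lead_coeff R = lead_coeff (p n)"
  shows "J (l n * l n) \<le> J (R * R)"
proof -
  have "R * R = l n * l n + smult 2 (l n * (R - l n)) + (R - l n) * (R - l n)"
    by (rule real_poly_eqI) (simp add: algebra_simps)
  then have "J (R * R) = J (l n * l n) + J ((R - l n) * (R - l n))"
    using J_orthogonal[OF assms(1) degree_diff_l[OF assms]] by (simp add: J.add J.smult)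
  moreover have "0 \<le> J ((R - l n) * (R - l n))" by (rule J.nonneg) simp
  ultimately show ?thesis by simp
qed

text \<open>Minimality is applied to a multiple of \<open>\<rho>1 * Y n\<close>. The majorant
  \<open>h\<close> bounds its \<open>J\<close>-norm by a value of \<open>I\<close>, whose limit is,
  up to a small excess, \<open>1 / C\<close> times the mean of \<open>(cmod (D S))\<^sup>2\<close>;
  and \<open>D S\<close> is close to \<open>1\<close>.\<close>

lemma l_norm_upper:
  assumes "\<delta> > 0"
  shows "\<forall>\<^sub>F n in sequentially. J (l n * l n) < (1 + \<delta>) / C"
proof -
  obtain S where S: "coeff S 0 = 1"
    "circle_mean (\<lambda>t. (cmod (poly (cpoly (D * S)) t - 1))\<^sup>2) < \<delta> / 3"
    using D \<open>\<delta> > 0\<close> unfolding square_approximable_def by (meson divide_pos_pos zero_less_numeral)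
  define V where "V = B * S"
  \<comment> \<open>Reversal preserves the modulus on the circle and moves the constant coefficient
    \<open>1\<close> of \<open>V\<close> to the top, which fixes the leading coefficient of
    \<open>Y n\<close>.\<close>
  define s where "s = reflect_poly V"
  define N where "N = degree V"
  define W where "W = circle_mean (\<lambda>t. poly \<rho> (Re t) * (cmod (poly (cpoly S) t))\<^sup>2)"
  \<comment> \<open>Makes the excess of \<open>h\<close> over the exact weight contribute at most
    \<open>\<delta> / 3\<close>. The summand \<open>1\<close> keeps the denominator
    positive.\<close>
  define \<epsilon> where "\<epsilon> = \<delta> / (3 * 4 ^ degree \<rho>1 * (\<bar>W\<bar> + 1))"
  have "\<epsilon> > 0" using \<open>\<delta> > 0\<close> by (auto simp: \<epsilon>_def intro!: divide_pos_pos mult_pos_pos)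
  then obtain h where h: "\<And>x. x \<in> {-1..1} \<Longrightarrow> (poly \<rho>1 x)\<^sup>2 \<le> poly h x * poly \<rho> x"
    "\<And>x. x \<in> {-1..1} \<Longrightarrow> poly h x * poly \<rho> x \<le> (poly \<rho>1 x)\<^sup>2 + \<epsilon> * poly \<rho> x"
    using majorant by meson
  have eps: "\<epsilon> * 4 ^ degree \<rho>1 * W < \<delta> / 2"
  proof -
    have "\<epsilon> * 4 ^ degree \<rho>1 * W \<le> \<epsilon> * 4 ^ degree \<rho>1 * (\<bar>W\<bar> + 1)"
      using \<open>\<epsilon> > 0\<close> by (intro mult_left_mono) auto
    also have "\<dots> = \<delta> / 3"
    proof -
      have "(4::real) ^ degree \<rho>1 * (\<bar>W\<bar> + 1) \<noteq> 0" by (simp add: add_nonneg_eq_0_iff)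
      then show ?thesis unfolding \<epsilon>_def
        by (metis (no_types, opaque_lifting) divide_divide_eq_left mult.assoc nonzero_eq_divide_eq)
    qed
    finally show ?thesis using \<open>\<delta> > 0\<close> by simp
  qed
  have V0: "coeff V 0 = 1" using B S(1) by (simp add: V_def square_approximable_def coeff_mult)
  then have s: "degree s = N" "lead_coeff s = 1"
    by (simp_all add: s_def N_def coeff_reflect_poly)
  define Y where "Y n = shifted_combination s n" for n
  have Y: "degree (Y n) = n + N" "lead_coeff (Y n) = lead_coeff (p (n + N))" for n
    using degree_shifted_combination[OF s(2), of n] by (simp_all add: Y_def s(1))
  \<comment> \<open>Gives the competitor the leading coefficient that minimality demands. It tends
    to \<open>2 ^ degree \<rho>1\<close>, and this is the origin of
    \<open>4 ^ degree \<rho>1\<close> in \<open>rho1_circle\<close>.\<close>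
  define r where "r n = lead_coeff (p (n + N + degree \<rho>1)) / lead_coeff (p (n + N))" for n
  define R where "R n = smult (r n) (\<rho>1 * Y n)" for n
  have r: "r n > 0" for n using lead_pos by (simp add: r_def)
  have R: "degree (R n) = n + N + degree \<rho>1" "lead_coeff (R n) = lead_coeff (p (n + N + degree \<rho>1))" for n
  proof -
    have "lead_coeff (R n) = r n * lead_coeff (p (n + N))"
      by (simp only: R_def lead_coeff_mult lead_coeff_smult lead_rho1 Y(2) mult_1)
    then show "lead_coeff (R n) = lead_coeff (p (n + N + degree \<rho>1))"
      using lead_pos[of "n + N"] by (simp add: r_def del: leading_coeff_0_iff)
    have "\<rho>1 \<noteq> 0" using lead_rho1 by auto
    moreover have "Y n \<noteq> 0" using Y(2)[of n] lead_pos[of "n + N"] by (auto simp del: leading_coeff_0_iff)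
    ultimately show "degree (R n) = n + N + degree \<rho>1"
      using r[of n] by (simp add: R_def degree_mult_eq Y)
  qed
  have upper: "J (R n * R n) \<le> (r n)\<^sup>2 * I (h * Y n * Y n)" for n
  proof -
    have "J (R n * R n) \<le> J (smult ((r n)\<^sup>2) (\<rho> * (h * Y n * Y n)))"
    proof (rule J.mono)
      fix x :: real assume x: "x \<in> {-1..1}"
      have "(r n * poly (Y n) x)\<^sup>2 * (poly \<rho>1 x)\<^sup>2 \<le> (r n * poly (Y n) x)\<^sup>2 * (poly h x * poly \<rho> x)"
        by (rule mult_left_mono[OF h(1)[OF x]]) simp
      then show "poly (R n * R n) x \<le> poly (smult ((r n)\<^sup>2) (\<rho> * (h * Y n * Y n))) x"
        by (simp add: R_def power2_eq_square algebra_simps)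
    qed
    then show ?thesis by (simp only: J.smult J_mult)
  qed
  define H where "H = circle_mean (\<lambda>t. poly h (Re t) * Re (poly (cpoly s) t * cnj (poly (cpoly s) t)))"
  have "(\<lambda>n. (r n)\<^sup>2 * I (h * Y n * Y n)) \<longlonglongrightarrow> (2 ^ degree \<rho>1)\<^sup>2 * H"
    unfolding Y_def H_def r_def
    by (intro tendsto_intros combination_limit
        LIMSEQ_ignore_initial_segment[OF lead_quotient_limit[of "degree \<rho>1"], of N])
  moreover have "(2 ^ degree \<rho>1)\<^sup>2 * H < (1 + \<delta>) / C"
  proof -
    have DS0: "coeff (cpoly (D * S)) 0 = 1"
      using D S(1) by (simp add: square_approximable_def coeff_mult coeff_map_poly)
    have "(2 ^ degree \<rho>1)\<^sup>2 * H = circle_mean (\<lambda>t. 4 ^ degree \<rho>1 * (poly h (Re t) * Re (poly (cpoly s) t * cnj (poly (cpoly s) t))))"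
      unfolding H_def circle_mean_cmult by (simp add: power2_eq_square flip: power_mult_distrib)
    also have "\<dots> \<le> circle_mean (\<lambda>t. 1 / C * (cmod (poly (cpoly (D * S)) t))\<^sup>2 +
        \<epsilon> * 4 ^ degree \<rho>1 / C * (poly \<rho> (Re t) * (cmod (poly (cpoly S) t))\<^sup>2))"
    proof (rule circle_mean_mono)
      fix t :: complex assume t: "cmod t = 1"
      define b d e where "b = cmod (poly (cpoly B) t)" and "d = cmod (poly (cpoly D) t)"
        and "e = cmod (poly (cpoly S) t)"
      have x: "Re t \<in> {-1..1}" using abs_Re_le_cmod[of t] t by auto
      have "Re (poly (cpoly s) t * cnj (poly (cpoly s) t)) = (cmod (poly (cpoly s) t))\<^sup>2"
        by (simp only: complex_norm_square[symmetric] Re_complex_of_real)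
      also have "\<dots> = b\<^sup>2 * e\<^sup>2"
        using cmod_reflect_poly[OF t, of V] V0
        by (simp add: s_def V_def cpoly_mult norm_mult power_mult_distrib b_def e_def)
      also have "b\<^sup>2 = poly \<rho> (Re t) / C" using rho_circle[OF t] C_pos by (simp add: b_def)
      finally have "4 ^ degree \<rho>1 * (poly h (Re t) * Re (poly (cpoly s) t * cnj (poly (cpoly s) t)))
          = 4 ^ degree \<rho>1 * e\<^sup>2 / C * (poly h (Re t) * poly \<rho> (Re t))" by simp
      also have "\<dots> \<le> 4 ^ degree \<rho>1 * e\<^sup>2 / C * ((poly \<rho>1 (Re t))\<^sup>2 + \<epsilon> * poly \<rho> (Re t))"
        using C_pos by (intro mult_left_mono h(2)[OF x]) auto
      also have "\<dots> = 1 / C * (e\<^sup>2 * (4 ^ degree \<rho>1 * (poly \<rho>1 (Re t))\<^sup>2)) + \<epsilon> * 4 ^ degree \<rho>1 / C * (poly \<rho> (Re t) * e\<^sup>2)"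
        by (simp add: algebra_simps add_divide_distrib)
      also have "e\<^sup>2 * (4 ^ degree \<rho>1 * (poly \<rho>1 (Re t))\<^sup>2) = (cmod (poly (cpoly (D * S)) t))\<^sup>2"
        unfolding rho1_circle[OF t] by (simp add: cpoly_mult norm_mult power_mult_distrib e_def)
      finally show "4 ^ degree \<rho>1 * (poly h (Re t) * Re (poly (cpoly s) t * cnj (poly (cpoly s) t))) \<le>
        1 / C * (cmod (poly (cpoly (D * S)) t))\<^sup>2 + \<epsilon> * 4 ^ degree \<rho>1 / C * (poly \<rho> (Re t) * (cmod (poly (cpoly S) t))\<^sup>2)"
        unfolding e_def .
    qed (intro continuous_intros)+
    also have "\<dots> = 1 / C * circle_mean (\<lambda>t. (cmod (poly (cpoly (D * S)) t))\<^sup>2) + \<epsilon> * 4 ^ degree \<rho>1 / C * W"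
      unfolding W_def circle_mean_cmult[symmetric] by (intro circle_mean_add continuous_intros)
    also have "\<dots> = (circle_mean (\<lambda>t. (cmod (poly (cpoly (D * S)) t))\<^sup>2) + \<epsilon> * 4 ^ degree \<rho>1 * W) / C"
      by (simp add: add_divide_distrib)
    also have "\<dots> < (1 + \<delta>) / C"
      using S(2) eps C_pos \<open>\<delta> > 0\<close> unfolding mean_square_minus_one[OF DS0]
      by (intro divide_strict_right_mono) auto
    finally show ?thesis .
  qed
  ultimately have "\<forall>\<^sub>F n in sequentially. (r n)\<^sup>2 * I (h * Y n * Y n) < (1 + \<delta>) / C"
    by (rule order_tendstoD(2))
  moreover have "\<forall>\<^sub>F n in sequentially. n > m" by (rule eventually_gt_at_top)
  ultimately have "\<forall>\<^sub>F n in sequentially. J (l (n + (N + degree \<rho>1)) * l (n + (N + degree \<rho>1))) < (1 + \<delta>) / C"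
  proof eventually_elim
    case (elim n)
    have "J (l (n + (N + degree \<rho>1)) * l (n + (N + degree \<rho>1))) \<le> J (R n * R n)"
      by (rule l_minimal) (use elim R[of n] in \<open>simp_all add: add.assoc\<close>)
    then show ?case using upper[of n] elim by linarith
  qed
  then show ?thesis by (subst (asm) eventually_sequentially_seg)
qed

text \<open>\<open>l n\<close> and \<open>p n\<close> share their leading coefficient, so
  \<open>I (l n * p n)\<close> equals \<open>I (p n * p n)\<close>; the higher
  \<open>p (n + k)\<close> are orthogonal to \<open>l n\<close> by degree.\<close>

lemma inner_l_shifted:
  assumes "n > m"
  shows "I (l n * shifted_combination S n) = coeff S 0"
proof -
  have "I (l n * p n) = 1"
  proof -
    have "degree (p n - l n) < n" using degree_diff_l[OF assms, of "p n"] by (simp add: degree_p)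
    then have "I ((p n - l n) * p n) = 0" by (rule orthogonal_lower)
    then show ?thesis by (simp add: left_diff_distrib diff orthonormal)
  qed
  moreover have "I (l n * p (n + k)) = 0" if "k > 0" for k
    using that by (intro orthogonal_lower) (simp add: degree_l[OF assms])
  ultimately have eq: "I (l n * p (n + k)) = (if k = 0 then 1 else 0)" for k by simp
  have "I (l n * shifted_combination S n) = (\<Sum>k\<le>degree S. coeff S k * I (l n * p (n + k)))"
    by (simp add: shifted_combination_def sum_distrib_left sum smult)
  then show ?thesis by (simp add: eq if_distrib cong: if_cong)
qed

text \<open>The coefficient is \<open>J (L * (\<rho> * p n))\<close> with
  \<open>L = l (n + k)\<close>. Replacing \<open>L\<close> by \<open>g / C\<close> turns it into a
  moment, whose limit is the circle mean of \<open>Re (t ^ k * B * S * cnj B)\<close>. With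
  \<open>B * S\<close> close to \<open>1\<close> this is nearly the \<open>k\<close>th Fourier
  coefficient of \<open>B\<close>.\<close>

theorem coefficient_limit: "(\<lambda>n. I (l (n + k) * p n)) \<longlonglongrightarrow> coeff B k"
proof (rule LIMSEQ_I)
  fix \<eta> :: real assume "\<eta> > 0"
  have "bounded ((\<lambda>t. poly (cpoly B) t) ` sphere 0 1)"
    by (intro compact_imp_bounded compact_continuous_image continuous_intros) auto
  then obtain M where M: "M > 0" "\<And>t. cmod t = 1 \<Longrightarrow> cmod (poly (cpoly B) t) \<le> M"
    by (auto simp: bounded_pos)
  have "bounded ((\<lambda>x. poly \<rho> x) ` {-1..1})"
    by (intro compact_imp_bounded compact_continuous_image continuous_intros) auto
  then obtain G where G: "G > 0" "\<And>x. x \<in> {-1..1} \<Longrightarrow> poly \<rho> x \<le> G"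
    unfolding bounded_pos by (auto simp: abs_le_iff)
  \<comment> \<open>Cauchy-Schwarz will cost \<open>\<tau> * sqrt (2 * G / C)\<close> and replacing
    \<open>B * S\<close> by \<open>1\<close> will cost \<open>M * \<tau>\<close>. Together they use
    half of \<open>\<eta>\<close>; the convergence of the moments uses the other half.\<close>
  define \<tau> where "\<tau> = \<eta> / (2 * (sqrt (2 * G / C) + M))"
  have den: "sqrt (2 * G / C) + M > 0" using M G C_pos by (intro add_nonneg_pos) auto
  have "\<tau> * (sqrt (2 * G / C) + M) = \<eta> / 2"
    using den unfolding \<tau>_def by (metis divide_divide_eq_left less_irrefl nonzero_eq_divide_eq mult.commute)
  moreover have "\<tau> > 0"
    unfolding \<tau>_def using den \<open>\<eta> > 0\<close> by (intro divide_pos_pos mult_pos_pos) auto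
  ultimately have \<tau>: "\<tau> * sqrt (2 * G / C) + M * \<tau> = \<eta> / 2" "\<tau> > 0"
    by (simp_all add: distrib_left mult.commute)
  obtain S where S: "coeff S 0 = 1"
    "circle_mean (\<lambda>t. (cmod (poly (cpoly (B * S)) t - 1))\<^sup>2) < \<tau>\<^sup>2"
    using B \<tau>(2) unfolding square_approximable_def by (meson zero_less_power)
  have BS0: "coeff (cpoly (B * S)) 0 = 1"
    using B S(1) by (simp add: square_approximable_def coeff_mult coeff_map_poly)
  have S_nz: "S \<noteq> 0" using S(1) by auto
  define X where "X n = shifted_combination S n" for n
  have norm_lim: "(\<lambda>n. I (\<rho> * X n * X n)) \<longlonglongrightarrow> C * circle_mean (\<lambda>t. (cmod (poly (cpoly (B * S)) t))\<^sup>2)"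
  proof -
    have "circle_mean (\<lambda>t. poly \<rho> (Re t) * Re (poly (cpoly S) t * cnj (poly (cpoly S) t))) =
      circle_mean (\<lambda>t. C * (cmod (poly (cpoly (B * S)) t))\<^sup>2)"
      by (rule circle_mean_cong)
        (simp only: complex_norm_square[symmetric] Re_complex_of_real rho_circle cpoly_mult poly_mult norm_mult power_mult_distrib mult.assoc)
    then show ?thesis using combination_limit[of \<rho> S S] by (simp only: X_def circle_mean_cmult)
  qed
  define c where "c = circle_mean (\<lambda>t. poly \<rho> (Re t) * Re (poly (cpoly (monom 1 k * S)) t * cnj (poly (cpoly 1) t)))"
  have c_lim: "(\<lambda>n. I (\<rho> * X (n + k) * p n)) \<longlonglongrightarrow> c"
    using combination_limit[of \<rho> "monom 1 k * S" 1]
    by (simp only: c_def X_def shifted_combination_monom[OF S_nz] shifted_combination_1)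
  have c: "\<bar>c / C - coeff B k\<bar> \<le> M * \<tau>"
  proof -
    let ?E = "\<lambda>t. poly (cpoly (B * S)) t - 1" and ?B = "\<lambda>t. poly (cpoly B) t"
    have "c = circle_mean (\<lambda>t. C * Re (t ^ k * poly (cpoly (B * S)) t * cnj (?B t)))"
      unfolding c_def
    proof (rule circle_mean_cong)
      fix t :: complex assume "cmod t = 1"
      have "complex_of_real ((cmod (?B t))\<^sup>2) = ?B t * cnj (?B t)" by (rule complex_norm_square)
      then have "t ^ k * poly (cpoly (B * S)) t * cnj (?B t) = of_real ((cmod (?B t))\<^sup>2) * (t ^ k * poly (cpoly S) t)"
        by (simp add: cpoly_mult algebra_simps)
      then have "Re (t ^ k * poly (cpoly (B * S)) t * cnj (?B t)) = (cmod (?B t))\<^sup>2 * Re (t ^ k * poly (cpoly S) t)"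
        by (simp only: Re_complex_of_real Im_complex_of_real times_complex.sel)
      moreover have "poly (cpoly (monom 1 k * S)) t * cnj (poly (cpoly 1) t) = t ^ k * poly (cpoly S) t"
        by (simp add: cpoly_mult map_poly_monom poly_monom)
      ultimately show "poly \<rho> (Re t) * Re (poly (cpoly (monom 1 k * S)) t * cnj (poly (cpoly 1) t)) =
          C * Re (t ^ k * poly (cpoly (B * S)) t * cnj (?B t))"
        using rho_circle[OF \<open>cmod t = 1\<close>] by (simp only: mult.assoc)
    qed
    then have "c / C = circle_mean (\<lambda>t. Re (t ^ k * poly (cpoly (B * S)) t * cnj (?B t)))"
      using C_pos by (simp only: circle_mean_cmult) simp
    moreover have "coeff B k = circle_mean (\<lambda>t. Re (poly (cpoly B) t * cnj t ^ k))"
      by (simp only: circle_mean_coeff) (simp add: coeff_map_poly)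
    moreover have "circle_mean (\<lambda>t. Re (poly (cpoly B) t * cnj t ^ k)) = circle_mean (\<lambda>t. Re (t ^ k * cnj (?B t)))"
      by (rule circle_mean_cong) (metis complex_cnj_cnj complex_cnj_mult complex_cnj_power complex_cnj(1) mult.commute cnj.sel(1))
    moreover have "\<bar>circle_mean (\<lambda>t. Re (t ^ k * poly (cpoly (B * S)) t * cnj (?B t))) - circle_mean (\<lambda>t. Re (t ^ k * cnj (?B t)))\<bar>
        \<le> circle_mean (\<lambda>t. M / (2 * \<tau>) * (cmod (?E t))\<^sup>2 + M * \<tau> / 2)"
    proof (rule circle_mean_abs_diff_le)
      fix t :: complex assume t: "cmod t = 1"
      have "\<bar>Re (t ^ k * poly (cpoly (B * S)) t * cnj (?B t)) - Re (t ^ k * cnj (?B t))\<bar> = \<bar>Re (t ^ k * ?E t * cnj (?B t))\<bar>"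
        by (simp only: minus_complex.sel(1)[symmetric]) (simp only: right_diff_distrib left_diff_distrib mult_1_right)
      also have "\<dots> \<le> cmod (t ^ k * ?E t * cnj (?B t))" by (rule abs_Re_le_cmod)
      also have "\<dots> \<le> cmod (?E t) * M" using M(2)[OF t] t by (simp add: norm_mult norm_power mult_left_mono)
      \<comment> \<open>The weighted arithmetic-geometric inequality stands in for Cauchy-Schwarz on
        the circle: as the mean square is below \<open>\<tau>\<^sup>2\<close>, each summand
        contributes at most \<open>M * \<tau> / 2\<close>.\<close>
      also have "\<dots> \<le> M / (2 * \<tau>) * (cmod (?E t))\<^sup>2 + M * \<tau> / 2"
      proof -
        have "2 * (cmod (?E t) * \<tau>) \<le> (cmod (?E t))\<^sup>2 + \<tau>\<^sup>2"
          using sum_squares_bound[of "cmod (?E t)" \<tau>] by simp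
        then have "M / (2 * \<tau>) * (2 * (cmod (?E t) * \<tau>)) \<le> M / (2 * \<tau>) * ((cmod (?E t))\<^sup>2 + \<tau>\<^sup>2)"
          using M \<tau> by (intro mult_left_mono) auto
        then show ?thesis using \<tau> by (simp add: field_simps power2_eq_square)
      qed
      finally show "\<bar>Re (t ^ k * poly (cpoly (B * S)) t * cnj (?B t)) - Re (t ^ k * cnj (?B t))\<bar> \<le> \<dots>" .
    qed (intro continuous_intros)+
    moreover have "circle_mean (\<lambda>t. M / (2 * \<tau>) * (cmod (?E t))\<^sup>2 + M * \<tau> / 2) \<le> M * \<tau>"
    proof -
      have "circle_mean (\<lambda>t. M / (2 * \<tau>) * (cmod (?E t))\<^sup>2 + M * \<tau> / 2) = M / (2 * \<tau>) * circle_mean (\<lambda>t. (cmod (?E t))\<^sup>2) + M * \<tau> / 2"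
        by (subst circle_mean_add) (intro continuous_intros, simp_all only: circle_mean_cmult circle_mean_const continuous_intros)
      also have "\<dots> \<le> M / (2 * \<tau>) * \<tau>\<^sup>2 + M * \<tau> / 2"
        using M \<tau> S(2) by (intro add_right_mono mult_left_mono) auto
      also have "\<dots> = M * \<tau>" using \<tau> by (simp add: power2_eq_square field_simps)
      finally show ?thesis .
    qed
    ultimately show ?thesis by linarith
  qed
  have "circle_mean (\<lambda>t. (cmod (poly (cpoly (B * S)) t))\<^sup>2) < 1 + \<tau>\<^sup>2"
    using S(2) by (simp add: mean_square_minus_one[OF BS0])
  then have "\<forall>\<^sub>F n in sequentially. I (\<rho> * X n * X n) < C * (1 + \<tau>\<^sup>2)"
    using C_pos by (intro order_tendstoD(2)[OF norm_lim]) simp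
  moreover have "\<forall>\<^sub>F n in sequentially. J (l n * l n) < (1 + \<tau>\<^sup>2) / C"
    using \<tau>(2) by (intro l_norm_upper) simp
  ultimately have "\<forall>\<^sub>F n in sequentially. I (\<rho> * X n * X n) < C * (1 + \<tau>\<^sup>2) \<and> J (l n * l n) < (1 + \<tau>\<^sup>2) / C \<and> n > m"
    using eventually_gt_at_top[of m] by eventually_elim auto
  then have "\<forall>\<^sub>F n in sequentially. I (\<rho> * X (n + k) * X (n + k)) < C * (1 + \<tau>\<^sup>2)
      \<and> J (l (n + k) * l (n + k)) < (1 + \<tau>\<^sup>2) / C \<and> n + k > m"
    by (subst eventually_sequentially_seg)
  moreover have "\<forall>\<^sub>F n in sequentially. \<bar>I (\<rho> * X (n + k) * p n) - c\<bar> < C * (\<eta> / 2)"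
  proof -
    have "C * (\<eta> / 2) > 0" using C_pos \<open>\<eta> > 0\<close> by simp
    from tendstoD[OF c_lim this] show ?thesis by (simp add: dist_real_def)
  qed
  ultimately have "\<forall>\<^sub>F n in sequentially. \<bar>I (l (n + k) * p n) - coeff B k\<bar> < \<eta>"
  proof eventually_elim
    case (elim n)
    define L where "L = l (n + k)"
    define g where "g = \<rho> * X (n + k)"
    define q where "q = L - smult (1 / C) g"
    have Lg: "J (L * g) = 1"
      using inner_l_shifted[of "n + k" S] elim S(1) J_mult[of "L * X (n + k)"]
      by (simp add: L_def g_def X_def algebra_simps)
    have gg: "J (g * g) < C * (1 + \<tau>\<^sup>2)"
      using elim J_mult[of "\<rho> * X (n + k) * X (n + k)"] by (simp add: g_def algebra_simps)
    have "q * q = L * L - smult (2 / C) (L * g) + smult (1 / C\<^sup>2) (g * g)"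
      by (rule real_poly_eqI) (use C_pos in \<open>simp add: q_def field_simps power2_eq_square\<close>)
    \<comment> \<open>The inner product of \<open>L\<close> and \<open>g\<close> is exactly
      \<open>1\<close>, so the main parts \<open>1 / C - 2 / C + 1 / C\<close> cancel and only terms
      of order \<open>\<tau>\<^sup>2\<close> survive.\<close>
    then have "J (q * q) = J (L * L) - 2 / C + J (g * g) / C\<^sup>2"
      by (simp add: J.add J.diff J.smult Lg)
    also have "\<dots> \<le> (1 + \<tau>\<^sup>2) / C - 2 / C + C * (1 + \<tau>\<^sup>2) / C\<^sup>2"
      using elim gg C_pos by (intro add_mono diff_mono divide_right_mono) (auto simp: L_def)
    also have "\<dots> = 2 * \<tau>\<^sup>2 / C" using C_pos by (simp add: field_simps power2_eq_square)
    finally have qq: "J (q * q) \<le> 2 * \<tau>\<^sup>2 / C" .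
    have pp: "J ((\<rho> * p n) * (\<rho> * p n)) \<le> G"
    proof -
      have "J ((\<rho> * p n) * (\<rho> * p n)) = I (\<rho> * (p n * p n))"
        using J_mult[of "\<rho> * (p n * p n)"] by (simp add: algebra_simps)
      also have "\<dots> \<le> I (smult G (p n * p n))"
        by (rule mono) (use G in \<open>auto intro: mult_right_mono\<close>)
      finally show ?thesis by (simp add: smult orthonormal)
    qed
    have "(J (q * (\<rho> * p n)))\<^sup>2 \<le> J (q * q) * J ((\<rho> * p n) * (\<rho> * p n))" by (rule J.cauchy_schwarz)
    also have "\<dots> \<le> (2 * \<tau>\<^sup>2 / C) * G"
      using qq pp C_pos by (intro mult_mono J.nonneg) auto
    also have "\<dots> = (\<tau> * sqrt (2 * G / C))\<^sup>2" using C_pos G by (simp add: power_mult_distrib)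
    finally have "\<bar>J (q * (\<rho> * p n))\<bar> \<le> \<tau> * sqrt (2 * G / C)"
      by (subst (asm) power2_le_iff_abs_le) (use \<tau> G C_pos in auto)
    moreover have "J (q * (\<rho> * p n)) = I (L * p n) - I (\<rho> * X (n + k) * p n) / C"
    proof -
      have eq: "q * (\<rho> * p n) = \<rho> * (L * p n - smult (1 / C) (\<rho> * X (n + k) * p n))"
        by (rule real_poly_eqI) (simp add: q_def g_def algebra_simps)
      show ?thesis by (simp only: eq J_mult diff smult) simp
    qed
    moreover have "\<bar>I (\<rho> * X (n + k) * p n) / C - c / C\<bar> < \<eta> / 2"
      using elim C_pos by (simp add: diff_divide_distrib[symmetric] abs_divide divide_less_eq mult.commute)
    ultimately show ?case using c \<tau>(1) unfolding L_def by linarith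
  qed
  then show "\<exists>no. \<forall>n\<ge>no. norm (I (l (n + k) * p n) - coeff B k) < \<eta>"
    by (simp add: eventually_sequentially)
qed

end

section \<open>The inverse Joukowski map and the zeros of the divisor\<close>

lemma joukowski_eq: "joukowski z + 1 / joukowski z = 2 * z"
  and norm_joukowski_ge_1: "cmod (joukowski z) \<ge> 1"
proof -
  define s where "s = csqrt (z\<^sup>2 - 1)"
  have prod: "(z + s) * (z - s) = 1"
    by (simp add: s_def algebra_simps power2_eq_square flip: power2_csqrt)
       (metis add_diff_cancel_left' diff_add_cancel power2_csqrt power2_eq_square)
  then have nz: "z + s \<noteq> 0" "z - s \<noteq> 0" by auto
  then have inv: "1 / (z + s) = z - s" "1 / (z - s) = z + s" using prod by (auto simp: field_simps)
  have "cmod (z + s) * cmod (z - s) = 1" using prod by (metis norm_mult norm_one)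
  then have "cmod (z - s) \<ge> 1" if "\<not> cmod (z + s) \<ge> 1"
    using that by (smt (verit) mult_left_le_one_le mult_right_le_one_le norm_ge_zero)
  then show "cmod (joukowski z) \<ge> 1" by (auto simp: joukowski_def s_def)
  show "joukowski z + 1 / joukowski z = 2 * z"
    using inv by (auto simp: joukowski_def s_def[symmetric])
qed

lemma joukowski_nonzero: "joukowski z \<noteq> 0"
  using norm_joukowski_ge_1[of z] by auto

text \<open>The difference of the equations \<open>w + 1 / w = 2 * z\<close> at two points. It
  yields injectivity, continuity off the interval and the value of
  \<open>Phi_factor\<close>.\<close>

lemma joukowski_difference:
  "2 * (z - z') = (joukowski z - joukowski z') * (1 - 1 / (joukowski z * joukowski z'))"
  using joukowski_eq[of z, symmetric] joukowski_eq[of z', symmetric] joukowski_nonzero[of z] joukowski_nonzero[of z']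
  by (simp add: right_diff_distrib) (simp add: field_simps)

lemma joukowski_unique:
  assumes "w + 1 / w = 2 * z" "cmod w > 1"
  shows "joukowski z = w"
proof -
  have w: "w \<noteq> 0" using assms(2) by auto
  have "(w - joukowski z) * (1 - 1 / (w * joukowski z)) = (w + 1 / w) - (joukowski z + 1 / joukowski z)"
    using w joukowski_nonzero[of z] by (simp add: field_simps)
  then have "(w - joukowski z) * (1 - 1 / (w * joukowski z)) = 0" using assms(1) joukowski_eq[of z] by simp
  moreover have "cmod (w * joukowski z) > 1"
    using assms(2) norm_joukowski_ge_1[of z] by (metis less_1_mult' norm_mult order_le_less_trans less_1_mult linorder_not_le mult_1_right norm_ge_zero order_less_le mult_less_cancel_left1)
  then have "w * joukowski z \<noteq> 1" by auto
  ultimately show ?thesis by auto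
qed

text \<open>The level curves of the modulus are the ellipses with foci \<open>-1\<close> and
  \<open>1\<close>. The right-hand side involves no branch, so the modulus is continuous also across
  \<open>(-1, 1)\<close>, where \<open>joukowski\<close> itself jumps.\<close>

lemma norm_joukowski_sum:
  "cmod (joukowski z) + 1 / cmod (joukowski z) = cmod (z - 1) + cmod (z + 1)"
proof -
  let ?w = "joukowski z"
  have w: "?w \<noteq> 0" by (rule joukowski_nonzero)
  have "2 * z = ?w + 1 / ?w" by (rule joukowski_eq[symmetric])
  then have "2 * (z + 1) * ?w = (?w + 1)\<^sup>2" "2 * (z - 1) * ?w = (?w - 1)\<^sup>2"
    using w by (simp_all add: distrib_left left_diff_distrib distrib_right right_diff_distrib power2_eq_square)
  then have "2 * cmod (z + 1) * cmod ?w = (cmod (?w + 1))\<^sup>2" "2 * cmod (z - 1) * cmod ?w = (cmod (?w - 1))\<^sup>2"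
    by (metis norm_mult norm_numeral norm_power)+
  moreover have "(cmod (?w + 1))\<^sup>2 + (cmod (?w - 1))\<^sup>2 = 2 * (cmod ?w)\<^sup>2 + 2"
    by (simp add: cmod_power2, simp add: power2_eq_square algebra_simps)
  ultimately have "2 * cmod ?w * (cmod (z - 1) + cmod (z + 1)) = 2 * ((cmod ?w)\<^sup>2 + 1)"
    by (simp add: algebra_simps)
  then show ?thesis using w by (simp add: field_simps power2_eq_square)
qed

lemma norm_joukowski_gt_1_iff: "cmod (joukowski z) > 1 \<longleftrightarrow> z \<notin> complex_of_real ` {-1..1}"
proof -
  have "cmod (joukowski z) = 1 \<longleftrightarrow> z \<in> complex_of_real ` {-1..1}"
  proof
    assume 1: "cmod (joukowski z) = 1"
    then have "joukowski z * cnj (joukowski z) = 1" by (simp add: complex_norm_square[symmetric])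
    then have "1 / joukowski z = cnj (joukowski z)"
      using joukowski_nonzero[of z] by (simp add: field_simps)
    then have "2 * z = joukowski z + cnj (joukowski z)" using joukowski_eq[of z] by simp
    then have "z = complex_of_real (Re (joukowski z))" by (simp add: complex_add_cnj)
    moreover have "Re (joukowski z) \<in> {-1..1}" using abs_Re_le_cmod[of "joukowski z"] 1 by auto
    ultimately show "z \<in> complex_of_real ` {-1..1}" by blast
  next
    assume "z \<in> complex_of_real ` {-1..1}"
    then obtain x where x: "z = of_real x" "-1 \<le> x" "x \<le> 1" by auto
    have "z - 1 = complex_of_real (x - 1)" "z + 1 = complex_of_real (x + 1)" using x(1) by simp_all
    then have "cmod (z - 1) + cmod (z + 1) = \<bar>x - 1\<bar> + \<bar>x + 1\<bar>" by (simp only: norm_of_real)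
    then have "cmod (joukowski z) + 1 / cmod (joukowski z) = 2" using norm_joukowski_sum[of z] x by simp
    then have "(cmod (joukowski z) - 1)\<^sup>2 = 0"
      using joukowski_nonzero[of z] by (simp add: field_simps power2_eq_square)
    then show "cmod (joukowski z) = 1" by simp
  qed
  then show ?thesis using norm_joukowski_ge_1[of z] by auto
qed

lemma continuous_norm_joukowski: "continuous_on UNIV (\<lambda>z. cmod (joukowski z))"
proof -
  have "cmod (joukowski z) = ((cmod (z - 1) + cmod (z + 1)) + sqrt ((cmod (z - 1) + cmod (z + 1))\<^sup>2 - 4)) / 2" for z
  proof -
    let ?r = "cmod (joukowski z)"
    have r: "?r \<ge> 1" by (rule norm_joukowski_ge_1)
    then have "1 / ?r \<le> 1" using divide_le_eq_1_pos[of ?r 1] by linarith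
    have "(?r + 1 / ?r)\<^sup>2 - 4 = (?r - 1 / ?r)\<^sup>2" using joukowski_nonzero[of z] by (simp add: power2_eq_square field_simps)
    moreover have "?r - 1 / ?r \<ge> 0" using r \<open>1 / ?r \<le> 1\<close> by linarith
    ultimately have "sqrt ((?r + 1 / ?r)\<^sup>2 - 4) = ?r - 1 / ?r" by simp
    then show ?thesis unfolding norm_joukowski_sum[symmetric] by simp
  qed
  then show ?thesis by (simp only:) (intro continuous_intros, simp)
qed

lemma isCont_joukowski:
  assumes "\<zeta> \<notin> complex_of_real ` {-1..1}"
  shows "isCont joukowski \<zeta>"
proof -
  have gt: "cmod (joukowski \<zeta>) > 1" using assms norm_joukowski_gt_1_iff by blast
  \<comment> \<open>A lower bound for the second factor in \<open>joukowski_difference\<close> that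
    is uniform in \<open>z\<close>, so the estimate at \<open>\<zeta>\<close> is of Lipschitz
    type.\<close>
  define k where "k = 1 - 1 / cmod (joukowski \<zeta>)"
  have "1 / cmod (joukowski \<zeta>) < 1" using gt by (subst divide_less_eq_1_pos) auto
  then have k: "k > 0" by (simp add: k_def)
  have "cmod (joukowski z - joukowski \<zeta>) \<le> 2 / k * cmod (z - \<zeta>)" for z
  proof -
    have "cmod (1 / (joukowski z * joukowski \<zeta>)) \<le> 1 / cmod (joukowski \<zeta>)"
    proof -
      have "cmod (joukowski \<zeta>) \<le> cmod (joukowski z * joukowski \<zeta>)"
        using mult_right_mono[OF norm_joukowski_ge_1[of z], of "cmod (joukowski \<zeta>)"] by (simp add: norm_mult)
      then show ?thesis using gt unfolding norm_divide norm_one by (intro frac_le) auto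
    qed
    then have "k \<le> cmod (1 - 1 / (joukowski z * joukowski \<zeta>))"
      using norm_triangle_ineq2[of 1 "1 / (joukowski z * joukowski \<zeta>)"] by (simp add: k_def)
    then have "k * cmod (joukowski z - joukowski \<zeta>) \<le> cmod (2 * (z - \<zeta>))"
      unfolding joukowski_difference norm_mult by (metis mult.commute mult_left_mono norm_ge_zero)
    then have "k * cmod (joukowski z - joukowski \<zeta>) \<le> 2 * cmod (z - \<zeta>)"
      by (simp only: norm_mult norm_numeral)
    then show ?thesis using k by (simp add: field_simps)
  qed
  then have "((\<lambda>z. joukowski z - joukowski \<zeta>) \<longlongrightarrow> 0) (at \<zeta>)"
    by (rule Lim_null_comparison[OF always_eventually[OF allI]])
      (intro tendsto_mult_right_zero tendsto_norm_zero LIM_zero tendsto_ident_at)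
  then show ?thesis unfolding isCont_def by (rule LIM_zero_cancel)
qed

text \<open>\<open>joukowski_difference\<close> removes the quotient, so the formula persists in the
  limit at \<open>z = \<nu>\<close>. The product over all zeros then becomes \<open>B\<close>
  evaluated at \<open>1 / joukowski z\<close>.\<close>

lemma Phi_factor_eq:
  assumes "z \<notin> complex_of_real ` {-1..1}"
  shows "2 * Phi_factor \<nu> z = 1 - 1 / (joukowski \<nu> * joukowski z)"
proof -
  have quot: "(w - \<nu>) / (joukowski w - joukowski \<nu>) = (1 - 1 / (joukowski \<nu> * joukowski w)) / 2" if "w \<noteq> \<nu>" for w
  proof -
    have "joukowski w - joukowski \<nu> \<noteq> 0" using joukowski_difference[of w \<nu>] that by auto
    then show ?thesis using joukowski_difference[of w \<nu>] by (simp add: field_simps)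
  qed
  show ?thesis
  proof (cases "z = \<nu>")
    case True
    have "(joukowski \<longlongrightarrow> joukowski \<nu>) (at \<nu>)" using isCont_joukowski[OF assms] True by (simp add: isCont_def)
    then have "((\<lambda>w. (1 - 1 / (joukowski \<nu> * joukowski w)) / 2) \<longlongrightarrow> (1 - 1 / (joukowski \<nu> * joukowski \<nu>)) / 2) (at \<nu>)"
      by (intro tendsto_intros) (simp_all add: joukowski_nonzero)
    then have "((\<lambda>w. (w - \<nu>) / (joukowski w - joukowski \<nu>)) \<longlongrightarrow> (1 - 1 / (joukowski \<nu> * joukowski \<nu>)) / 2) (at \<nu>)"
    proof (rule tendsto_cong[THEN iffD2, rotated])
      have "\<forall>\<^sub>F w in nhds \<nu>. w \<noteq> \<nu> \<longrightarrow> w \<in> UNIV \<longrightarrow>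
          (w - \<nu>) / (joukowski w - joukowski \<nu>) = (1 - 1 / (joukowski \<nu> * joukowski w)) / 2"
        by (intro always_eventually allI impI quot)
      then show "\<forall>\<^sub>F w in at \<nu>. (w - \<nu>) / (joukowski w - joukowski \<nu>) = (1 - 1 / (joukowski \<nu> * joukowski w)) / 2"
        by (simp only: eventually_at_filter)
    qed
    then have Lim: "Lim (at \<nu>) (\<lambda>w. (w - \<nu>) / (joukowski w - joukowski \<nu>)) = (1 - 1 / (joukowski \<nu> * joukowski \<nu>)) / 2"
      by (intro tendsto_Lim) auto
    show ?thesis unfolding Phi_factor_def if_P[OF True] Lim using True by simp
  next
    case False
    then show ?thesis by (simp add: Phi_factor_def quot)
  qed
qed

text \<open>On \<open>(-1, 1)\<close> the chosen branch value is not real although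
  \<open>cnj z = z\<close>, hence the exclusion. At the end points the value is real.\<close>

lemma joukowski_cnj:
  assumes "z \<notin> complex_of_real ` {-1<..<1}"
  shows "joukowski (cnj z) = cnj (joukowski z)"
proof (cases "z \<in> complex_of_real ` {-1..1}")
  case True
  then have "z = 1 \<or> z = -1" using assms by (force simp: image_iff)
  then show ?thesis by (auto simp: joukowski_def)
next
  case False
  show ?thesis
  proof (rule joukowski_unique)
    show "cnj (joukowski z) + 1 / cnj (joukowski z) = 2 * cnj z"
      using arg_cong[OF joukowski_eq[of z], of cnj] by simp
    show "1 < cmod (cnj (joukowski z))" using False norm_joukowski_gt_1_iff by simp
  qed
qed

section \<open>Factorisation of the divisor on the unit circle\<close>

lemma proots_prod_linear: "proots (\<Prod>\<nu>\<in>#A. [:- \<nu>, 1:]) = (A :: complex multiset)"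
proof (induction A)
  case (add x A)
  have "(\<Prod>\<nu>\<in>#A. [:- \<nu>, 1:]) \<noteq> 0" by (auto simp: prod_mset_zero_iff)
  then show ?case
    using add by (simp add: proots_mult del: mult_pCons_left)
qed simp

lemma proots_cpoly_cnj: "image_mset cnj (proots (cpoly \<rho>)) = proots (cpoly \<rho>)"
proof (cases "\<rho> = 0")
  case False
  let ?A = "proots (cpoly \<rho>)"
  have nz: "complex_of_real (lead_coeff \<rho>) \<noteq> 0" using False by simp
  have lead: "lead_coeff (cpoly \<rho>) = complex_of_real (lead_coeff \<rho>)"
    by (simp add: coeff_map_poly degree_map_poly)
  have dec: "cpoly \<rho> = smult (complex_of_real (lead_coeff \<rho>)) (\<Prod>\<nu>\<in>#?A. [:- \<nu>, 1:])"
    using complex_poly_decompose_multiset[of "cpoly \<rho>"] by (simp add: lead)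
  have "map_poly cnj (\<Prod>\<nu>\<in>#A. [:- \<nu>, 1:]) = (\<Prod>\<nu>\<in>#image_mset cnj A. [:- \<nu>, 1:])" for A
    by (induction A) (simp_all add: map_poly_cnj_mult map_poly_pCons del: mult_pCons_left)
  moreover have "map_poly cnj (smult (complex_of_real c) P) = smult (complex_of_real c) (map_poly cnj P)" for c P
    by (simp add: poly_eq_iff coeff_map_poly)
  moreover have "map_poly cnj (cpoly \<rho>) = cpoly \<rho>" by (simp add: poly_eq_iff coeff_map_poly)
  ultimately have "cpoly \<rho> = smult (complex_of_real (lead_coeff \<rho>)) (\<Prod>\<nu>\<in>#image_mset cnj ?A. [:- \<nu>, 1:])"
    by (subst dec) (metis dec)
  then show ?thesis using proots_prod_linear[of "image_mset cnj ?A"] proots_smult[OF nz] by metis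
qed simp

text \<open>On the circle \<open>2 * Re t = t + 1 / t\<close>, and \<open>2 * \<nu>\<close> has the
  same form in \<open>\<phi> \<nu>\<close>, so each linear factor splits into one factor in
  \<open>t\<close> and one in \<open>cnj t\<close>. For \<open>\<rho>\<close> this is the
  Fejer-Riesz factorisation.\<close>

lemma prod_root_factor_circle:
  assumes "cmod t = 1" "\<And>\<nu>. \<nu> \<in># A \<Longrightarrow> \<phi> \<nu> \<noteq> 0" "\<And>\<nu>. \<nu> \<in># A \<Longrightarrow> \<phi> \<nu> + 1 / \<phi> \<nu> = 2 * \<nu>"
  shows "(\<Prod>\<nu>\<in>#A. of_real (Re t) - \<nu>) =
    (\<Prod>\<nu>\<in>#A. - \<phi> \<nu> / 2) * (poly (\<Prod>u\<in>#image_mset \<phi> A. root_factor u) t * poly (\<Prod>u\<in>#image_mset \<phi> A. root_factor u) (cnj t))"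
  using assms(2,3)
proof (induction A)
  case (add v A)
  have "t * cnj t = 1" using assms(1) by (simp add: complex_norm_square[symmetric])
  moreover have "complex_of_real (2 * Re t) = t + cnj t" by (rule complex_add_cnj[symmetric])
  moreover have "\<phi> v \<noteq> 0" "\<phi> v + 1 / \<phi> v = 2 * v" using add.prems by auto
  ultimately have "2 * (of_real (Re t) - v) = t + cnj t - (\<phi> v + t * cnj t / \<phi> v)" by simp
  also have "\<dots> = - \<phi> v * ((1 - t / \<phi> v) * (1 - cnj t / \<phi> v))"
    using \<open>\<phi> v \<noteq> 0\<close> by (simp add: algebra_simps \<open>t * cnj t = 1\<close>)
  finally have "of_real (Re t) - v = - \<phi> v / 2 * ((1 - t / \<phi> v) * (1 - cnj t / \<phi> v))"
    by (metis (no_types, lifting) mult.assoc mult_minus_left nonzero_mult_div_cancel_left times_divide_eq_left zero_neq_numeral)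
  then have "of_real (Re t) - v = - \<phi> v / 2 * (poly (root_factor (\<phi> v)) t * poly (root_factor (\<phi> v)) (cnj t))"
    by (simp add: root_factor_def)
  then show ?case using add by (simp add: mult_ac del: of_real_diff)
qed simp

lemma divisor_data:
  assumes nz: "\<rho> \<noteq> 0" and nonneg: "\<And>x. x \<in> {-1..1} \<Longrightarrow> 0 \<le> poly \<rho> x"
    and pos: "\<And>x. x \<in> {-1<..<1} \<Longrightarrow> poly \<rho> x \<noteq> 0"
  obtains B C where "C > 0" "square_approximable B"
    "\<forall>t. cmod t = 1 \<longrightarrow> poly \<rho> (Re t) = C * (cmod (poly (cpoly B) t))\<^sup>2"
    "\<forall>z. z \<notin> complex_of_real ` {-1..1} \<longrightarrow> 2 ^ degree \<rho> * Phi \<rho> z = poly (cpoly B) (1 / joukowski z)"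
proof -
  define R where "R = proots (cpoly \<rho>)"
  define A where "A = image_mset joukowski R"
  have cnz: "cpoly \<rho> \<noteq> 0" using nz by (simp add: poly_eq_iff coeff_map_poly)
  have R: "\<nu> \<notin> complex_of_real ` {-1<..<1}" if "\<nu> \<in># R" for \<nu>
    using that pos cnz by (auto simp: R_def poly_cpoly_of_real)
  have "image_mset cnj A = image_mset joukowski (image_mset cnj R)"
    unfolding A_def multiset.map_comp by (intro image_mset_cong) (simp add: joukowski_cnj R)
  then have inv: "image_mset cnj A = A" by (simp only: R_def proots_cpoly_cnj A_def)
  have ge: "cmod u \<ge> 1" if "u \<in># A" for u using that norm_joukowski_ge_1 by (auto simp: A_def)
  obtain B where B: "cpoly B = (\<Prod>u\<in>#A. root_factor u)" "coeff B 0 = 1"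
    "\<And>\<epsilon>. \<epsilon> > 0 \<Longrightarrow> \<exists>S. coeff S 0 = 1 \<and> circle_mean (\<lambda>t. (cmod (poly (cpoly (B * S)) t - 1))\<^sup>2) < \<epsilon>"
    using outer_polynomial[OF ge inv] by blast
  define c where "c = complex_of_real (lead_coeff \<rho>) * (\<Prod>\<nu>\<in>#R. - joukowski \<nu> / 2)"
  have lead: "lead_coeff (cpoly \<rho>) = complex_of_real (lead_coeff \<rho>)"
    by (simp add: coeff_map_poly degree_map_poly)
  have circ: "complex_of_real (poly \<rho> (Re t)) = c * of_real ((cmod (poly (cpoly B) t))\<^sup>2)" if "cmod t = 1" for t
  proof -
    have "complex_of_real (poly \<rho> (Re t)) = poly (cpoly \<rho>) (of_real (Re t))" by (simp add: poly_cpoly_of_real)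
    also have "cpoly \<rho> = smult (complex_of_real (lead_coeff \<rho>)) (\<Prod>\<nu>\<in>#R. [:- \<nu>, 1:])"
      using complex_poly_decompose_multiset[of "cpoly \<rho>"] by (simp add: lead R_def)
    also have "poly (smult (complex_of_real (lead_coeff \<rho>)) (\<Prod>\<nu>\<in>#R. [:- \<nu>, 1:])) (of_real (Re t)) =
        of_real (lead_coeff \<rho>) * (\<Prod>\<nu>\<in>#R. of_real (Re t) - \<nu>)"
      by (simp add: poly_prod_mset image_mset.compositionality o_def)
    also have "(\<Prod>\<nu>\<in>#R. of_real (Re t) - \<nu>) = (\<Prod>\<nu>\<in>#R. - joukowski \<nu> / 2) * (poly (cpoly B) t * poly (cpoly B) (cnj t))"
      unfolding B(1) A_def by (rule prod_root_factor_circle[OF that joukowski_nonzero joukowski_eq])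
    finally show ?thesis unfolding c_def poly_cpoly_cnj complex_norm_square by (simp only: mult.assoc)
  qed
  \<comment> \<open>\<open>c\<close> is a product of complex numbers. Evaluation at one interior
    point, where \<open>\<rho>\<close> is positive, shows that it is real and positive.\<close>
  define x :: real where "x = 0"
  have x: "x \<in> {-1<..<1}" "poly \<rho> x \<noteq> 0" using pos[of 0] by (simp_all add: x_def)
  define t where "t = Complex x (sqrt (1 - x\<^sup>2))"
  have "x\<^sup>2 \<le> 1" by (simp add: x_def)
  then have t: "cmod t = 1" "Re t = x" by (simp_all add: t_def cmod_def)
  define b where "b = (cmod (poly (cpoly B) t))\<^sup>2"
  have cb: "complex_of_real (poly \<rho> x) = c * of_real b" using circ[OF t(1)] by (simp add: t b_def)
  then have b: "b \<noteq> 0" using x by auto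
  have c: "c = complex_of_real (poly \<rho> x / b)" using cb b by (simp add: field_simps)
  have "poly \<rho> x > 0" using nonneg[of x] x by auto
  moreover have "b > 0" using b by (simp add: b_def)
  ultimately have C: "poly \<rho> x / b > 0" by simp
  show thesis
  proof (rule that[OF C])
    show "square_approximable B" using B by (simp add: square_approximable_def)
    show "\<forall>s. cmod s = 1 \<longrightarrow> poly \<rho> (Re s) = poly \<rho> x / b * (cmod (poly (cpoly B) s))\<^sup>2"
      using circ unfolding c of_real_mult[symmetric] of_real_eq_iff by blast
    show "\<forall>z. z \<notin> complex_of_real ` {-1..1} \<longrightarrow> 2 ^ degree \<rho> * Phi \<rho> z = poly (cpoly B) (1 / joukowski z)"
    proof (intro allI impI)
      fix z :: complex assume z: "z \<notin> complex_of_real ` {-1..1}"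
      have "2 ^ size R * (\<Prod>\<nu>\<in>#R. Phi_factor \<nu> z) = (\<Prod>\<nu>\<in>#R. 2 * Phi_factor \<nu> z)"
        by (induction R) simp_all
      moreover have "size R = degree \<rho>" by (simp add: R_def size_proots_complex degree_map_poly)
      moreover have "(\<Prod>\<nu>\<in>#R. 2 * Phi_factor \<nu> z) = poly (cpoly B) (1 / joukowski z)"
        unfolding B(1) A_def Phi_factor_eq[OF z]
        by (simp add: poly_prod_mset image_mset.compositionality o_def root_factor_def mult.commute)
      ultimately show "2 ^ degree \<rho> * Phi \<rho> z = poly (cpoly B) (1 / joukowski z)"
        by (simp add: Phi_def R_def)
    qed
  qed
qed

lemma real_poly_approximation:
  assumes "continuous_on {-1..1} f" "\<epsilon> > 0"
  obtains h :: "real poly" where "\<And>x. x \<in> {-1..1} \<Longrightarrow> \<bar>f x - poly h x\<bar> < \<epsilon>"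
proof -
  obtain g where g: "real_polynomial_function g" "\<And>x. x \<in> {-1..1} \<Longrightarrow> \<bar>f x - g x\<bar> < \<epsilon>"
    using Stone_Weierstrass_real_polynomial_function[OF compact_Icc assms] by blast
  obtain a n where "g = (\<lambda>x. \<Sum>i\<le>n. a i * x ^ i)" using g(1) real_polynomial_function_iff_sum by blast
  then have "g x = poly (\<Sum>i\<le>n. monom (a i) i) x" for x by (simp add: poly_sum poly_monom)
  then show thesis using that g(2) by metis
qed

lemma zeros_data:
  assumes nz: "\<rho> \<noteq> 0" and nonneg: "\<And>x. x \<in> {-1..1} \<Longrightarrow> 0 \<le> poly \<rho> x"
    and pos: "\<And>x. x \<in> {-1<..<1} \<Longrightarrow> poly \<rho> x \<noteq> 0"
  obtains \<rho>1 D where "lead_coeff \<rho>1 = 1" "square_approximable D"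
    "\<forall>t. cmod t = 1 \<longrightarrow> 4 ^ degree \<rho>1 * (poly \<rho>1 (Re t))\<^sup>2 = (cmod (poly (cpoly D) t))\<^sup>2"
    "\<forall>\<epsilon>>0. \<exists>h. \<forall>x\<in>{-1..1}. (poly \<rho>1 x)\<^sup>2 \<le> poly h x * poly \<rho> x \<and>
      poly h x * poly \<rho> x \<le> (poly \<rho>1 x)\<^sup>2 + \<epsilon> * poly \<rho> x"
proof -
  obtain q where q: "\<rho> = [:-1, 1:] ^ order 1 \<rho> * q" "\<not> [:-1, 1:] dvd q" using order_decomp[OF nz, of 1] by auto
  have q_nz: "q \<noteq> 0" using q(2) by auto
  obtain r where r: "q = [:1, 1:] ^ order (-1) q * r" "\<not> [:1, 1:] dvd r" using order_decomp[OF q_nz, of "-1"] by auto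
  define a b where "a = order 1 \<rho>" and "b = order (-1) q"
  \<comment> \<open>\<open>\<rho>1\<close> takes over the end-point zeros with their multiplicities,
    which leaves a cofactor \<open>r\<close> without zeros on \<open>[-1, 1]\<close>.\<close>
  define \<rho>1 :: "real poly" where "\<rho>1 = [:-1, 1:] ^ a * [:1, 1:] ^ b"
  have rho: "\<rho> = \<rho>1 * r" using q(1) r(1) by (simp add: \<rho>1_def a_def b_def mult.assoc)
  have r0: "poly r x \<noteq> 0" if "x \<in> {-1..1}" for x
  proof -
    have "poly r (-1) \<noteq> 0" using r(2) by (simp add: poly_eq_0_iff_dvd)
    moreover have "poly r 1 \<noteq> 0" using q(2) r(1) by (metis dvd_mult poly_eq_0_iff_dvd)
    moreover have "poly r x \<noteq> 0" if "-1 < x" "x < 1" using pos[of x] that rho by auto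
    ultimately show ?thesis using that by (cases "x = -1 \<or> x = 1") auto
  qed
  \<comment> \<open>On the circle \<open>|1 - t|^2 = 2 (1 - Re t)\<close> and
    \<open>|1 + t|^2 = 2 (1 + Re t)\<close>, so the square of \<open>\<rho>1\<close> calls for the
    exponents \<open>2 * a\<close> and \<open>2 * b\<close> in \<open>D\<close>.\<close>
  define A where "A = replicate_mset (2 * a) (1::complex) + replicate_mset (2 * b) (- 1)"
  have A: "\<And>u. u \<in># A \<Longrightarrow> cmod u \<ge> 1" "image_mset cnj A = A" by (auto simp: A_def split: if_splits)
  obtain D where D: "cpoly D = (\<Prod>u\<in>#A. root_factor u)" "coeff D 0 = 1"
    "\<And>\<epsilon>. \<epsilon> > 0 \<Longrightarrow> \<exists>S. coeff S 0 = 1 \<and> circle_mean (\<lambda>t. (cmod (poly (cpoly (D * S)) t - 1))\<^sup>2) < \<epsilon>"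
    using outer_polynomial[OF A] by blast
  have D_eq: "poly (cpoly D) t = (1 - t) ^ (2 * a) * (1 + t) ^ (2 * b)" for t
    by (simp add: D(1) A_def poly_power root_factor_def)
  have deg: "degree \<rho>1 = a + b"
    by (simp add: \<rho>1_def degree_mult_eq degree_power_eq)
  have rho1_eq: "poly \<rho>1 x = (x - 1) ^ a * (1 + x) ^ b" for x
    by (simp add: \<rho>1_def poly_power)
  show thesis
  proof (rule that)
    show "lead_coeff \<rho>1 = 1" by (simp add: \<rho>1_def lead_coeff_mult lead_coeff_power)
    show "square_approximable D" using D by (simp add: square_approximable_def)
    show "\<forall>t. cmod t = 1 \<longrightarrow> 4 ^ degree \<rho>1 * (poly \<rho>1 (Re t))\<^sup>2 = (cmod (poly (cpoly D) t))\<^sup>2"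
    proof (intro allI impI)
      fix t :: complex assume "cmod t = 1"
      then have "(Re t)\<^sup>2 + (Im t)\<^sup>2 = 1" using cmod_power2[of t] by simp
      then have 1: "(cmod (1 - t))\<^sup>2 = 2 * (1 - Re t)" "(cmod (1 + t))\<^sup>2 = 2 * (1 + Re t)"
        by (simp_all add: cmod_power2) (simp_all add: power2_eq_square algebra_simps)
      have "(cmod (poly (cpoly D) t))\<^sup>2 = ((cmod (1 - t))\<^sup>2) ^ (2 * a) * ((cmod (1 + t))\<^sup>2) ^ (2 * b)"
        by (simp add: D_eq norm_mult norm_power power_mult_distrib mult.commute flip: power_mult)
      also have "\<dots> = 4 ^ a * (1 - Re t) ^ (2 * a) * (4 ^ b * (1 + Re t) ^ (2 * b))"
        unfolding 1 by (simp only: power_mult_distrib power_mult) simp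
      also have "\<dots> = 4 ^ (a + b) * (((1 - Re t) ^ a)\<^sup>2 * ((1 + Re t) ^ b)\<^sup>2)"
        by (simp add: power_add mult.commute flip: power_mult)
      also have "((1 - Re t) ^ a)\<^sup>2 = ((Re t - 1) ^ a)\<^sup>2"
        by (simp only: power_mult[symmetric] mult.commute[of a]) (simp only: power_mult power2_commute)
      finally show "4 ^ degree \<rho>1 * (poly \<rho>1 (Re t))\<^sup>2 = (cmod (poly (cpoly D) t))\<^sup>2"
        by (simp add: deg rho1_eq power_mult_distrib)
    qed
    show "\<forall>\<epsilon>>0. \<exists>h. \<forall>x\<in>{-1..1}. (poly \<rho>1 x)\<^sup>2 \<le> poly h x * poly \<rho> x \<and>
      poly h x * poly \<rho> x \<le> (poly \<rho>1 x)\<^sup>2 + \<epsilon> * poly \<rho> x"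
    proof (intro allI impI)
      fix \<epsilon> :: real assume "\<epsilon> > 0"
      \<comment> \<open>\<open>f * \<rho>\<close> is the square of \<open>\<rho>1\<close>, and
        \<open>f\<close> is continuous because \<open>r\<close> has no zeros. Raising it by
        \<open>\<epsilon> / 2\<close> before approximating makes the approximation
        one-sided.\<close>
      define f where "f x = poly \<rho>1 x / poly r x" for x
      have half: "\<epsilon> / 2 > 0" using \<open>\<epsilon> > 0\<close> by simp
      have cont: "continuous_on {-1..1} (\<lambda>x. f x + \<epsilon> / 2)"
        unfolding f_def by (intro continuous_intros) (use r0 in auto)
      obtain h where h: "\<And>x. x \<in> {-1..1} \<Longrightarrow> \<bar>f x + \<epsilon> / 2 - poly h x\<bar> < \<epsilon> / 2"
        using real_poly_approximation[OF cont half] by blast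
      have "(poly \<rho>1 x)\<^sup>2 \<le> poly h x * poly \<rho> x \<and> poly h x * poly \<rho> x \<le> (poly \<rho>1 x)\<^sup>2 + \<epsilon> * poly \<rho> x"
        if "x \<in> {-1..1}" for x
      proof -
        have eq: "(poly \<rho>1 x)\<^sup>2 = f x * poly \<rho> x" using r0[OF that] by (simp add: f_def rho power2_eq_square)
        have "f x \<le> poly h x" "poly h x \<le> f x + \<epsilon>" using h[OF that] by linarith+
        then show ?thesis unfolding eq distrib_right[symmetric] using nonneg[OF that]
          by (auto intro: mult_right_mono)
      qed
      then show "\<exists>h. \<forall>x\<in>{-1..1}. (poly \<rho>1 x)\<^sup>2 \<le> poly h x * poly \<rho> x \<and>
          poly h x * poly \<rho> x \<le> (poly \<rho>1 x)\<^sup>2 + \<epsilon> * poly \<rho> x" by blast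
    qed
  qed
qed

section \<open>The Jacobi recurrence coefficients\<close>

definition jop :: "real \<Rightarrow> real \<Rightarrow> real poly \<Rightarrow> real poly" where
  "jop \<alpha> \<beta> f = [:1, 0, -1:] * pderiv (pderiv f) + [:\<beta> - \<alpha>, - (\<alpha> + \<beta> + 2):] * pderiv f"

definition eigenvalue :: "real \<Rightarrow> real \<Rightarrow> nat \<Rightarrow> real" where
  "eigenvalue \<alpha> \<beta> n = - real n * (1 + real n + \<alpha> + \<beta>)"

text \<open>The operator acts on coefficients as a triangular matrix with diagonal
  \<open>eigenvalue\<close>: degrees never rise, and the top coefficients of an eigenpolynomial can
  be read off.\<close>

lemma coeff_jop:
  "coeff (jop \<alpha> \<beta> f) k = eigenvalue \<alpha> \<beta> k * coeff f k + (\<beta> - \<alpha>) * (real k + 1) * coeff f (k + 1)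
     + (real k + 1) * (real k + 2) * coeff f (k + 2)"
proof (cases k)
  case 0
  then show ?thesis by (simp add: jop_def eigenvalue_def coeff_pderiv numeral_2_eq_2)
next
  case (Suc j)
  show ?thesis unfolding Suc
    by (cases j) (simp_all add: jop_def eigenvalue_def coeff_pderiv algebra_simps)
qed

lemma eigenvalue_nonzero: "\<alpha> > -1 \<Longrightarrow> \<beta> > -1 \<Longrightarrow> n > 0 \<Longrightarrow> eigenvalue \<alpha> \<beta> n \<noteq> 0"
  by (auto simp: eigenvalue_def)

lemma degree_jop_le: "degree (jop \<alpha> \<beta> f) \<le> degree f"
  by (rule degree_le) (auto simp: coeff_jop coeff_eq_0)

lemma jop_smult: "jop \<alpha> \<beta> (smult c f) = smult c (jop \<alpha> \<beta> f)"
  by (simp add: jop_def pderiv_smult smult_add_right)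

lemma jop_diff: "jop \<alpha> \<beta> (f - g) = jop \<alpha> \<beta> f - jop \<alpha> \<beta> g"
  by (rule poly_eqI) (simp add: coeff_jop algebra_simps)

lemma jop_sum: "jop \<alpha> \<beta> (\<Sum>x\<in>A. f x) = (\<Sum>x\<in>A. jop \<alpha> \<beta> (f x))"
proof -
  have "jop \<alpha> \<beta> (f + g) = jop \<alpha> \<beta> f + jop \<alpha> \<beta> g" for f g
    by (rule poly_eqI) (simp add: coeff_jop algebra_simps)
  moreover have "jop \<alpha> \<beta> 0 = 0" by (simp add: jop_def)
  ultimately show ?thesis by (induction A rule: infinite_finite_induct) simp_all
qed

text \<open>The kernel consists of constants only, since \<open>eigenvalue\<close> vanishes at no
  positive index. This is exactly the additive constant left free in \<open>Q n\<close>.\<close>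

lemma jop_eq_0:
  assumes "\<alpha> > -1" "\<beta> > -1" "jop \<alpha> \<beta> f = 0"
  shows "degree f = 0"
proof (rule ccontr)
  assume "degree f \<noteq> 0"
  then have "coeff (jop \<alpha> \<beta> f) (degree f) \<noteq> 0"
    using eigenvalue_nonzero[OF assms(1,2), of "degree f"] by (auto simp: coeff_jop coeff_eq_0)
  then show False using assms(3) by simp
qed

lemma eigenvalue_quotient_limit:
  "(\<lambda>n. eigenvalue \<alpha> \<beta> (n + k) / eigenvalue \<alpha> \<beta> n) \<longlonglongrightarrow> 1"
  unfolding eigenvalue_def by real_asymp

text \<open>\<open>pearson\<close> is the integrated Pearson equation \<open>((1 - x^2) w)' =
  (\<beta> - \<alpha> - (\<alpha> + \<beta> + 2) x) w\<close>, the link between the weight and the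
  operator.\<close>

locale jacobi_polys = orthonormal_polys I p for I p +
  fixes \<alpha> \<beta> :: real
  assumes alpha: "\<alpha> > -1" and beta: "\<beta> > -1"
    and pearson: "I ([:1, 0, -1:] * pderiv f + [:\<beta> - \<alpha>, - (\<alpha> + \<beta> + 2):] * f) = 0"
begin

lemma jop_symmetric: "I (jop \<alpha> \<beta> f * g) = I (f * jop \<alpha> \<beta> g)"
proof -
  \<comment> \<open>Applying \<open>pearson\<close> to \<open>pderiv f * g\<close> is the
    integration by parts; the result is symmetric in \<open>f\<close> and \<open>g\<close>.\<close>
  have parts: "I (jop \<alpha> \<beta> f * g) = - I ([:1, 0, -1:] * pderiv f * pderiv g)" for f g
  proof -
    have "jop \<alpha> \<beta> f * g = ([:1, 0, -1:] * pderiv (pderiv f * g) + [:\<beta> - \<alpha>, - (\<alpha> + \<beta> + 2):] * (pderiv f * g))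
       - [:1, 0, -1:] * pderiv f * pderiv g"
      by (rule real_poly_eqI) (simp add: jop_def pderiv_mult algebra_simps)
    then show ?thesis by (simp only: diff pearson)
  qed
  have "I (jop \<alpha> \<beta> f * g) = I (jop \<alpha> \<beta> g * f)"
    unfolding parts by (simp only: mult.assoc mult.commute[of "pderiv f"])
  then show ?thesis by (simp only: mult.commute)
qed

text \<open>By symmetry and because degrees do not rise, the image of \<open>p n\<close> is
  orthogonal to all lower degrees, hence a multiple of \<open>p n\<close>. The leading coefficient
  identifies the factor.\<close>

lemma jop_p: "jop \<alpha> \<beta> (p n) = smult (eigenvalue \<alpha> \<beta> n) (p n)"
proof -
  have "I (jop \<alpha> \<beta> (p n) * p k) = 0" if "k < n" for k
    unfolding jop_symmetric
    using orthogonal_lower[of "jop \<alpha> \<beta> (p k)" n] that degree_jop_le[of \<alpha> \<beta> "p k"] degree_p[of k]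
    by (simp add: mult.commute)
  then have "(\<Sum>k\<le>n. smult (I (jop \<alpha> \<beta> (p n) * p k)) (p k)) = (\<Sum>k\<in>{n}. smult (I (jop \<alpha> \<beta> (p n) * p k)) (p k))"
    by (intro sum.mono_neutral_right) auto
  then have eq: "jop \<alpha> \<beta> (p n) = smult (I (jop \<alpha> \<beta> (p n) * p n)) (p n)"
    using expansion[of "jop \<alpha> \<beta> (p n)" n] degree_jop_le[of \<alpha> \<beta> "p n"] by (simp add: degree_p)
  have "eigenvalue \<alpha> \<beta> n * lead_coeff (p n) = I (jop \<alpha> \<beta> (p n) * p n) * lead_coeff (p n)"
    using arg_cong[OF eq, of "\<lambda>q. coeff q n"] by (simp add: coeff_jop coeff_eq_0 degree_p)
  then have "I (jop \<alpha> \<beta> (p n) * p n) = eigenvalue \<alpha> \<beta> n" using p_nonzero[of n] by simp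
  then show ?thesis using eq by metis
qed

text \<open>The indices are shifted, to \<open>p (n + 1)\<close> and \<open>p (n + 2)\<close>, to avoid truncated subtraction.\<close>

definition second_coeff :: "nat \<Rightarrow> real" where
  "second_coeff n = coeff (p (n + 1)) n / lead_coeff (p (n + 1))"

definition third_coeff :: "nat \<Rightarrow> real" where
  "third_coeff n = coeff (p (n + 2)) n / lead_coeff (p (n + 2))"

lemma second_coeff_eq: "second_coeff n = (\<alpha> - \<beta>) * ((real n + 1) / (2 * real n + 2 + \<alpha> + \<beta>))"
proof -
  have "eigenvalue \<alpha> \<beta> (n + 1) * coeff (p (n + 1)) n =
     eigenvalue \<alpha> \<beta> n * coeff (p (n + 1)) n + (\<beta> - \<alpha>) * (real n + 1) * lead_coeff (p (n + 1))"
    using arg_cong[OF jop_p[of "n + 1"], of "\<lambda>q. coeff q n"] by (simp add: coeff_jop coeff_eq_0 degree_p)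
  then have "(2 * real n + 2 + \<alpha> + \<beta>) * coeff (p (n + 1)) n = (\<alpha> - \<beta>) * (real n + 1) * lead_coeff (p (n + 1))"
    by (simp add: eigenvalue_def algebra_simps)
  moreover have "2 * real n + 2 + \<alpha> + \<beta> > 0" using alpha beta by simp
  ultimately show ?thesis using p_nonzero[of "n + 1"] by (simp add: second_coeff_def field_simps)
qed

text \<open>The two summands are kept apart because the first converges, while the second grows
  linearly and only its increments converge.\<close>

lemma third_coeff_eq:
  "third_coeff n = - (((\<beta> - \<alpha>) * second_coeff (n + 1)) * ((real n + 1) / (2 * (2 * real n + 3 + \<alpha> + \<beta>)))
     + (real n + 1) * (real n + 2) / (2 * (2 * real n + 3 + \<alpha> + \<beta>)))"
proof -
  have "eigenvalue \<alpha> \<beta> (n + 2) * coeff (p (n + 2)) n =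
     eigenvalue \<alpha> \<beta> n * coeff (p (n + 2)) n + (\<beta> - \<alpha>) * (real n + 1) * coeff (p (n + 2)) (n + 1)
     + (real n + 1) * (real n + 2) * lead_coeff (p (n + 2))"
    using arg_cong[OF jop_p[of "n + 2"], of "\<lambda>q. coeff q n"] by (simp add: coeff_jop coeff_eq_0 degree_p)
  moreover have "coeff (p (n + 2)) (n + 1) = second_coeff (n + 1) * lead_coeff (p (n + 2))"
    using p_nonzero[of "n + 2"] by (simp add: second_coeff_def)
  moreover have "coeff (p (n + 2)) n = third_coeff n * lead_coeff (p (n + 2))"
    using p_nonzero[of "n + 2"] by (simp add: third_coeff_def)
  ultimately have "lead_coeff (p (n + 2)) * ((2 * (2 * real n + 3 + \<alpha> + \<beta>)) * third_coeff n) =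
      lead_coeff (p (n + 2)) * (- ((\<beta> - \<alpha>) * (real n + 1) * second_coeff (n + 1) + (real n + 1) * (real n + 2)))"
    by (simp add: eigenvalue_def algebra_simps)
  then have *: "(2 * (2 * real n + 3 + \<alpha> + \<beta>)) * third_coeff n =
      - ((\<beta> - \<alpha>) * (real n + 1) * second_coeff (n + 1) + (real n + 1) * (real n + 2))"
    using p_nonzero[of "n + 2"] by simp
  define d where "d = 2 * (2 * real n + 3 + \<alpha> + \<beta>)"
  have "d \<noteq> 0" using alpha beta by (simp add: d_def)
  then have "third_coeff n = - ((\<beta> - \<alpha>) * (real n + 1) * second_coeff (n + 1) + (real n + 1) * (real n + 2)) / d"
    using * unfolding d_def[symmetric] by (metis nonzero_mult_div_cancel_left)
  also have "\<dots> = - (((\<beta> - \<alpha>) * second_coeff (n + 1)) * ((real n + 1) / d) + (real n + 1) * (real n + 2) / d)"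
    using \<open>d \<noteq> 0\<close> by (simp add: field_simps)
  finally show ?thesis unfolding d_def .
qed

lemma diag_eq: "diag (n + 1) = second_coeff n - second_coeff (n + 1)"
proof -
  have "coeff (p (n + 1)) n = offdiag (n + 2) * coeff (p (n + 2)) (n + 1) + diag (n + 1) * lead_coeff (p (n + 1))"
    using arg_cong[OF recurrence[of "n + 1"], of "\<lambda>q. coeff q (n + 1)"] by (simp add: coeff_eq_0 degree_p)
  then have "coeff (p (n + 1)) n / lead_coeff (p (n + 1)) =
      offdiag (n + 2) * coeff (p (n + 2)) (n + 1) / lead_coeff (p (n + 1)) + diag (n + 1)"
    using p_nonzero[of "n + 1"] by (simp add: add_divide_distrib)
  also have "offdiag (n + 2) * coeff (p (n + 2)) (n + 1) / lead_coeff (p (n + 1)) = second_coeff (n + 1)"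
    using lead_offdiag[of "n + 1"] offdiag_pos[of "n + 1"] by (simp add: second_coeff_def)
  finally show ?thesis by (simp add: second_coeff_def)
qed

text \<open>The coefficients two places below the top of the recurrence are compared.
  \<open>lead_offdiag\<close> turns the quotient of leading coefficients into a second factor
  \<open>offdiag\<close>, hence the square.\<close>

lemma offdiag_eq:
  "(offdiag (n + 2))\<^sup>2 = third_coeff n - third_coeff (n + 1) - diag (n + 2) * second_coeff (n + 1)"
proof -
  have "coeff (p (n + 2)) n = offdiag (n + 3) * coeff (p (n + 3)) (n + 1) + diag (n + 2) * coeff (p (n + 2)) (n + 1)
      + offdiag (n + 2) * lead_coeff (p (n + 1))"
    using arg_cong[OF recurrence[of "n + 2"], of "\<lambda>q. coeff q (n + 1)"] by (simp add: degree_p eval_nat_numeral)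
  then have "coeff (p (n + 2)) n / lead_coeff (p (n + 2)) =
      offdiag (n + 3) * coeff (p (n + 3)) (n + 1) / lead_coeff (p (n + 2))
      + diag (n + 2) * (coeff (p (n + 2)) (n + 1) / lead_coeff (p (n + 2)))
      + offdiag (n + 2) * lead_coeff (p (n + 1)) / lead_coeff (p (n + 2))"
    by (simp add: add_divide_distrib)
  also have "offdiag (n + 3) * coeff (p (n + 3)) (n + 1) / lead_coeff (p (n + 2)) = third_coeff (n + 1)"
    using lead_offdiag[of "n + 2"] offdiag_pos[of "n + 2"] by (simp add: third_coeff_def eval_nat_numeral)
  also have "offdiag (n + 2) * lead_coeff (p (n + 1)) / lead_coeff (p (n + 2)) = (offdiag (n + 2))\<^sup>2"
    using lead_offdiag[of "n + 1"] p_nonzero[of "n + 2"] by (simp add: power2_eq_square)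
  finally show ?thesis by (simp add: third_coeff_def second_coeff_def)
qed

sublocale nevai_polys I p
proof
  have ratio: "(\<lambda>n. (real n + 1) / (2 * real n + 2 + \<alpha> + \<beta>)) \<longlonglongrightarrow> 1 / 2" by real_asymp
  have second: "second_coeff \<longlonglongrightarrow> (\<alpha> - \<beta>) * (1 / 2)"
    unfolding second_coeff_eq[abs_def] by (intro tendsto_intros ratio)
  have shift: "f \<longlonglongrightarrow> l \<Longrightarrow> (\<lambda>n. f (n + k)) \<longlonglongrightarrow> l" for f :: "nat \<Rightarrow> real" and l k
    by (rule LIMSEQ_ignore_initial_segment)
  have "(\<lambda>n. second_coeff n - second_coeff (n + 1)) \<longlonglongrightarrow> (\<alpha> - \<beta>) * (1 / 2) - (\<alpha> - \<beta>) * (1 / 2)"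
    by (intro tendsto_diff second shift)
  then have "(\<lambda>n. diag (n + 1)) \<longlonglongrightarrow> 0" by (simp only: diag_eq) simp
  then show diag: "diag \<longlonglongrightarrow> 0" by (rule LIMSEQ_offset)
  define g where "g n = ((\<beta> - \<alpha>) * second_coeff (n + 1)) * ((real n + 1) / (2 * (2 * real n + 3 + \<alpha> + \<beta>)))" for n
  have "(\<lambda>n. (real n + 1) / (2 * (2 * real n + 3 + \<alpha> + \<beta>))) \<longlonglongrightarrow> 1 / 4" by real_asymp
  then have g: "g \<longlonglongrightarrow> ((\<beta> - \<alpha>) * ((\<alpha> - \<beta>) * (1 / 2))) * (1 / 4)"
    unfolding g_def by (intro tendsto_mult[OF tendsto_mult_left[OF shift[OF second]]])
  \<comment> \<open>\<open>h\<close> grows like \<open>n / 4\<close>, so its increments supply the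
    limit \<open>1 / 4\<close> of the squares, while the increments of the convergent
    \<open>g\<close> tend to \<open>0\<close>.\<close>
  define h where "h n = (real n + 1) * (real n + 2) / (2 * (2 * real n + 3 + \<alpha> + \<beta>))" for n
  have h: "(\<lambda>n. h (n + 1) - h n) \<longlonglongrightarrow> 1 / 4" unfolding h_def by real_asymp (simp add: field_simps)
  have "(\<lambda>n. (h (n + 1) - h n) + (g (n + 1) - g n) - diag (n + 2) * second_coeff (n + 1)) \<longlonglongrightarrow>
      1 / 4 + (((\<beta> - \<alpha>) * ((\<alpha> - \<beta>) * (1 / 2))) * (1 / 4) - ((\<beta> - \<alpha>) * ((\<alpha> - \<beta>) * (1 / 2))) * (1 / 4)) - 0 * ((\<alpha> - \<beta>) * (1 / 2))"
    by (intro tendsto_diff tendsto_add tendsto_mult h g second diag shift)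
  moreover have "(offdiag (n + 2))\<^sup>2 = (h (n + 1) - h n) + (g (n + 1) - g n) - diag (n + 2) * second_coeff (n + 1)" for n
    unfolding offdiag_eq third_coeff_eq g_def h_def by simp
  ultimately have "(\<lambda>n. (offdiag (n + 2))\<^sup>2) \<longlonglongrightarrow> 1 / 4" by simp
  then have "(\<lambda>n. sqrt ((offdiag (n + 2))\<^sup>2)) \<longlonglongrightarrow> sqrt (1 / 4)" by (rule tendsto_real_sqrt)
  moreover have "sqrt ((offdiag (n + 2))\<^sup>2) = offdiag (n + 2)" for n
    using offdiag_pos[of "n + 1"] by simp
  moreover have "sqrt (1 / 4) = (1 / 2 :: real)" by (simp add: real_sqrt_divide)
  ultimately have "(\<lambda>n. offdiag (n + 2)) \<longlonglongrightarrow> 1 / 2" by simp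
  then show "offdiag \<longlonglongrightarrow> 1 / 2" by (rule LIMSEQ_offset)
qed

end

section \<open>The Jacobi measure divided by a polynomial\<close>

lemma AE_poly_nonzero: "p \<noteq> 0 \<Longrightarrow> AE x in lborel. poly p x \<noteq> (0 :: real)"
  by (rule AE_I'[of "{x. poly p x = 0}"]) (auto intro!: finite_imp_null_set_lborel poly_roots_finite)

lemma borel_measurable_poly [measurable]: "(\<lambda>x :: real. poly p x :: real) \<in> borel_measurable borel"
  by (intro borel_measurable_continuous_onI continuous_intros)

locale divided_jacobi_measure =
  fixes \<alpha> \<beta> :: real and m :: nat and \<rho> :: "real poly" and \<mu> :: "real measure"
  assumes alpha: "\<alpha> > -1" and beta: "\<beta> > -1"
    and divided: "jacobi_divided \<alpha> \<beta> m \<rho> \<mu>"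
    and finite: "finite_measure \<mu>"
begin

abbreviation "M \<equiv> jacobi_measure \<alpha> \<beta>"

definition w :: "real \<Rightarrow> real" where
  "w x = indicator {-1..1} x * ((1 - x) powr \<alpha> * (1 + x) powr \<beta>)"

lemma w_measurable [measurable]: "w \<in> borel_measurable borel"
  unfolding w_def by measurable

lemma w_nonneg: "0 \<le> w x"
  by (simp add: w_def)

lemma M_eq: "M = density lborel (\<lambda>x. ennreal (w x))"
  by (simp add: jacobi_measure_def w_def)

lemma rho_nonzero: "\<rho> \<noteq> 0" and degree_rho: "degree \<rho> = m"
  and rho_nonneg: "x \<in> {-1..1} \<Longrightarrow> 0 \<le> poly \<rho> x"
  and mu_eq: "\<mu> = density M (\<lambda>x. ennreal (1 / poly \<rho> x))"
  using divided by (auto simp: jacobi_divided_def)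

lemma M_sets [measurable_cong, simp]: "sets M = sets borel"
  by (simp add: M_eq)

lemma mu_sets [measurable_cong, simp]: "sets \<mu> = sets borel"
  by (simp add: mu_eq)

lemma AE_M: "AE x in M. x \<in> {-1..1} \<and> poly \<rho> x \<noteq> 0"
  unfolding M_eq using AE_poly_nonzero[OF rho_nonzero]
  by (subst AE_density) (auto simp: w_def indicator_def split: if_splits elim!: eventually_mono)

lemma AE_mu: "AE x in \<mu>. x \<in> {-1..1}"
  unfolding mu_eq by (subst AE_density, measurable) (rule eventually_mono[OF AE_M], auto)

lemma nn_integral_mu:
  assumes [measurable]: "f \<in> borel_measurable borel"
  shows "(\<integral>\<^sup>+x. f x \<partial>\<mu>) = (\<integral>\<^sup>+x. ennreal (w x / poly \<rho> x) * f x \<partial>lborel)"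
  unfolding mu_eq M_eq
  by (subst density_density_eq, measurable, subst nn_integral_density, measurable)
     (auto simp: w_nonneg ennreal_mult'[symmetric] intro!: nn_integral_cong)

text \<open>Just to the right of an interior zero the density of \<open>\<mu>\<close> would exceed a
  multiple of \<open>1 / (x - x0)\<close>, whose integral diverges logarithmically.\<close>

lemma rho_pos: 
  assumes "x0 \<in> {-1<..<1}"
  shows "poly \<rho> x0 \<noteq> 0"
proof
  assume zero: "poly \<rho> x0 = 0"
  then obtain q where q: "\<rho> = [:- x0, 1:] * q" by (auto simp: poly_eq_0_iff_dvd)
  define \<delta> where "\<delta> = (1 - x0) / 2"
  have \<delta>: "\<delta> > 0" "x0 + \<delta> < 1" using assms by (auto simp: \<delta>_def field_simps)
  have sub: "x \<in> {-1<..<1}" if "x \<in> {x0..x0 + \<delta>}" for x using that \<delta> assms by auto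
  have "bounded ((\<lambda>x. poly q x) ` {-1..1})"
    by (intro compact_imp_bounded compact_continuous_image continuous_intros) auto
  then obtain G where G: "G > 0" "\<And>x. x \<in> {-1..1} \<Longrightarrow> \<bar>poly q x\<bar> \<le> G"
    unfolding bounded_pos by auto
  have "continuous_on {x0..x0 + \<delta>} (\<lambda>x. (1 - x) powr \<alpha> * (1 + x) powr \<beta>)"
    using sub by (intro continuous_on_mult continuous_on_powr continuous_intros) force+
  then obtain y where y: "y \<in> {x0..x0 + \<delta>}"
    "\<And>x. x \<in> {x0..x0 + \<delta>} \<Longrightarrow> (1 - y) powr \<alpha> * (1 + y) powr \<beta> \<le> (1 - x) powr \<alpha> * (1 + x) powr \<beta>"
    using continuous_attains_inf[of "{x0..x0 + \<delta>}" "\<lambda>x. (1 - x) powr \<alpha> * (1 + x) powr \<beta>"] \<delta> by auto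
  define c where "c = (1 - y) powr \<alpha> * (1 + y) powr \<beta>"
  have c: "c > 0" using sub[OF y(1)] by (auto simp: c_def)
  have w_ge: "w x \<ge> c" if "x \<in> {x0..x0 + \<delta>}" for x
    using y(2)[OF that] sub[OF that] by (simp add: w_def c_def)
  define B where "B = emeasure \<mu> UNIV"
  have "space \<mu> = UNIV" using sets_eq_imp_space_eq[OF mu_sets] by simp
  then have "B < \<infinity>" using finite_measure.emeasure_finite[OF finite, of UNIV] by (simp add: B_def less_top)
  have bound: "ennreal (c / G * (ln \<delta> - ln \<epsilon>)) \<le> B" if \<epsilon>: "0 < \<epsilon>" "\<epsilon> \<le> \<delta>" for \<epsilon>
  proof -
    have "(\<integral>\<^sup>+x. ennreal (c / G * (1 / (x - x0))) * indicator {x0 + \<epsilon>..x0 + \<delta>} x \<partial>lborel) =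
      ennreal (c / G * ln ((x0 + \<delta>) - x0) - c / G * ln ((x0 + \<epsilon>) - x0))"
    proof (rule nn_integral_FTC_Icc)
      fix x assume "x \<in> {x0 + \<epsilon>..x0 + \<delta>}"
      then have "x - x0 > 0" using \<epsilon> by auto
      then show "((\<lambda>x. c / G * ln (x - x0)) has_real_derivative c / G * (1 / (x - x0))) (at x)"
        using G by (auto intro!: derivative_eq_intros)
      show "0 \<le> c / G * (1 / (x - x0))" using c G \<open>x - x0 > 0\<close> by simp
    qed (use \<epsilon> in auto)
    also have "c / G * ln ((x0 + \<delta>) - x0) - c / G * ln ((x0 + \<epsilon>) - x0) = c / G * (ln \<delta> - ln \<epsilon>)"
      by (simp add: right_diff_distrib)
    finally have "ennreal (c / G * (ln \<delta> - ln \<epsilon>)) =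
      (\<integral>\<^sup>+x. ennreal (c / G * (1 / (x - x0))) * indicator {x0 + \<epsilon>..x0 + \<delta>} x \<partial>lborel)" by simp
    also have "\<dots> \<le> (\<integral>\<^sup>+x. ennreal (w x / poly \<rho> x) * 1 \<partial>lborel)"
    proof (rule nn_integral_mono_AE)
      show "AE x in lborel. ennreal (c / G * (1 / (x - x0))) * indicator {x0 + \<epsilon>..x0 + \<delta>} x \<le> ennreal (w x / poly \<rho> x) * 1"
        using AE_poly_nonzero[OF rho_nonzero]
      proof eventually_elim
        case (elim x)
        show ?case
        proof (cases "x \<in> {x0 + \<epsilon>..x0 + \<delta>}")
          case True
          then have x: "x \<in> {x0..x0 + \<delta>}" "x - x0 > 0" "x \<in> {-1..1}" using \<epsilon> sub[of x] by auto
          have "poly \<rho> x > 0" using elim rho_nonneg[OF x(3)] by auto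
          moreover have "poly \<rho> x \<le> (x - x0) * G"
            using mult_left_mono[of "poly q x" G "x - x0"] G(2)[OF x(3)] x(2) by (simp add: q algebra_simps abs_le_iff)
          ultimately have "c / ((x - x0) * G) \<le> w x / poly \<rho> x"
            using w_ge[OF x(1)] c x(2) G(1) w_nonneg[of x] by (intro frac_le) auto
          then show ?thesis using True by (simp add: ennreal_leI mult.commute)
        qed simp
      qed
    qed
    also have "\<dots> = B" using nn_integral_mu[of "\<lambda>_. 1"] \<open>space \<mu> = UNIV\<close> by (simp add: B_def)
    finally show ?thesis .
  qed
  obtain b where b: "B = ennreal b" "b \<ge> 0" using \<open>B < \<infinity>\<close> by (cases B) auto
  \<comment> \<open>Solves \<open>c / G * (ln \<delta> - ln \<epsilon>) = b + 1\<close>, one more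
    than the total mass of \<open>\<mu>\<close>.\<close>
  define \<epsilon> where "\<epsilon> = \<delta> * exp (- (G * (b + 1) / c))"
  have "0 < \<epsilon>" "\<epsilon> \<le> \<delta>" using \<delta> b c G by (auto simp: \<epsilon>_def mult_le_cancel_left2)
  moreover have "c / G * (ln \<delta> - ln \<epsilon>) = b + 1" using \<delta> c G by (simp add: \<epsilon>_def ln_mult)
  ultimately have "ennreal (b + 1) \<le> ennreal b" using bound[of \<epsilon>] b by simp
  then show False using b by simp
qed

lemma rho_bounded: obtains G where "G > 0" "\<And>x. x \<in> {-1..1} \<Longrightarrow> poly \<rho> x \<le> G"
proof -
  have "bounded ((\<lambda>x. poly \<rho> x) ` {-1..1})"
    by (intro compact_imp_bounded compact_continuous_image continuous_intros) auto
  then show thesis using that unfolding bounded_pos by (auto simp: abs_le_iff)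
qed

text \<open>\<open>M\<close> is \<open>\<mu>\<close> with density \<open>\<rho>\<close>, which is
  bounded on \<open>[-1, 1]\<close>, so finiteness is inherited from \<open>\<mu>\<close>.\<close>

lemma finite_M: "finite_measure M"
proof (rule finite_measureI)
  obtain G where G: "G > 0" "\<And>x. x \<in> {-1..1} \<Longrightarrow> poly \<rho> x \<le> G" using rho_bounded by blast
  have "emeasure M (space M) = (\<integral>\<^sup>+x. ennreal (w x) \<partial>lborel)"
    unfolding M_eq by (subst emeasure_density) auto
  also have "\<dots> \<le> (\<integral>\<^sup>+x. ennreal (w x / poly \<rho> x) * ennreal G \<partial>lborel)"
  proof (rule nn_integral_mono_AE)
    show "AE x in lborel. ennreal (w x) \<le> ennreal (w x / poly \<rho> x) * ennreal G"
      using AE_poly_nonzero[OF rho_nonzero]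
    proof eventually_elim
      case (elim x)
      show ?case
      proof (cases "x \<in> {-1..1}")
        case True
        then have "poly \<rho> x > 0" using elim rho_nonneg[OF True] by auto
        then have "w x * poly \<rho> x \<le> w x * G" "w x / poly \<rho> x \<ge> 0"
          using G(2)[OF True] w_nonneg[of x] by (auto intro: mult_left_mono)
        then show ?thesis using \<open>poly \<rho> x > 0\<close> G(1)
          by (simp add: ennreal_mult'[symmetric] ennreal_leI field_simps)
      qed (simp add: w_def)
    qed
  qed
  also have "\<dots> = (\<integral>\<^sup>+x. ennreal G \<partial>\<mu>)" by (rule nn_integral_mu[symmetric]) simp
  also have "\<dots> = ennreal G * emeasure \<mu> (space \<mu>)" by simp
  also have "\<dots> < \<infinity>" using finite_measure.emeasure_finite[OF finite]
    by (simp add: ennreal_mult_less_top less_top)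
  finally show "emeasure M (space M) \<noteq> \<infinity>" by simp
qed

lemma integrable_poly:
  fixes f :: "real poly" and N :: "real measure"
  assumes "finite_measure N" "sets N = sets borel" "AE x in N. x \<in> {-1..1}"
  shows "integrable N (\<lambda>x. poly f x)"
proof -
  have "bounded ((\<lambda>x. poly f x) ` {-1..1})"
    by (intro compact_imp_bounded compact_continuous_image continuous_intros) auto
  then obtain G where G: "\<And>x. x \<in> {-1..1} \<Longrightarrow> \<bar>poly f x\<bar> \<le> G"
    unfolding bounded_pos by (metis imageI real_norm_def)
  show ?thesis
  proof (rule finite_measure.integrable_const_bound[OF assms(1)])
    show "AE x in N. norm (poly f x) \<le> G" using assms(3) by eventually_elim (use G in auto)
    show "poly f \<in> borel_measurable N" using assms(2) borel_measurable_poly measurable_cong_sets by blast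
  qed
qed

lemma integrable_mu: "integrable \<mu> (\<lambda>x. poly f x)"
  by (rule integrable_poly[OF finite mu_sets AE_mu])

lemma integrable_M: "integrable M (\<lambda>x. poly f x)"
  by (rule integrable_poly[OF finite_M M_sets], rule eventually_mono[OF AE_M]) auto

definition J :: "real poly \<Rightarrow> real" where "J f = (\<integral>x. poly f x \<partial>\<mu>)"

definition I :: "real poly \<Rightarrow> real" where "I f = (\<integral>x. poly f x \<partial>M)"

lemma J_mult: "J (\<rho> * f) = I f"
proof -
  have "J (\<rho> * f) = (\<integral>x. (1 / poly \<rho> x) *\<^sub>R poly (\<rho> * f) x \<partial>M)"
    unfolding J_def unfolding mu_eq
  proof (rule integral_density)
    show "AE x in M. 0 \<le> 1 / poly \<rho> x"
      using AE_M by eventually_elim (use rho_nonneg in auto)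
  qed measurable
  also have "\<dots> = I f" unfolding I_def
    by (intro integral_cong_AE, measurable, rule eventually_mono[OF AE_M]) auto
  finally show ?thesis .
qed

lemma positive_J: "positive_functional J"
proof
  show "J (p + q) = J p + J q" for p q by (simp add: J_def integrable_mu)
  show "J (smult c p) = c * J p" for c p by (simp add: J_def)
  show "0 \<le> J p" if "\<And>x. x \<in> {-1..1} \<Longrightarrow> 0 \<le> poly p x" for p
    unfolding J_def by (rule integral_nonneg_AE, rule eventually_mono[OF AE_mu]) (use that in auto)
qed

lemma positive_I: "positive_functional I"
proof
  show "I (p + q) = I p + I q" for p q by (simp add: I_def integrable_M)
  show "I (smult c p) = c * I p" for c p by (simp add: I_def)
  show "0 \<le> I p" if "\<And>x. x \<in> {-1..1} \<Longrightarrow> 0 \<le> poly p x" for p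
    unfolding I_def by (rule integral_nonneg_AE, rule eventually_mono[OF AE_M]) (use that in auto)
qed

lemma I_definite:
  assumes "f \<noteq> 0"
  shows "I (f * f) > 0"
proof (rule ccontr)
  assume "\<not> I (f * f) > 0"
  moreover have "0 \<le> I (f * f)" by (rule positive_functional.nonneg[OF positive_I]) simp
  ultimately have "I (f * f) = 0" by linarith
  then have "(\<integral>x. poly (f * f) x \<partial>M) = 0" by (simp only: I_def)
  then have "AE x in M. poly (f * f) x = 0"
    by (subst (asm) integral_nonneg_eq_0_iff_AE[OF integrable_M]) auto
  then have "AE x in lborel. 0 < ennreal (w x) \<longrightarrow> poly (f * f) x = 0"
    unfolding M_eq by (subst (asm) AE_density) auto
  then have "AE x in lborel. x \<notin> {-1<..<1::real}"
    using AE_poly_nonzero[OF assms] by eventually_elim (auto simp: w_def)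
  then have "emeasure lborel {-1<..<1::real} = 0"
    by (subst (asm) AE_iff_measurable[of "{-1<..<1::real}"]) auto
  then show False by simp
qed

text \<open>The antiderivative \<open>F\<close> vanishes at both ends because
  \<open>\<alpha> + 1\<close> and \<open>\<beta> + 1\<close> are positive. The weight may be
  unbounded there, so the fundamental theorem is used with derivatives only in the interior, for the
  gauge integral, which is then identified with the Lebesgue integral.\<close>

lemma pearson: "I ([:1, 0, -1:] * pderiv f + [:\<beta> - \<alpha>, - (\<alpha> + \<beta> + 2):] * f) = 0"
proof -
  define g where "g = [:1, 0, -1:] * pderiv f + [:\<beta> - \<alpha>, - (\<alpha> + \<beta> + 2):] * f"
  define F where "F x = (1 - x) powr (\<alpha> + 1) * (1 + x) powr (\<beta> + 1) * poly f x" for x :: real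
  have cont: "continuous_on {-1..1} F"
    unfolding F_def using alpha beta
    by (intro continuous_on_mult continuous_on_powr' continuous_intros) auto
  have deriv: "(F has_vector_derivative w x * poly g x) (at x)" if "x \<in> {-1<..<1}" for x
  proof -
    have 1: "(1 - x) powr (\<alpha> + 1) = (1 - x) powr \<alpha> * (1 - x)" "(1 + x) powr (\<beta> + 1) = (1 + x) powr \<beta> * (1 + x)"
      using that by (simp_all add: powr_add)
    have "(F has_real_derivative
        (((\<alpha> + 1) * (1 - x) powr \<alpha> * (-1)) * (1 + x) powr (\<beta> + 1) + (\<beta> + 1) * (1 + x) powr \<beta> * (1 - x) powr (\<alpha> + 1)) * poly f x
        + poly (pderiv f) x * ((1 - x) powr (\<alpha> + 1) * (1 + x) powr (\<beta> + 1))) (at x)"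
      unfolding F_def using that by (auto intro!: derivative_eq_intros poly_DERIV)
    also have "(((\<alpha> + 1) * (1 - x) powr \<alpha> * (-1)) * (1 + x) powr (\<beta> + 1) + (\<beta> + 1) * (1 + x) powr \<beta> * (1 - x) powr (\<alpha> + 1)) * poly f x
        + poly (pderiv f) x * ((1 - x) powr (\<alpha> + 1) * (1 + x) powr (\<beta> + 1)) = w x * poly g x"
      unfolding 1 using that by (simp add: w_def g_def algebra_simps)
    finally show ?thesis by (simp add: has_real_derivative_iff_has_vector_derivative)
  qed
  have "((\<lambda>x. w x * poly g x) has_integral F 1 - F (-1)) {-1..1}"
    by (rule fundamental_theorem_of_calculus_interior[OF _ cont deriv]) auto
  then have "((\<lambda>x. if x \<in> {-1..1} then w x * poly g x else 0) has_integral 0) UNIV"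
    unfolding has_integral_restrict_UNIV by (simp add: F_def)
  also have "(\<lambda>x. if x \<in> {-1..1} then w x * poly g x else 0) = (\<lambda>x. w x * poly g x)"
    by (auto simp: w_def)
  finally have HK: "((\<lambda>x. w x * poly g x) has_integral 0) UNIV" .
  have "integrable lborel (\<lambda>x. w x *\<^sub>R poly g x)"
    using integrable_M[of g] unfolding M_eq by (subst (asm) integrable_density) (auto simp: w_nonneg)
  then have "((\<lambda>x. w x * poly g x) has_integral (\<integral>x. w x * poly g x \<partial>lborel)) UNIV"
    using has_integral_integral_lborel[of "\<lambda>x. w x * poly g x"] by simp
  then have "(\<integral>x. w x * poly g x \<partial>lborel) = 0" using HK has_integral_unique by blast
  moreover have "I g = (\<integral>x. w x *\<^sub>R poly g x \<partial>lborel)"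
    unfolding I_def M_eq by (rule integral_density) (auto simp: w_nonneg)
  ultimately show ?thesis by (simp add: g_def)
qed

end

section \<open>Locally uniform limits\<close>

lemma norm_inverse_joukowski_le_1: "cmod (1 / joukowski z) \<le> 1"
  using norm_joukowski_ge_1[of z] joukowski_nonzero[of z] by (simp add: norm_divide divide_le_eq_1)

lemma bounded_inverse_joukowski_power: "bounded ((\<lambda>z. (1 / joukowski z) ^ j) ` K)"
proof (rule boundedI)
  fix y assume "y \<in> (\<lambda>z. (1 / joukowski z) ^ j) ` K"
  then obtain z where "y = (1 / joukowski z) ^ j" by blast
  then show "cmod y \<le> 1"
    using norm_inverse_joukowski_le_1[of z] by (simp add: norm_power power_le_one del: norm_divide)
qed

lemma compact_ellipse_le: "compact {z. cmod (joukowski z) \<le> r}"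
  and closed_ellipse: "closed {z. cmod (joukowski z) = r}"
proof -
  have "bounded {z. cmod (joukowski z) \<le> r}"
  proof (rule boundedI)
    fix z assume "z \<in> {z. cmod (joukowski z) \<le> r}"
    then have z: "cmod (joukowski z) \<le> r" by simp
    have "2 * z = joukowski z + 1 / joukowski z" by (rule joukowski_eq[symmetric])
    then have "2 * cmod z \<le> cmod (joukowski z) + cmod (1 / joukowski z)"
      by (metis norm_mult norm_numeral norm_triangle_ineq)
    also have "cmod (1 / joukowski z) \<le> 1" by (rule norm_inverse_joukowski_le_1)
    finally show "cmod z \<le> (r + 1) / 2" using z by simp
  qed
  moreover have "closed {z. cmod (joukowski z) \<le> r}"
    by (intro closed_Collect_le continuous_norm_joukowski continuous_intros)
  ultimately show "compact {z. cmod (joukowski z) \<le> r}" by (simp add: compact_eq_bounded_closed)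
  show "closed {z. cmod (joukowski z) = r}"
    by (intro closed_Collect_eq continuous_norm_joukowski continuous_intros)
qed

lemma joukowski_gap_above:
  assumes "compact K" "\<And>z. z \<in> K \<Longrightarrow> cmod (joukowski z) < R"
  obtains r where "r < R" "\<And>z. z \<in> K \<Longrightarrow> cmod (joukowski z) \<le> r"
proof (cases "K = {}")
  case True
  then show thesis using that[of "R - 1"] by simp
next
  case False
  obtain z where "z \<in> K" "\<And>y. y \<in> K \<Longrightarrow> cmod (joukowski y) \<le> cmod (joukowski z)"
    using continuous_attains_sup[OF assms(1) False continuous_on_subset[OF continuous_norm_joukowski subset_UNIV]] by blast
  then show thesis using that assms(2) by blast
qed

lemma joukowski_gap_below:
  assumes "compact K" "\<And>z. z \<in> K \<Longrightarrow> R < cmod (joukowski z)"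
  obtains r where "R < r" "\<And>z. z \<in> K \<Longrightarrow> r \<le> cmod (joukowski z)"
proof (cases "K = {}")
  case True
  then show thesis using that[of "R + 1"] by simp
next
  case False
  obtain z where "z \<in> K" "\<And>y. y \<in> K \<Longrightarrow> cmod (joukowski z) \<le> cmod (joukowski y)"
    using continuous_attains_inf[OF assms(1) False continuous_on_subset[OF continuous_norm_joukowski subset_UNIV]] by blast
  then show thesis using that assms(2) by blast
qed

lemma distance_to_interval:
  assumes "compact K" "\<And>z. z \<in> K \<Longrightarrow> cmod (joukowski z) > 1"
  obtains d where "d > 0" "\<And>z x. z \<in> K \<Longrightarrow> x \<in> {-1..1} \<Longrightarrow> d \<le> cmod (z - complex_of_real x)"
proof -
  have "compact (complex_of_real ` {-1..1})"
    by (intro compact_continuous_image continuous_intros) auto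
  moreover have "K \<inter> complex_of_real ` {-1..1} = {}"
    using assms(2) norm_joukowski_gt_1_iff by blast
  ultimately obtain d where "d > 0" "\<forall>z\<in>K. \<forall>y\<in>complex_of_real ` {-1..1}. d \<le> dist z y"
    using separate_compact_closed[OF assms(1) compact_imp_closed] by metis
  then show thesis using that by (simp add: dist_norm)
qed

section \<open>Asymptotics of the orthonormal polynomials on compact sets\<close>

context nevai_polys
begin

lemma pz_nonzero:
  assumes "cmod (joukowski z) > 1"
  shows "pz n z \<noteq> 0"
proof (cases n)
  case 0
  then show ?thesis by (simp add: pz_0)
next
  case (Suc k)
  obtain d where "d > 0" "\<And>y x. y \<in> {z} \<Longrightarrow> x \<in> {-1..1} \<Longrightarrow> d \<le> cmod (y - complex_of_real x)"
    using distance_to_interval[of "{z}"] assms by auto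
  then show ?thesis using pz_le_later(1)[of d z k n] Suc by auto
qed

lemma ratio_joukowski:
  assumes "compact K" "\<And>z. z \<in> K \<Longrightarrow> cmod (joukowski z) > 1"
  shows "uniform_limit K (\<lambda>n z. pz n z / pz (Suc n) z) (\<lambda>z. 1 / joukowski z) sequentially"
proof -
  obtain d where d: "d > 0" "\<And>z x. z \<in> K \<Longrightarrow> x \<in> {-1..1} \<Longrightarrow> d \<le> cmod (z - complex_of_real x)"
    using distance_to_interval[OF assms] by blast
  obtain r where r: "1 < r" "\<And>z. z \<in> K \<Longrightarrow> r \<le> cmod (joukowski z)"
    using joukowski_gap_below[OF assms] by blast
  show ?thesis
  proof (rule ratio_asymptotics[OF d])
    show "1 / r < 1" using r by simp
    show "cmod (1 / joukowski z) \<le> 1 / r" if "z \<in> K" for z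
      using r(2)[OF that] r(1) by (simp add: norm_divide frac_le)
    show "1 / joukowski z \<noteq> 0" for z by (simp add: joukowski_nonzero)
    show "1 / joukowski z + 1 / (1 / joukowski z) = 2 * z" for z
      using joukowski_eq[of z] by (simp add: add.commute)
  qed
qed

lemma pz_upper:
  assumes K: "compact K" "\<And>z. z \<in> K \<Longrightarrow> cmod (joukowski z) < r" and "1 < r"
  obtains C where "C > 0" "\<forall>\<^sub>F n in sequentially. \<forall>z\<in>K. cmod (pz n z) \<le> C * r ^ n"
proof -
  obtain s where s: "s < r" "\<And>z. z \<in> K \<Longrightarrow> cmod (joukowski z) \<le> s"
    using joukowski_gap_above[OF K] by blast
  define r0 where "r0 = (max 1 s + r) / 2"
  have r0: "1 < r0" "s < r0" "r0 < r" using s(1) \<open>1 < r\<close> by (auto simp: r0_def)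
  define S where "S = {z. cmod (joukowski z) \<le> r0}"
  define E where "E = {z. cmod (joukowski z) = r0}"
  have "E = S \<inter> E" by (auto simp: S_def E_def)
  then have E: "compact E" using compact_Int_closed[OF compact_ellipse_le closed_ellipse] by (metis E_def S_def)
  obtain C where C: "C > 0" "\<forall>\<^sub>F n in sequentially. \<forall>z\<in>E. cmod (pz n z) \<le> C * r ^ n"
    by (rule growth_upper[OF ratio_joukowski[OF E] E, of r0 r])
      (use r0 in \<open>auto simp: E_def norm_divide\<close>)
  have "cmod (pz n z) \<le> C * r ^ n" if bound: "\<forall>z\<in>E. cmod (pz n z) \<le> C * r ^ n" and "z \<in> K" for n z
  proof (rule maximum_modulus_frontier[of "pz n" S])
    show "pz n holomorphic_on interior S" unfolding pz_def by (intro holomorphic_intros)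
    show "continuous_on (closure S) (pz n)" unfolding pz_def by (intro continuous_intros)
    show "bounded S" unfolding S_def by (rule compact_imp_bounded[OF compact_ellipse_le])
    show "z \<in> S" using s(2)[OF \<open>z \<in> K\<close>] r0 by (simp add: S_def)
    fix y assume y: "y \<in> frontier S"
    have "open {z. cmod (joukowski z) < r0}"
      by (intro open_Collect_less continuous_norm_joukowski continuous_intros)
    then have "{z. cmod (joukowski z) < r0} \<subseteq> interior S"
      by (intro interior_maximal) (auto simp: S_def)
    moreover have "closed S" unfolding S_def by (rule compact_imp_closed[OF compact_ellipse_le])
    ultimately have "y \<in> S" "\<not> cmod (joukowski y) < r0" using y by (auto simp: frontier_def)
    then have "y \<in> E" by (simp add: E_def S_def)
    then show "cmod (pz n y) \<le> C * r ^ n" using bound by blast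
  qed
  then have "\<forall>\<^sub>F n in sequentially. \<forall>z\<in>K. cmod (pz n z) \<le> C * r ^ n"
    using C(2) by (auto elim!: eventually_mono)
  then show thesis using that C(1) by blast
qed

lemma pz_lower:
  assumes K: "compact K" "\<And>z. z \<in> K \<Longrightarrow> r < cmod (joukowski z)" and "1 < r"
  obtains c where "c > 0" "\<forall>\<^sub>F n in sequentially. \<forall>z\<in>K. c * r ^ n \<le> cmod (pz n z)"
proof -
  obtain R where R: "r < R" "\<And>z. z \<in> K \<Longrightarrow> R \<le> cmod (joukowski z)"
    using joukowski_gap_below[OF K] by blast
  have gt: "cmod (joukowski z) > 1" if "z \<in> K" for z using K(2)[OF that] \<open>1 < r\<close> by simp
  obtain d where d: "d > 0" "\<And>z x. z \<in> K \<Longrightarrow> x \<in> {-1..1} \<Longrightarrow> d \<le> cmod (z - complex_of_real x)"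
    using distance_to_interval[OF K(1) gt] by blast
  have "cmod (1 / joukowski z) \<le> 1 / R" if "z \<in> K" for z
    using R(2)[OF that] R(1) \<open>1 < r\<close> by (simp add: norm_divide frac_le)
  then obtain c where "c > 0" "\<forall>\<^sub>F n in sequentially. \<forall>z\<in>K. c * r ^ n \<le> cmod (pz n z)"
    using growth_lower[OF ratio_joukowski[OF K(1) gt] d, of R r] R(1) \<open>1 < r\<close> by auto
  then show thesis by (rule that)
qed

lemma ratio_joukowski_power:
  assumes K: "compact K" "\<And>z. z \<in> K \<Longrightarrow> cmod (joukowski z) > 1"
  shows "uniform_limit K (\<lambda>n z. pz (n - k) z / pz n z) (\<lambda>z. (1 / joukowski z) ^ k) sequentially"
proof -
  \<comment> \<open>With the index raised, the quotient telescopes by induction on \<open>k\<close>;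
    truncated subtraction enters only at the end.\<close>
  have "uniform_limit K (\<lambda>n z. pz n z / pz (n + k) z) (\<lambda>z. (1 / joukowski z) ^ k) sequentially"
  proof (induction k)
    case 0
    show ?case
    proof (rule uniform_limit_cong[THEN iffD2, OF _ _ uniform_limit_const])
      show "\<forall>\<^sub>F n in sequentially. \<forall>z\<in>K. pz n z / pz (n + 0) z = 1"
        by (intro always_eventually allI ballI) (simp add: pz_nonzero K)
    qed simp
  next
    case (Suc k)
    have next_ratio: "uniform_limit K (\<lambda>n z. pz (n + k) z / pz (Suc (n + k)) z) (\<lambda>z. 1 / joukowski z) sequentially"
      using filterlim_compose[OF ratio_joukowski[OF K] filterlim_add_const_nat_at_top] .
    have "uniform_limit K (\<lambda>n z. (pz n z / pz (n + k) z) * (pz (n + k) z / pz (Suc (n + k)) z))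
        (\<lambda>z. (1 / joukowski z) ^ k * (1 / joukowski z)) sequentially"
      by (rule uniform_lim_mult[OF Suc next_ratio]) (use bounded_inverse_joukowski_power[of k K] bounded_inverse_joukowski_power[of 1 K] in simp_all)
    then show ?case
      by (rule uniform_limit_cong[THEN iffD1, rotated -1])
        (simp_all add: pz_nonzero K mult.commute)
  qed
  from filterlim_compose[OF this filterlim_minus_const_nat_at_top]
  have "uniform_limit K (\<lambda>n z. pz (n - k) z / pz (n - k + k) z) (\<lambda>z. (1 / joukowski z) ^ k) sequentially" .
  moreover have "\<forall>\<^sub>F n in sequentially. \<forall>z\<in>K. pz (n - k) z / pz (n - k + k) z = pz (n - k) z / pz n z"
    using eventually_ge_at_top[of k] by eventually_elim simp
  ultimately show ?thesis
    by (rule uniform_limit_cong[THEN iffD1, rotated -1]) simp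
qed

end

lemma uniform_limit_sum:
  fixes f :: "'i \<Rightarrow> 'n \<Rightarrow> 'a \<Rightarrow> complex"
  assumes "\<And>i. i \<in> A \<Longrightarrow> uniform_limit K (f i) (l i) F"
  shows "uniform_limit K (\<lambda>n z. \<Sum>i\<in>A. f i n z) (\<lambda>z. \<Sum>i\<in>A. l i z) F"
  using assms
  by (induction A rule: infinite_finite_induct) (auto intro!: uniform_limit_add uniform_limit_const)

lemma uniform_limit_perturb:
  fixes f g :: "nat \<Rightarrow> 'a \<Rightarrow> complex"
  assumes g: "uniform_limit K g l sequentially" and a: "a \<longlonglongrightarrow> (0::real)"
    and "\<forall>\<^sub>F n in sequentially. \<forall>z\<in>K. cmod (f n z - g n z) \<le> a n"
  shows "uniform_limit K f l sequentially"
proof (rule uniform_limitI)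
  fix e :: real assume "e > 0"
  then have "e / 2 > 0" by simp
  show "\<forall>\<^sub>F n in sequentially. \<forall>z\<in>K. dist (f n z) (l z) < e"
    using assms(3) uniform_limitD[OF g \<open>e / 2 > 0\<close>] order_tendstoD(2)[OF a \<open>e / 2 > 0\<close>]
  proof eventually_elim
    case (elim n)
    show ?case
    proof
      fix z assume "z \<in> K"
      then have "dist (f n z) (g n z) \<le> a n" "dist (g n z) (l z) < e / 2" using elim by (auto simp: dist_norm)
      then show "dist (f n z) (l z) < e" using elim dist_triangle[of "f n z" "l z" "g n z"] by linarith
    qed
  qed
qed

text \<open>
  The data of the theorem after the measure and the operator have been eliminated: \<open>q n\<close> is
  \<open>kappa n * Q n\<close> for the leading coefficient \<open>kappa n\<close> of \<open>p n\<close>, and \<open>b\<close> is the polynomial with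
  \<open>2 ^ m * Phi \<rho> z = b (1 / joukowski z)\<close>.
\<close>

locale banded_combination = nevai_polys I p for I p +
  fixes m :: nat and \<gamma> :: "nat \<Rightarrow> nat \<Rightarrow> real" and b :: "real poly" and q :: "nat \<Rightarrow> complex \<Rightarrow> complex"
    and \<zeta>s :: "nat \<Rightarrow> complex" and \<zeta> :: complex
  assumes q: "n > m \<Longrightarrow> q n z = (\<Sum>k\<le>m. of_real (\<gamma> n k) * (pz (n - k) z - pz (n - k) (\<zeta>s n)))"
    and gamma_lim: "k \<le> m \<Longrightarrow> (\<lambda>n. \<gamma> n k) \<longlonglongrightarrow> coeff b k"
    and degree_b: "degree b \<le> m"
    and zeta_lim: "\<zeta>s \<longlonglongrightarrow> \<zeta>" and zeta: "cmod (joukowski \<zeta>) > 1"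
begin

text \<open>For \<open>n > m\<close>, \<open>q n z = S n z * pz n z - S n (\<zeta>s n) * pz n
  (\<zeta>s n)\<close> wherever these values of \<open>pz n\<close> are nonzero. The two limits
  differ only in which term dominates.\<close>

definition S :: "nat \<Rightarrow> complex \<Rightarrow> complex" where
  "S n z = (\<Sum>k\<le>m. of_real (\<gamma> n k) * (pz (n - k) z / pz n z))"

lemma S_limit:
  assumes K: "compact K" "\<And>z. z \<in> K \<Longrightarrow> cmod (joukowski z) > 1"
  shows "uniform_limit K S (\<lambda>z. poly (cpoly b) (1 / joukowski z)) sequentially"
proof -
  have const: "uniform_limit K (\<lambda>n z. complex_of_real (\<gamma> n k)) (\<lambda>z. complex_of_real (coeff b k)) sequentially" if "k \<le> m" for k
  proof (rule uniform_limitI)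
    fix e :: real assume "e > 0"
    from tendstoD[OF gamma_lim[OF that] this]
    show "\<forall>\<^sub>F n in sequentially. \<forall>z\<in>K. dist (complex_of_real (\<gamma> n k)) (complex_of_real (coeff b k)) < e"
      by (auto elim!: eventually_mono simp: dist_of_real)
  qed
  have bc: "bounded ((\<lambda>z. c) ` K)" for c :: complex
    by (rule bounded_subset[of "{c}"]) auto
  have "uniform_limit K (\<lambda>n z. \<Sum>k\<le>m. of_real (\<gamma> n k) * (pz (n - k) z / pz n z))
      (\<lambda>z. \<Sum>k\<le>m. of_real (coeff b k) * (1 / joukowski z) ^ k) sequentially"
    by (intro uniform_limit_sum uniform_lim_mult const ratio_joukowski_power K bounded_inverse_joukowski_power bc) auto
  moreover have "(\<Sum>k\<le>m. of_real (coeff b k) * x ^ k) = poly (cpoly b) x" for x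
    unfolding poly_altdef using degree_b
    by (intro sum.mono_neutral_cong_right) (auto simp: degree_map_poly coeff_map_poly coeff_eq_0)
  ultimately show ?thesis by (simp add: S_def[abs_def])
qed

text \<open>The points \<open>\<zeta>s n\<close> move with \<open>n\<close>, so estimates at them
  are taken uniformly over a compact set that contains them eventually.\<close>

lemma neighbourhood:
  assumes "r < cmod (joukowski \<zeta>)" "cmod (joukowski \<zeta>) < r'"
  shows "\<exists>K. compact K \<and> (\<forall>\<^sub>F n in sequentially. \<zeta>s n \<in> K) \<and>
    (\<forall>z\<in>K. r < cmod (joukowski z) \<and> cmod (joukowski z) < r')"
proof -
  have "open {z. r < cmod (joukowski z)}" "open {z. cmod (joukowski z) < r'}"
    by (intro open_Collect_less continuous_norm_joukowski continuous_intros)+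
  then have "open ({z. r < cmod (joukowski z)} \<inter> {z. cmod (joukowski z) < r'})" by (rule open_Int)
  moreover have "\<zeta> \<in> {z. r < cmod (joukowski z)} \<inter> {z. cmod (joukowski z) < r'}" using assms by simp
  ultimately obtain e where e: "e > 0" "cball \<zeta> e \<subseteq> {z. r < cmod (joukowski z)} \<inter> {z. cmod (joukowski z) < r'}"
    unfolding open_contains_cball by blast
  have "\<forall>\<^sub>F n in sequentially. \<zeta>s n \<in> cball \<zeta> e"
    using tendstoD[OF zeta_lim e(1)] by (auto elim!: eventually_mono simp: dist_commute)
  then show ?thesis using e by (intro exI[of _ "cball \<zeta> e"]) auto
qed

lemma S_zeta_limit: "(\<lambda>n. S n (\<zeta>s n)) \<longlonglongrightarrow> poly (cpoly b) (1 / joukowski \<zeta>)"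
proof -
  obtain K where K: "compact K" "\<forall>\<^sub>F n in sequentially. \<zeta>s n \<in> K" "\<And>z. z \<in> K \<Longrightarrow> 1 < cmod (joukowski z)"
    "\<And>z. z \<in> K \<Longrightarrow> cmod (joukowski z) < cmod (joukowski \<zeta>) + 1"
    using neighbourhood[OF zeta less_add_one] by blast
  let ?g = "\<lambda>z. poly (cpoly b) (1 / joukowski z)"
  have "isCont joukowski \<zeta>" using isCont_joukowski zeta norm_joukowski_gt_1_iff by blast
  then have "isCont ?g \<zeta>" by (intro continuous_intros) (simp_all add: joukowski_nonzero)
  then have g: "(\<lambda>n. ?g (\<zeta>s n)) \<longlonglongrightarrow> ?g \<zeta>" using zeta_lim by (rule isCont_tendsto_compose)
  have lim: "uniform_limit K S ?g sequentially" by (rule S_limit) (use K in auto)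
  have "(\<lambda>n. S n (\<zeta>s n) - ?g (\<zeta>s n)) \<longlonglongrightarrow> 0"
  proof (rule tendstoI)
    fix e :: real assume "e > 0"
    show "\<forall>\<^sub>F n in sequentially. dist (S n (\<zeta>s n) - ?g (\<zeta>s n)) 0 < e"
      using uniform_limitD[OF lim \<open>e > 0\<close>] K(2)
      by eventually_elim (auto simp: dist_norm)
  qed
  from tendsto_add[OF this g] show ?thesis by simp
qed

lemma exterior_limit:
  assumes K: "compact K" "K \<subseteq> {z. cmod (joukowski z) > cmod (joukowski \<zeta>)}"
  shows "uniform_limit K (\<lambda>n z. q n z / pz n z) (\<lambda>z. poly (cpoly b) (1 / joukowski z)) sequentially"
proof -
  obtain R where R: "cmod (joukowski \<zeta>) < R" "\<And>z. z \<in> K \<Longrightarrow> R \<le> cmod (joukowski z)"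
    using joukowski_gap_below[OF K(1)] K(2) by blast
  \<comment> \<open>Two radii between \<open>\<zeta>\<close> and \<open>K\<close>: up to constants,
    \<open>pz n (\<zeta>s n)\<close> is at most \<open>r1 ^ n\<close> and \<open>pz n\<close> is at
    least \<open>r2 ^ n\<close> on \<open>K\<close>. The constant term of \<open>q n\<close> thus
    has relative size \<open>(r1 / r2) ^ n\<close>.\<close>
  obtain r2 where r2: "cmod (joukowski \<zeta>) < r2" "r2 < R" using dense[OF R(1)] by blast
  obtain r1 where r1: "cmod (joukowski \<zeta>) < r1" "r1 < r2" using dense[OF r2(1)] by blast
  obtain U where U: "compact U" "\<forall>\<^sub>F n in sequentially. \<zeta>s n \<in> U"
    "\<And>z. z \<in> U \<Longrightarrow> 1 < cmod (joukowski z)" "\<And>z. z \<in> U \<Longrightarrow> cmod (joukowski z) < r1"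
    using neighbourhood[OF zeta r1(1)] by blast
  have "1 < r1" "1 < r2" using zeta r1 by auto
  obtain C where C: "C > 0" "\<forall>\<^sub>F n in sequentially. \<forall>z\<in>U. cmod (pz n z) \<le> C * r1 ^ n"
    using pz_upper[OF U(1,4) \<open>1 < r1\<close>] by blast
  have "r2 < cmod (joukowski z)" if "z \<in> K" for z using R(2)[OF that] r2 by simp
  then obtain c where c: "c > 0" "\<forall>\<^sub>F n in sequentially. \<forall>z\<in>K. c * r2 ^ n \<le> cmod (pz n z)"
    using pz_lower[OF K(1) _ \<open>1 < r2\<close>] by blast
  have gt: "cmod (joukowski z) > 1" if "z \<in> K" for z using K(2) that zeta by fastforce
  have "(\<lambda>n. (r1 / r2) ^ n) \<longlonglongrightarrow> 0" using r1 \<open>1 < r1\<close> \<open>1 < r2\<close> by (intro LIMSEQ_realpow_zero) auto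
  then have "(\<lambda>n. cmod (S n (\<zeta>s n)) * (C / c * (r1 / r2) ^ n)) \<longlonglongrightarrow> cmod (poly (cpoly b) (1 / joukowski \<zeta>)) * (C / c * 0)"
    by (intro tendsto_mult tendsto_norm S_zeta_limit tendsto_const)
  then have a: "(\<lambda>n. cmod (S n (\<zeta>s n)) * (C / c * (r1 / r2) ^ n)) \<longlonglongrightarrow> 0" by simp
  show ?thesis
  proof (rule uniform_limit_perturb[OF S_limit[OF K(1) gt] a])
    show "\<forall>\<^sub>F n in sequentially. \<forall>z\<in>K. cmod (q n z / pz n z - S n z) \<le> cmod (S n (\<zeta>s n)) * (C / c * (r1 / r2) ^ n)"
      using C(2) c(2) U(2) eventually_gt_at_top[of m]
    proof eventually_elim
      case (elim n)
      show ?case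
      proof
        fix z assume "z \<in> K"
        have nz: "pz n z \<noteq> 0" by (rule pz_nonzero[OF gt[OF \<open>z \<in> K\<close>]])
        have S': "(\<Sum>k\<le>m. of_real (\<gamma> n k) * pz (n - k) (\<zeta>s n)) = S n (\<zeta>s n) * pz n (\<zeta>s n)"
          using pz_nonzero[OF U(3)] elim by (simp add: S_def sum_distrib_right)
        have "q n z / pz n z - S n z = - (S n (\<zeta>s n) * pz n (\<zeta>s n)) / pz n z"
          using elim unfolding q[OF \<open>m < n\<close>] S'[symmetric]
          by (simp add: S_def right_diff_distrib sum_subtractf diff_divide_distrib sum_divide_distrib)
        then have "cmod (q n z / pz n z - S n z) = cmod (S n (\<zeta>s n)) * (cmod (pz n (\<zeta>s n)) / cmod (pz n z))"
          by (simp add: norm_mult norm_divide)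
        also have "cmod (pz n (\<zeta>s n)) / cmod (pz n z) \<le> (C * r1 ^ n) / (c * r2 ^ n)"
          using elim \<open>z \<in> K\<close> c(1) \<open>1 < r2\<close> C(1) \<open>1 < r1\<close> by (intro frac_le) auto
        also have "\<dots> = C / c * (r1 / r2) ^ n" by (simp add: power_divide)
        finally show "cmod (q n z / pz n z - S n z) \<le> cmod (S n (\<zeta>s n)) * (C / c * (r1 / r2) ^ n)"
          by (simp add: mult_left_mono)
      qed
    qed
  qed
qed

lemma interior_limit:
  assumes K: "compact K" "K \<subseteq> {z. cmod (joukowski z) < cmod (joukowski \<zeta>)}"
  shows "uniform_limit K (\<lambda>n z. q n z / pz n (\<zeta>s n)) (\<lambda>z. - poly (cpoly b) (1 / joukowski \<zeta>)) sequentially"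
proof -
  obtain s where s: "s < cmod (joukowski \<zeta>)" "\<And>z. z \<in> K \<Longrightarrow> cmod (joukowski z) \<le> s"
    using joukowski_gap_above[OF K(1)] K(2) by blast
  \<comment> \<open>The radii now have exchanged roles: \<open>r1\<close> bounds the growth on
    \<open>K\<close> and \<open>r2\<close> the growth at \<open>\<zeta>s n\<close>. \<open>K\<close>
    may meet \<open>[-1, 1]\<close>, so \<open>r1\<close> is kept above \<open>1\<close>.\<close>
  obtain r1 where r1: "max 1 s < r1" "r1 < cmod (joukowski \<zeta>)"
    using dense[of "max 1 s" "cmod (joukowski \<zeta>)"] s(1) zeta by auto
  obtain r2 where r2: "r1 < r2" "r2 < cmod (joukowski \<zeta>)" using dense[OF r1(2)] by blast
  obtain U where U: "compact U" "\<forall>\<^sub>F n in sequentially. \<zeta>s n \<in> U" "\<And>z. z \<in> U \<Longrightarrow> r2 < cmod (joukowski z)"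
    "\<And>z. z \<in> U \<Longrightarrow> cmod (joukowski z) < cmod (joukowski \<zeta>) + 1"
    using neighbourhood[OF r2(2) less_add_one] by blast
  have "1 < r1" "1 < r2" using r1 r2 by auto
  have "cmod (joukowski z) < r1" if "z \<in> K" for z using s(2)[OF that] r1 by simp
  then obtain C where C: "C > 0" "\<forall>\<^sub>F n in sequentially. \<forall>z\<in>K. cmod (pz n z) \<le> C * r1 ^ n"
    using pz_upper[OF K(1) _ \<open>1 < r1\<close>] by blast
  obtain c where c: "c > 0" "\<forall>\<^sub>F n in sequentially. \<forall>z\<in>U. c * r2 ^ n \<le> cmod (pz n z)"
    using pz_lower[OF U(1,3) \<open>1 < r2\<close>] by blast
  \<comment> \<open>An explicit threshold, because the growth bound is applied at the indices
    \<open>n - k\<close> with \<open>k \<le> m\<close>; hence \<open>n > N + m\<close>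
    below.\<close>
  obtain N where N: "\<And>n z. n \<ge> N \<Longrightarrow> z \<in> K \<Longrightarrow> cmod (pz n z) \<le> C * r1 ^ n"
    using C(2) by (auto simp: eventually_sequentially)
  have "(\<lambda>n. (r1 / r2) ^ n) \<longlonglongrightarrow> 0" using r2 \<open>1 < r1\<close> \<open>1 < r2\<close> by (intro LIMSEQ_realpow_zero) auto
  then have "(\<lambda>n. (\<Sum>k\<le>m. \<bar>\<gamma> n k\<bar>) * (C / c * (r1 / r2) ^ n)) \<longlonglongrightarrow> (\<Sum>k\<le>m. \<bar>coeff b k\<bar>) * (C / c * 0)"
    by (intro tendsto_mult tendsto_sum tendsto_rabs gamma_lim tendsto_const) auto
  then have a: "(\<lambda>n. (\<Sum>k\<le>m. \<bar>\<gamma> n k\<bar>) * (C / c * (r1 / r2) ^ n)) \<longlonglongrightarrow> 0" by simp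
  have main: "uniform_limit K (\<lambda>n z. - S n (\<zeta>s n)) (\<lambda>z. - poly (cpoly b) (1 / joukowski \<zeta>)) sequentially"
  proof (rule uniform_limitI)
    fix e :: real assume "e > 0"
    from tendstoD[OF tendsto_minus[OF S_zeta_limit] this]
    show "\<forall>\<^sub>F n in sequentially. \<forall>z\<in>K. dist (- S n (\<zeta>s n)) (- poly (cpoly b) (1 / joukowski \<zeta>)) < e"
      by (auto elim!: eventually_mono)
  qed
  show ?thesis
  proof (rule uniform_limit_perturb[OF main a])
    show "\<forall>\<^sub>F n in sequentially. \<forall>z\<in>K. cmod (q n z / pz n (\<zeta>s n) - - S n (\<zeta>s n)) \<le> (\<Sum>k\<le>m. \<bar>\<gamma> n k\<bar>) * (C / c * (r1 / r2) ^ n)"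
      using c(2) U(2) eventually_gt_at_top[of "N + m"]
    proof eventually_elim
      case (elim n)
      have lower: "c * r2 ^ n \<le> cmod (pz n (\<zeta>s n))" "0 < c * r2 ^ n" using elim c(1) \<open>1 < r2\<close> by auto
      then have nz: "pz n (\<zeta>s n) \<noteq> 0" by auto
      show ?case
      proof
        fix z assume z: "z \<in> K"
        \<comment> \<open>Inside the ellipse \<open>pz n z\<close> may vanish, so the remaining sum
          is estimated term by term against \<open>pz n (\<zeta>s n)\<close> without passing through
          \<open>S n z\<close>.\<close>
        have "q n z / pz n (\<zeta>s n) - - S n (\<zeta>s n) = (\<Sum>k\<le>m. of_real (\<gamma> n k) * (pz (n - k) z / pz n (\<zeta>s n)))"
          using elim by (subst q) (auto simp: S_def right_diff_distrib sum_subtractf diff_divide_distrib sum_divide_distrib)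
        also have "cmod \<dots> \<le> (\<Sum>k\<le>m. \<bar>\<gamma> n k\<bar> * (C / c * (r1 / r2) ^ n))"
        proof (intro order_trans[OF norm_sum] sum_mono)
          fix k assume k: "k \<in> {..m}"
          have "cmod (pz (n - k) z) \<le> C * r1 ^ (n - k)" using k elim z by (intro N) auto
          also have "\<dots> \<le> C * r1 ^ n" using C(1) \<open>1 < r1\<close> by (intro mult_left_mono power_increasing) auto
          finally have "cmod (pz (n - k) z) / cmod (pz n (\<zeta>s n)) \<le> (C * r1 ^ n) / (c * r2 ^ n)"
            using lower C(1) \<open>1 < r1\<close> by (intro frac_le) auto
          also have "\<dots> = C / c * (r1 / r2) ^ n" by (simp add: power_divide)
          finally show "cmod (of_real (\<gamma> n k) * (pz (n - k) z / pz n (\<zeta>s n))) \<le> \<bar>\<gamma> n k\<bar> * (C / c * (r1 / r2) ^ n)"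
            unfolding norm_mult norm_divide norm_of_real by (rule mult_left_mono) simp
        qed
        finally show "cmod (q n z / pz n (\<zeta>s n) - - S n (\<zeta>s n)) \<le> (\<Sum>k\<le>m. \<bar>\<gamma> n k\<bar>) * (C / c * (r1 / r2) ^ n)"
          by (simp only: sum_distrib_right)
      qed
    qed
  qed
qed

end

section \<open>The theorem\<close>

lemma jacobi_op_parts:
  "poly (jacobi_op \<alpha> \<beta> q) (of_real x) =
     of_real (poly (jop \<alpha> \<beta> (map_poly Re q)) x) + \<i> * of_real (poly (jop \<alpha> \<beta> (map_poly Im q)) x)"
proof -
  have q: "q = cpoly (map_poly Re q) + smult \<i> (cpoly (map_poly Im q))"
    by (rule poly_eqI) (simp add: coeff_map_poly complex_eq_iff)
  have pd: "pderiv (cpoly f) = cpoly (pderiv f)" for f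
    by (rule poly_eqI) (simp add: coeff_map_poly coeff_pderiv)
  have neg: "cpoly (- f) = - cpoly f" for f
    by (rule poly_eqI) (simp add: coeff_map_poly)
  have "jacobi_op \<alpha> \<beta> (cpoly f + smult \<i> (cpoly g)) = cpoly (jop \<alpha> \<beta> f) + smult \<i> (cpoly (jop \<alpha> \<beta> g))" for f g
  proof (rule poly_eq_poly_eq_iff[THEN iffD1], rule ext)
    fix z
    show "poly (jacobi_op \<alpha> \<beta> (cpoly f + smult \<i> (cpoly g))) z = poly (cpoly (jop \<alpha> \<beta> f) + smult \<i> (cpoly (jop \<alpha> \<beta> g))) z"
      by (simp add: jacobi_op_def jop_def pderiv_add pderiv_smult pd cpoly_add cpoly_mult cpoly_smult neg map_poly_pCons
          algebra_simps del: mult_pCons_left)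
  qed
  then show ?thesis by (subst q) (simp add: poly_cpoly_of_real)
qed

locale divided_jacobi_sequence = divided_jacobi_measure +
  fixes P :: "nat \<Rightarrow> real poly" and Q :: "nat \<Rightarrow> complex poly"
  assumes P: "monic_orthogonal_poly (jacobi_measure \<alpha> \<beta>) n (P n)"
    and Q: "n > m \<Longrightarrow> monic_jacobi_op_orthogonal_poly \<alpha> \<beta> \<mu> n (Q n)"
begin

interpretation I: positive_functional I by (rule positive_I)

interpretation J: positive_functional J by (rule positive_J)

definition kappa :: "nat \<Rightarrow> real" where "kappa n = 1 / sqrt (I (P n * P n))"

definition p :: "nat \<Rightarrow> real poly" where "p n = smult (kappa n) (P n)"

lemma P_nonzero: "P n \<noteq> 0" and degree_P: "degree (P n) = n" and lead_P: "lead_coeff (P n) = 1"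
  using P[of n] by (auto simp: monic_orthogonal_poly_def)

lemma kappa_pos: "kappa n > 0"
  using I_definite[OF P_nonzero] by (simp add: kappa_def)

lemma P_orthogonal:
  assumes "degree q < n"
  shows "I (P n * q) = 0"
proof -
  have "I (P n * q) = I (\<Sum>k\<le>degree q. smult (coeff q k) (P n * monom 1 k))"
    by (subst (1) poly_as_sum_of_monoms[of q, symmetric]) (simp add: sum_distrib_left smult_monom flip: mult_smult_right)
  also have "\<dots> = (\<Sum>k\<le>degree q. coeff q k * I (P n * monom 1 k))" by (simp only: I.sum I.smult)
  also have "\<dots> = 0"
    using P[of n] assms by (intro sum.neutral) (auto simp: monic_orthogonal_poly_def I_def poly_monom)
  finally show ?thesis .
qed

sublocale O: jacobi_polys I p \<alpha> \<beta>
proof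
  show "degree (p n) = n" for n using kappa_pos[of n] by (simp add: p_def degree_P)
  show "lead_coeff (p n) > 0" for n using kappa_pos[of n] by (simp add: p_def lead_coeff_smult lead_P)
  show "I (p i * p j) = (if i = j then 1 else 0)" for i j
  proof -
    have eq: "I (p i * p j) = kappa i * kappa j * I (P i * P j)" by (simp add: p_def I.smult)
    have "I (P i * P j) = 0" if "i \<noteq> j"
      using that P_orthogonal[of "P i" j] P_orthogonal[of "P j" i]
      by (cases "i < j") (auto simp: degree_P mult.commute)
    moreover have "kappa i * kappa i * I (P i * P i) = 1"
      using I_definite[OF P_nonzero[of i]] by (simp add: kappa_def)
    ultimately show ?thesis by (auto simp: eq)
  qed
qed (rule alpha beta pearson)+

lemma lead_p: "lead_coeff (p n) = kappa n"
  by (simp add: p_def lead_coeff_smult lead_P)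

lemma poly_P: "poly (cpoly (P n)) z = O.pz n z / kappa n"
  using kappa_pos[of n] by (simp add: O.pz_def p_def cpoly_smult)

definition U :: "nat \<Rightarrow> real poly" where "U n = map_poly Re (Q n)"

definition V :: "nat \<Rightarrow> real poly" where "V n = map_poly Im (Q n)"

lemma Q_coeff: "n > m \<Longrightarrow> coeff (Q n) n = 1" and degree_Q: "n > m \<Longrightarrow> degree (Q n) = n"
  using Q[of n] by (auto simp: monic_jacobi_op_orthogonal_poly_def)

lemma Q_orthogonal:
  assumes "n > m" "degree q < n"
  shows "J (jop \<alpha> \<beta> (U n) * q) = 0" "J (jop \<alpha> \<beta> (V n) * q) = 0"
proof -
  have mono: "J (jop \<alpha> \<beta> (U n) * monom 1 k) = 0 \<and> J (jop \<alpha> \<beta> (V n) * monom 1 k) = 0" if "k < n" for k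
  proof -
    let ?u = "\<lambda>x. poly (jop \<alpha> \<beta> (U n) * monom 1 k) x" and ?v = "\<lambda>x. poly (jop \<alpha> \<beta> (V n) * monom 1 k) x"
    have eq: "poly (jacobi_op \<alpha> \<beta> (Q n)) (complex_of_real x) * complex_of_real x ^ k = of_real (?u x) + \<i> * of_real (?v x)" for x
      by (simp add: jacobi_op_parts U_def V_def poly_monom algebra_simps)
    have "(\<integral>x. poly (jacobi_op \<alpha> \<beta> (Q n)) (complex_of_real x) * complex_of_real x ^ k \<partial>\<mu>) = 0"
      using Q[OF assms(1)] that by (simp add: monic_jacobi_op_orthogonal_poly_def)
    then have "(\<integral>x. of_real (?u x) + \<i> * of_real (?v x) \<partial>\<mu>) = (0 :: complex)"
      by (simp only: eq)
    moreover have "integrable \<mu> (\<lambda>x. complex_of_real (?u x))" "integrable \<mu> (\<lambda>x. complex_of_real (?v x))"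
      by (intro integrable_of_real integrable_mu)+
    ultimately have "complex_of_real (J (jop \<alpha> \<beta> (U n) * monom 1 k)) + \<i> * of_real (J (jop \<alpha> \<beta> (V n) * monom 1 k)) = 0"
      by (simp only: J_def Bochner_Integration.integral_add integrable_mult_right integral_mult_right_zero integral_complex_of_real)
    then show ?thesis by (simp add: complex_eq_iff)
  qed
  have exp: "J (f * q) = (\<Sum>k\<le>degree q. coeff q k * J (f * monom 1 k))" for f
  proof -
    have "J (f * q) = J (\<Sum>k\<le>degree q. smult (coeff q k) (f * monom 1 k))"
      by (subst (1) poly_as_sum_of_monoms[of q, symmetric]) (simp add: sum_distrib_left smult_monom flip: mult_smult_right)
    then show ?thesis by (simp only: J.sum J.smult)
  qed
  show "J (jop \<alpha> \<beta> (U n) * q) = 0" "J (jop \<alpha> \<beta> (V n) * q) = 0"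
    unfolding exp using mono assms(2) by (auto intro!: sum.neutral)
qed

text \<open>Definiteness passes from \<open>I\<close> to \<open>J\<close> because
  \<open>\<rho>\<close> is bounded: \<open>I (f * f) \<le> G * J (f * f)\<close>.\<close>

lemma J_square_eq_0:
  assumes "J (f * f) = 0"
  shows "f = 0"
proof (rule ccontr)
  assume "f \<noteq> 0"
  obtain G where G: "G > 0" "\<And>x. x \<in> {-1..1} \<Longrightarrow> poly \<rho> x \<le> G" using rho_bounded by blast
  have "I (f * f) = J (\<rho> * (f * f))" by (rule J_mult[symmetric])
  also have "\<dots> \<le> J (smult G (f * f))"
    by (rule J.mono) (use G in \<open>auto intro: mult_right_mono\<close>)
  finally show False using I_definite[OF \<open>f \<noteq> 0\<close>] assms by (simp add: J.smult)
qed

text \<open>\<open>Q n\<close> is monic, so its imaginary part has degree below \<open>n\<close>.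
  Its image under the operator is then \<open>J\<close>-orthogonal to itself and vanishes, and the
  kernel is constant.\<close>

lemma degree_V:
  assumes "n > m"
  shows "degree (V n) = 0"
proof -
  have "degree (V n) < n"
  proof (rule degree_lessI)
    show "\<forall>k\<ge>n. coeff (V n) k = 0"
    proof (intro allI impI)
      fix k assume "n \<le> k"
      then show "coeff (V n) k = 0" using Q_coeff[OF assms] degree_Q[OF assms]
        by (cases "k = n") (auto simp: V_def coeff_map_poly coeff_eq_0)
    qed
  qed (use assms in auto)
  then have "degree (jop \<alpha> \<beta> (V n)) < n" using degree_jop_le[of \<alpha> \<beta> "V n"] by simp
  then have "jop \<alpha> \<beta> (V n) = 0" by (intro J_square_eq_0 Q_orthogonal(2)[OF assms])
  then show ?thesis by (rule jop_eq_0[OF alpha beta])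
qed

lemma U_coeff: "n > m \<Longrightarrow> coeff (U n) n = 1"
  by (simp add: U_def coeff_map_poly Q_coeff)

lemma degree_U: "n > m \<Longrightarrow> degree (U n) = n"
  using U_coeff[of n] degree_Q[of n]
  by (intro antisym le_degree degree_le) (auto simp: U_def coeff_map_poly coeff_eq_0)

text \<open>The \<open>n\<close>th monic orthogonal polynomial of \<open>\<mu>\<close> times
  \<open>kappa n\<close>: dividing by \<open>eigenvalue\<close> makes the image of the monic
  \<open>U n\<close> monic.\<close>

definition l :: "nat \<Rightarrow> real poly" where
  "l n = smult (kappa n / eigenvalue \<alpha> \<beta> n) (jop \<alpha> \<beta> (U n))"

lemma l_props:
  assumes "n > m"
  shows "degree (l n) = n" "lead_coeff (l n) = lead_coeff (p n)" "degree q < n \<Longrightarrow> J (l n * q) = 0"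
proof -
  have ev: "eigenvalue \<alpha> \<beta> n \<noteq> 0" using eigenvalue_nonzero[OF alpha beta] assms by simp
  have top: "coeff (l n) n = kappa n"
    using ev degree_U[OF assms] U_coeff[OF assms] by (simp add: l_def coeff_jop coeff_eq_0)
  show deg: "degree (l n) = n"
  proof (rule antisym)
    show "degree (l n) \<le> n" unfolding l_def
      using degree_smult_le degree_jop_le degree_U[OF assms] by (metis order_trans)
    show "n \<le> degree (l n)" using top kappa_pos[of n] by (intro le_degree) simp
  qed
  show "lead_coeff (l n) = lead_coeff (p n)" using top by (simp add: deg lead_p)
  show "J (l n * q) = 0" if "degree q < n"
    using Q_orthogonal(1)[OF assms that] by (simp add: l_def J.smult)
qed

text \<open>The quotient of eigenvalues is the effect of inverting the operator on the component
  \<open>p (n - k)\<close> of \<open>l n\<close>.\<close>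

definition coef :: "nat \<Rightarrow> nat \<Rightarrow> real" where
  "coef n k = eigenvalue \<alpha> \<beta> n / eigenvalue \<alpha> \<beta> (n - k) * I (l n * p (n - k))"

text \<open>The origin of the band width: \<open>I\<close> is \<open>J\<close> with a factor
  \<open>\<rho>\<close> of degree \<open>m\<close>, and \<open>\<rho> * p j\<close> still has degree
  below \<open>n\<close>.\<close>

lemma I_l_p_far:
  assumes "n > m" "j + m < n"
  shows "I (l n * p j) = 0"
proof -
  have "degree (\<rho> * p j) < n" using degree_mult_le[of \<rho> "p j"] degree_rho assms by (simp add: O.degree_p)
  then have "J (l n * (\<rho> * p j)) = 0" by (rule l_props(3)[OF assms(1)])
  then show ?thesis using J_mult[of "l n * p j"] by (simp add: mult.left_commute)
qed

lemma U_expansion: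
  assumes "n > m"
  obtains c where "U n = [:c:] + (\<Sum>k\<le>m. smult (coef n k / kappa n) (p (n - k)))"
proof -
  have ev: "eigenvalue \<alpha> \<beta> k \<noteq> 0" if "k > 0" for k using eigenvalue_nonzero[OF alpha beta that] .
  have "l n = (\<Sum>j\<le>n. smult (I (l n * p j)) (p j))"
    by (rule O.expansion) (simp add: l_props(1)[OF assms])
  also have "\<dots> = (\<Sum>j\<in>(\<lambda>k. n - k) ` {..m}. smult (I (l n * p j)) (p j))"
  proof (rule sum.mono_neutral_right)
    show "\<forall>j\<in>{..n} - (\<lambda>k. n - k) ` {..m}. smult (I (l n * p j)) (p j) = 0"
    proof
      fix j assume j: "j \<in> {..n} - (\<lambda>k. n - k) ` {..m}"
      have "j + m < n"
      proof (rule ccontr)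
        assume "\<not> j + m < n"
        then have "n - j \<in> {..m}" "j = n - (n - j)" using j by auto
        then show False using j by blast
      qed
      then show "smult (I (l n * p j)) (p j) = 0" by (simp add: I_l_p_far[OF assms])
    qed
  qed auto
  also have "\<dots> = (\<Sum>k\<le>m. smult (I (l n * p (n - k))) (p (n - k)))"
    by (subst sum.reindex) (use assms in \<open>auto simp: inj_on_def\<close>)
  finally have l: "l n = (\<Sum>k\<le>m. smult (I (l n * p (n - k))) (p (n - k)))" .
  \<comment> \<open>As \<open>n > m\<close>, every index \<open>n - k\<close> is positive and its
    eigenvalue nonzero, so the operator is inverted term by term. \<open>U n\<close> and
    \<open>W\<close> can differ only by its kernel.\<close>
  define W where "W = (\<Sum>k\<le>m. smult (coef n k / kappa n) (p (n - k)))"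
  have "jop \<alpha> \<beta> W = (\<Sum>k\<le>m. smult (eigenvalue \<alpha> \<beta> n / kappa n) (smult (I (l n * p (n - k))) (p (n - k))))"
    unfolding W_def jop_sum jop_smult O.jop_p
    using ev assms by (intro sum.cong) (auto simp: coef_def field_simps)
  also have "\<dots> = smult (eigenvalue \<alpha> \<beta> n / kappa n) (l n)"
  proof (rule real_poly_eqI)
    fix x
    have "poly (l n) x = (\<Sum>k\<le>m. I (l n * p (n - k)) * poly (p (n - k)) x)"
      using arg_cong[OF l, of "\<lambda>q. poly q x"] by (simp only: poly_sum poly_smult)
    then show "poly (\<Sum>k\<le>m. smult (eigenvalue \<alpha> \<beta> n / kappa n) (smult (I (l n * p (n - k))) (p (n - k)))) x =
        poly (smult (eigenvalue \<alpha> \<beta> n / kappa n) (l n)) x"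
      by (simp only: poly_sum poly_smult sum_distrib_left)
  qed
  also have "\<dots> = jop \<alpha> \<beta> (U n)"
    using ev[of n] kappa_pos[of n] assms by (simp add: l_def)
  finally have "jop \<alpha> \<beta> (U n - W) = 0" by (simp add: jop_diff)
  then have "degree (U n - W) = 0" by (rule jop_eq_0[OF alpha beta])
  then obtain c where "U n - W = [:c:]" by (metis degree_eq_zeroE)
  then have "U n = [:c:] + W" by (simp add: algebra_simps)
  then show thesis using that by (simp add: W_def)
qed

text \<open>The constant from the kernel and the constant imaginary part both cancel in
  \<open>poly (Q n) z - poly (Q n) y\<close>.\<close>

lemma Q_eq:
  assumes "n > m" "poly (Q n) y = 0"
  shows "kappa n * poly (Q n) z = (\<Sum>k\<le>m. of_real (coef n k) * (O.pz (n - k) z - O.pz (n - k) y))"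
proof -
  obtain c where c: "U n = [:c:] + (\<Sum>k\<le>m. smult (coef n k / kappa n) (p (n - k)))"
    using U_expansion[OF assms(1)] by blast
  obtain v where v: "V n = [:v:]" using degree_V[OF assms(1)] by (metis degree_eq_zeroE)
  have "Q n = cpoly (U n) + smult \<i> (cpoly (V n))"
    by (rule poly_eqI) (simp add: U_def V_def coeff_map_poly complex_eq_iff)
  then have Qz: "poly (Q n) z = (of_real c + \<i> * of_real v) + (\<Sum>k\<le>m. of_real (coef n k / kappa n) * O.pz (n - k) z)" for z
    by (simp add: c v cpoly_add cpoly_sum cpoly_smult poly_sum map_poly_pCons O.pz_def)
  have "poly (Q n) z = poly (Q n) z - poly (Q n) y" using assms(2) by simp
  also have "\<dots> = (\<Sum>k\<le>m. of_real (coef n k / kappa n) * (O.pz (n - k) z - O.pz (n - k) y))"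
    unfolding Qz by (simp add: right_diff_distrib sum_subtractf)
  finally show ?thesis using kappa_pos[of n] by (simp only: sum_distrib_left) (intro sum.cong, auto)
qed

theorem limits:
  assumes zeros: "\<And>n. n > m \<Longrightarrow> poly (Q n) (\<zeta>s n) = 0"
    and lim: "\<zeta>s \<longlonglongrightarrow> \<zeta>" and zeta: "\<zeta> \<notin> complex_of_real ` {-1..1}"
  shows "compact K \<Longrightarrow> K \<subseteq> {z. cmod (joukowski z) > cmod (joukowski \<zeta>)} \<Longrightarrow>
      uniform_limit K (\<lambda>n z. poly (Q n) z / poly (cpoly (P n)) z) (\<lambda>z. 2 ^ m * Phi \<rho> z) sequentially"
    and "compact K \<Longrightarrow> K \<subseteq> {z. cmod (joukowski z) < cmod (joukowski \<zeta>)} \<Longrightarrow>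
      uniform_limit K (\<lambda>n z. poly (Q n) z / poly (cpoly (P n)) (\<zeta>s n)) (\<lambda>z. - (2 ^ m * Phi \<rho> \<zeta>)) sequentially"
proof -
  have pos: "poly \<rho> x \<noteq> 0" if "x \<in> {-1<..<1}" for x by (rule rho_pos[OF that])
  obtain B C where B: "C > 0" "square_approximable B"
    "\<forall>t. cmod t = 1 \<longrightarrow> poly \<rho> (Re t) = C * (cmod (poly (cpoly B) t))\<^sup>2"
    "\<forall>z. z \<notin> complex_of_real ` {-1..1} \<longrightarrow> 2 ^ degree \<rho> * Phi \<rho> z = poly (cpoly B) (1 / joukowski z)"
    by (rule divisor_data, rule rho_nonzero, erule rho_nonneg, erule pos, rule that)
  obtain \<rho>1 D where D: "lead_coeff \<rho>1 = 1" "square_approximable D"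
    "\<forall>t. cmod t = 1 \<longrightarrow> 4 ^ degree \<rho>1 * (poly \<rho>1 (Re t))\<^sup>2 = (cmod (poly (cpoly D) t))\<^sup>2"
    "\<forall>\<epsilon>>0. \<exists>h. \<forall>x\<in>{-1..1}. (poly \<rho>1 x)\<^sup>2 \<le> poly h x * poly \<rho> x \<and>
      poly h x * poly \<rho> x \<le> (poly \<rho>1 x)\<^sup>2 + \<epsilon> * poly \<rho> x"
    by (rule zeros_data, rule rho_nonzero, erule rho_nonneg, erule pos, rule that)
  interpret DF: divided_functional I p J \<rho> B C \<rho>1 D m l
    by unfold_locales (use J_mult B D l_props in auto)
  have zeta_gt: "cmod (joukowski \<zeta>) > 1" using zeta norm_joukowski_gt_1_iff by blast
  have coef_lim: "(\<lambda>n. coef n k) \<longlonglongrightarrow> coeff B k" for k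
  proof -
    \<comment> \<open>The quotient of eigenvalues tends to \<open>1\<close>, so inverting the
      operator leaves the limiting coefficients unchanged.\<close>
    have "(\<lambda>n. coef (n + k) k) \<longlonglongrightarrow> 1 * coeff B k"
      unfolding coef_def diff_add_inverse2
      by (intro tendsto_mult eigenvalue_quotient_limit DF.coefficient_limit)
    then show ?thesis by (simp add: LIMSEQ_offset)
  qed
  \<comment> \<open>The degree bound on \<open>B\<close> is read off from the limits: beyond
    \<open>m\<close> the coefficients of \<open>l (n + k)\<close> vanish identically.\<close>
  have "coeff B k = 0" if "k > m" for k
  proof -
    have "(\<lambda>n. I (l (n + k) * p n)) = (\<lambda>n. 0)" using that by (auto intro!: I_l_p_far)
    then show ?thesis using DF.coefficient_limit[of k] by (simp add: LIMSEQ_const_iff)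
  qed
  then have "degree B \<le> m" by (simp add: degree_le)
  interpret BC: banded_combination I p m coef B "\<lambda>n z. kappa n * poly (Q n) z" \<zeta>s \<zeta>
    by unfold_locales (use Q_eq zeros coef_lim \<open>degree B \<le> m\<close> lim zeta_gt in auto)
  have quot: "poly (Q n) z / poly (cpoly (P n)) y = kappa n * poly (Q n) z / O.pz n y" for n z y
    by (simp add: poly_P)
  have Phi: "2 ^ m * Phi \<rho> z = poly (cpoly B) (1 / joukowski z)" if "cmod (joukowski z) > 1" for z
    using B(4) that norm_joukowski_gt_1_iff[of z] by (simp add: degree_rho)
  show "uniform_limit K (\<lambda>n z. poly (Q n) z / poly (cpoly (P n)) z) (\<lambda>z. 2 ^ m * Phi \<rho> z) sequentially"
    if K: "compact K" "K \<subseteq> {z. cmod (joukowski z) > cmod (joukowski \<zeta>)}"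
  proof -
    have "2 ^ m * Phi \<rho> z = poly (cpoly B) (1 / joukowski z)" if "z \<in> K" for z
      using K(2) that zeta_gt by (intro Phi) fastforce
    then show ?thesis unfolding quot
      using BC.exterior_limit[OF K] by (simp cong: uniform_limit_cong')
  qed
  show "uniform_limit K (\<lambda>n z. poly (Q n) z / poly (cpoly (P n)) (\<zeta>s n)) (\<lambda>z. - (2 ^ m * Phi \<rho> \<zeta>)) sequentially"
    if K: "compact K" "K \<subseteq> {z. cmod (joukowski z) < cmod (joukowski \<zeta>)}"
    unfolding quot Phi[OF zeta_gt] by (rule BC.interior_limit[OF K])
qed

end

theorem theorem1p2:
  fixes \<alpha> \<beta> :: real and m :: nat
    and \<mu> :: "real measure" and \<rho> :: "real poly"
    and \<zeta> :: complex and \<zeta>s :: "nat \<Rightarrow> complex"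
    and P :: "nat \<Rightarrow> real poly" and Q :: "nat \<Rightarrow> complex poly"
  assumes "\<alpha> > -1" and "\<beta> > -1"
    and "\<zeta>s \<longlonglongrightarrow> \<zeta>" and "\<zeta> \<notin> complex_of_real ` {-1..1}"
    and "\<mu> \<in> jacobi_class m \<alpha> \<beta>" and "jacobi_divided \<alpha> \<beta> m \<rho> \<mu>"
    and "\<forall>n. monic_orthogonal_poly (jacobi_measure \<alpha> \<beta>) n (P n)"
    and "\<forall>n>m. monic_jacobi_op_orthogonal_poly \<alpha> \<beta> \<mu> n (Q n) \<and> poly (Q n) (\<zeta>s n) = 0"
  shows "(\<forall>K. compact K \<and> K \<subseteq> {z. cmod (joukowski z) > cmod (joukowski \<zeta>)} \<longrightarrow>
           uniform_limit K
             (\<lambda>n z. poly (Q n) z / poly (map_poly complex_of_real (P n)) z)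
             (\<lambda>z. 2 ^ m * Phi \<rho> z) sequentially)
         \<and> (\<forall>K. compact K \<and>
             K \<subseteq> {z. cmod (joukowski z) < cmod (joukowski \<zeta>)} - complex_of_real ` {-1..1} \<longrightarrow>
           uniform_limit K
             (\<lambda>n z. poly (Q n) z / poly (map_poly complex_of_real (P n)) (\<zeta>s n))
             (\<lambda>z. - (2 ^ m * Phi \<rho> \<zeta>)) sequentially)
         \<and> ((INF x\<in>{-1..1}. cmod (\<zeta> - complex_of_real x)) > 2 \<longrightarrow>
         (\<forall>K. compact K \<and> K \<subseteq> {z. cmod (joukowski z) < cmod (joukowski \<zeta>)} \<longrightarrow>
           uniform_limit K
             (\<lambda>n z. poly (Q n) z / poly (map_poly complex_of_real (P n)) (\<zeta>s n))
             (\<lambda>z. - (2 ^ m * Phi \<rho> \<zeta>)) sequentially))"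
proof -
  have "finite_measure \<mu>" using assms(5) by (simp add: jacobi_class_def)
  interpret divided_jacobi_sequence \<alpha> \<beta> m \<rho> \<mu> P Q
    by (intro divided_jacobi_sequence.intro divided_jacobi_measure.intro divided_jacobi_sequence_axioms.intro)
      (use assms \<open>finite_measure \<mu>\<close> in blast)+
  have zeros: "\<And>n. n > m \<Longrightarrow> poly (Q n) (\<zeta>s n) = 0" using assms by blast
  note limits = limits[OF zeros assms(3,4)]
  show ?thesis by (intro conjI allI impI limits) auto
qed

end
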